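(* Let $a,b$ be real numbers with $a>-1$, $-1<b<1$, $|b|\le 1+a$, and let $\xi=(\xi_t)_{t\ge 0}$ be the weighted fractional Brownian motion with parameters $a$ and $b$, i.e. the centered Gaussian process with covariance $$E\xi_s\xi_t=\int_0^{s\wedge t}u^a\left[(t-u)^b+(s-u)^b\right]du,\qquad s,t\ge 0.$$ Then $\xi$ has the following properties. (1) Self-similarity: for each $c>0$, $(\xi_{ct})_{t\ge 0}\stackrel{d}{=}(c^{(1+a+b)/2}\xi_t)_{t\ge 0}$. (2) Second moments of increments: for $0\le s<t$, $$E(\xi_t-\xi_s)^2=2\int_s^t u^a(t-u)^b\,du .$$ Moreover: (2i) If $a\ge 0$, then for every $T>0$ there is a constant $C=C(T)<\infty$ such that $E(\xi_t-\xi_s)^2\le C|t-s|^{b+1}$ for all $s,t\in[0,T]$. If $a<0$, then for every $\varepsilon>0$ there is a constant $C=C(\varepsilon)<\infty$ such that $E(\xi_t-\xi_s)^2\le C|t-s|^{b+1}$ for all $s,t\ge\varepsilon$. (2ii) If $a<0$ and $1+a+b>0$, there is a constant $C<\infty$ such that $E(\xi_t-\xi_s)^2\le C|t-s|^{1+a+b}$ for all $s,t\ge 0$. (2iii) If $a>0$, then for every $\varepsilon>0$ there is a constant $C=C(\varepsilon)>0$ such that $E(\xi_t-\xi_s)^2\ge C|t-s|^{b+1}$ for all $s,t\ge\varepsilon$. If $a\le 0$, then for every $T>0$ there is a constant $C=C(T)>0$ such that $E(\xi_t-\xi_s)^2\ge C|t-s|^{b+1}$ for all $s,t\in[0,T]$.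 (3) Path continuity: $\xi$ is a continuous process, with the only exception of the case $a<0$, $b<0$, $a+b=-1$, in which $\xi$ is discontinuous at $0$. (4) Covariance of increments: for $0\le r<v\le s<t$, put $Q(r,v,s,t)=E\big((\xi_t-\xi_s)(\xi_v-\xi_r)\big)$. Then $$Q(r,v,s,t)=\int_r^v u^a\left[(t-u)^b-(s-u)^b\right]du,$$ hence $Q(r,v,s,t)>0$ if $b>0$, $Q(r,v,s,t)=0$ if $b=0$, and $Q(r,v,s,t)<0$ if $b<0$. (5) Long-range dependence: for $0\le r<v\le s<t$, $$\lim_{T\to\infty}T^{1-b}\,Q(r,v,s+T,t+T)=\frac{b}{a+1}(t-s)\left(v^{a+1}-r^{a+1}\right).$$ (6) Asymptotic homogeneity: the finite-dimensional distributions of the process $\big(T^{-a/2}(\xi_{t+T}-\xi_T)\big)_{t\ge 0}$ converge, as $T\to\infty$, to those of fractional Brownian motion with Hurst parameter $(1+b)/2$ multiplied by $(2/(1+b))^{1/2}$. (7) Short- and long-time asymptotics: for every $t\ge 0$ (with $t>0$ if $a<0$), $$\lim_{\varepsilon\searrow 0}\varepsilon^{-b-1}E(\xi_{t+\varepsilon}-\xi_t)^2=\frac{2}{b+1}t^a,$$ and for every $t\ge 0$, $$\lim_{T\to\infty}T^{-(1+a+b)}E(\xi_{t+T}-\xi_t)^2=2\int_0^1u^a(1-u)^b\,du.$$ Hence $\xi$ has asymptotically stationary increments for long time intervals, but not for short time intervals. (8) If $b\ne 0$, then $\xi$ is not a semimartingale. (9) If $b\neq 0$, then $\xi$ is not a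 Markov process.
   Context: The stated function is positive-definite for the given parameter range, so the process $\xi$ exists. Here $s\wedge t=\min(s,t)$ and $\stackrel{d}{=}$ denotes equality of finite-dimensional distributions. Fractional Brownian motion with Hurst parameter $H\in(0,1)$ is the centered Gaussian process on $[0,\infty)$ with covariance $\frac12(s^{2H}+t^{2H}-|s-t|^{2H})$. "Continuous process" means that the process has a version (modification) with continuous paths; "discontinuous at $0$" means that no version is continuous at $0$. The semimartingale and Markov properties are understood with respect to the natural filtration of the process. The last sentence of (7) is drawn from the two limits displayed there: it refers to whether the asymptotics of $E(\xi_{t+\tau}-\xi_t)^2$ for a long ($\tau\to\infty$), respectively short ($\tau\searrow 0$), time interval are free of the starting time $t$. The convention $0^0=1$ is used.
   Formalization: In the last sentence of (7), "but not for short time intervals" is stated as: the short-time asymptotics are free of the starting time if and only if a = 0, since for a = 0 the process is a multiple of fractional Brownian motion, with stationary increments. *)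

theory Defs
  imports "HOL-Probability.Probability" "HOL-Library.Landau_Symbols"
begin

text \<open>
  A real-valued process is a function \<open>X :: real \<Rightarrow> 'a \<Rightarrow> real\<close>, \<open>X t \<omega>\<close> being its value at time
  \<open>t\<close>. Only times \<open>t \<ge> 0\<close> are relevant; nothing below depends on \<open>X t\<close> for \<open>t < 0\<close>.
\<close>

section \<open>Gaussian processes\<close>

text \<open>The normal law with mean \<open>\<mu>\<close> and standard deviation \<open>\<sigma>\<close>, with \<open>\<sigma> = 0\<close> allowed.\<close>

definition normal_law :: "real \<Rightarrow> real \<Rightarrow> real measure" where
  "normal_law \<mu> \<sigma> =
     (if \<sigma> = 0 then return borel \<mu> else density lborel (\<lambda>x. ennreal (normal_density \<mu> \<sigma> x)))"

definition gaussian_process :: "'a measure \<Rightarrow> (real \<Rightarrow> 'a \<Rightarrow> real) \<Rightarrow> bool" where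
  "gaussian_process M X \<longleftrightarrow>
     prob_space M \<and> (\<forall>t\<ge>0. X t \<in> borel_measurable M) \<and>
     (\<forall>J c. finite J \<and> J \<subseteq> {0..} \<longrightarrow>
        (\<exists>\<mu> \<sigma>. 0 \<le> \<sigma> \<and> distr M borel (\<lambda>\<omega>. \<Sum>t\<in>J. c t * X t \<omega>) = normal_law \<mu> \<sigma>))"

definition centered_gaussian_process ::
  "'a measure \<Rightarrow> (real \<Rightarrow> real \<Rightarrow> real) \<Rightarrow> (real \<Rightarrow> 'a \<Rightarrow> real) \<Rightarrow> bool" where
  "centered_gaussian_process M K X \<longleftrightarrow>
     gaussian_process M X \<and> (\<forall>t\<ge>0. (\<integral>\<omega>. X t \<omega> \<partial>M) = 0) \<and>
     (\<forall>s\<ge>0. \<forall>t\<ge>0. (\<integral>\<omega>. X s \<omega> * X t \<omega> \<partial>M) = K s t)"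

text \<open>
  In \<open>powr\<close> one has \<open>0 powr p = 0\<close> for all \<open>p\<close>. Under the integral sign this concerns only the end
  points \<open>u = 0\<close>, \<open>u = s\<close>, \<open>u = t\<close>, a null set, so the integrals are those with \<open>0\<^sup>0 = 1\<close>.
\<close>

definition weighted_fbm :: "'a measure \<Rightarrow> real \<Rightarrow> real \<Rightarrow> (real \<Rightarrow> 'a \<Rightarrow> real) \<Rightarrow> bool" where
  "weighted_fbm M a b X \<longleftrightarrow>
     centered_gaussian_process M
       (\<lambda>s t. LINT u:{0..min s t}|lborel. u powr a * ((t - u) powr b + (s - u) powr b)) X"

definition fbm :: "'a measure \<Rightarrow> real \<Rightarrow> (real \<Rightarrow> 'a \<Rightarrow> real) \<Rightarrow> bool" where
  "fbm M H X \<longleftrightarrow>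
     centered_gaussian_process M
       (\<lambda>s t. (s powr (2 * H) + t powr (2 * H) - \<bar>s - t\<bar> powr (2 * H)) / 2) X"


section \<open>Finite-dimensional distributions\<close>

definition fdd :: "'a measure \<Rightarrow> (real \<Rightarrow> 'a \<Rightarrow> real) \<Rightarrow> real set \<Rightarrow> (real \<Rightarrow> real) measure" where
  "fdd M X J = distr M (Pi\<^sub>M J (\<lambda>_. borel)) (\<lambda>\<omega>. \<lambda>t\<in>J. X t \<omega>)"

definition fdd_equal ::
  "'a measure \<Rightarrow> (real \<Rightarrow> 'a \<Rightarrow> real) \<Rightarrow> 'b measure \<Rightarrow> (real \<Rightarrow> 'b \<Rightarrow> real) \<Rightarrow> bool" where
  "fdd_equal M X N Y \<longleftrightarrow> (\<forall>J. finite J \<and> J \<subseteq> {0..} \<longrightarrow> fdd M X J = fdd N Y J)"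

text \<open>
  Weak convergence of all finite-dimensional distributions of \<open>X T\<close> to those of \<open>Y\<close>, as \<open>T\<close> tends to
  its limit along \<open>F\<close>. The test functions are the bounded continuous functions on the finite power
  \<open>\<real>\<^sup>J\<close>, which is represented by the functions \<open>J \<rightarrow> \<real>\<close> that are \<open>undefined\<close> outside \<open>J\<close>.
\<close>

definition fdd_converges ::
  "'a measure \<Rightarrow> ('p \<Rightarrow> real \<Rightarrow> 'a \<Rightarrow> real) \<Rightarrow> 'p filter \<Rightarrow>
   'b measure \<Rightarrow> (real \<Rightarrow> 'b \<Rightarrow> real) \<Rightarrow> bool" where
  "fdd_converges M X F N Y \<longleftrightarrow>
     (\<forall>J f. finite J \<and> J \<subseteq> {0..} \<and>
        continuous_map (product_topology (\<lambda>_. euclideanreal) J) euclideanreal f \<and>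
        bounded (f ` (\<Pi>\<^sub>E t\<in>J. UNIV)) \<longrightarrow>
        ((\<lambda>T. \<integral>x. f x \<partial>(fdd M (X T) J)) \<longlongrightarrow> (\<integral>x. f x \<partial>(fdd N Y J))) F)"


section \<open>Versions\<close>

definition modification :: "'a measure \<Rightarrow> (real \<Rightarrow> 'a \<Rightarrow> real) \<Rightarrow> (real \<Rightarrow> 'a \<Rightarrow> real) \<Rightarrow> bool" where
  "modification M X Y \<longleftrightarrow>
     (\<forall>t\<ge>0. Y t \<in> borel_measurable M \<and> (AE \<omega> in M. Y t \<omega> = X t \<omega>))"

definition continuous_process :: "'a measure \<Rightarrow> (real \<Rightarrow> 'a \<Rightarrow> real) \<Rightarrow> bool" where
  "continuous_process M X \<longleftrightarrow>
     (\<exists>Y. modification M X Y \<and> (\<forall>\<omega>\<in>space M. continuous_on {0..} (\<lambda>t. Y t \<omega>)))"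

text \<open>No version is continuous at \<open>0\<close>, not even with probability one.\<close>

definition discontinuous_at_0 :: "'a measure \<Rightarrow> (real \<Rightarrow> 'a \<Rightarrow> real) \<Rightarrow> bool" where
  "discontinuous_at_0 M X \<longleftrightarrow>
     \<not> (\<exists>Y. modification M X Y \<and> (AE \<omega> in M. continuous (at 0 within {0..}) (\<lambda>t. Y t \<omega>)))"


section \<open>Increments\<close>

definition increment_sq :: "'a measure \<Rightarrow> (real \<Rightarrow> 'a \<Rightarrow> real) \<Rightarrow> real \<Rightarrow> real \<Rightarrow> real" where
  "increment_sq M X s t = (\<integral>\<omega>. (X t \<omega> - X s \<omega>)\<^sup>2 \<partial>M)"

definition increment_cov ::
  "'a measure \<Rightarrow> (real \<Rightarrow> 'a \<Rightarrow> real) \<Rightarrow> real \<Rightarrow> real \<Rightarrow> real \<Rightarrow> real \<Rightarrow> real" where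
  "increment_cov M X r v s t = (\<integral>\<omega>. (X t \<omega> - X s \<omega>) * (X v \<omega> - X r \<omega>) \<partial>M)"

text \<open>
  The asymptotics, as \<open>\<tau>\<close> tends to its limit along \<open>F\<close>, of the second moment of the increment over
  \<open>[t, t + \<tau>]\<close> are the same for all starting times \<open>t \<in> I\<close>. Long and short time intervals
  correspond to \<open>F = at_top\<close> and \<open>F = at_right 0\<close>.
\<close>

definition asymptotically_stationary_increments ::
  "'a measure \<Rightarrow> (real \<Rightarrow> 'a \<Rightarrow> real) \<Rightarrow> real set \<Rightarrow> real filter \<Rightarrow> bool" where
  "asymptotically_stationary_increments M X I F \<longleftrightarrow>
     (\<forall>s\<in>I. \<forall>t\<in>I. (\<lambda>\<tau>. increment_sq M X s (s + \<tau>)) \<sim>[F] (\<lambda>\<tau>. increment_sq M X t (t + \<tau>)))"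


section \<open>Filtrations, Markov processes and semimartingales\<close>

definition natural_filtration :: "'a measure \<Rightarrow> (real \<Rightarrow> 'a \<Rightarrow> real) \<Rightarrow> real \<Rightarrow> 'a measure" where
  "natural_filtration M X t =
     sigma (space M) (\<Union>s\<in>{0..t}. {X s -` B \<inter> space M | B. B \<in> sets borel})"

text \<open>Completion by the null events of \<open>M\<close>, followed by the right-continuous regularisation.\<close>

definition usual_augmentation :: "'a measure \<Rightarrow> (real \<Rightarrow> 'a measure) \<Rightarrow> real \<Rightarrow> 'a measure" where
  "usual_augmentation M F t =
     sigma (space M) (\<Inter>s\<in>{t<..}. sigma_sets (space M) (sets (F s) \<union> null_sets M))"

definition markov_process :: "'a measure \<Rightarrow> (real \<Rightarrow> 'a \<Rightarrow> real) \<Rightarrow> bool" where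
  "markov_process M X \<longleftrightarrow>
     (\<forall>s t. 0 \<le> s \<and> s \<le> t \<longrightarrow> (\<forall>B\<in>sets borel.
        AE \<omega> in M.
          real_cond_exp M (natural_filtration M X s) (\<lambda>\<omega>. indicator B (X t \<omega>)) \<omega> =
          real_cond_exp M (vimage_algebra (space M) (X s) borel) (\<lambda>\<omega>. indicator B (X t \<omega>)) \<omega>))"

definition adapted_process :: "(real \<Rightarrow> 'a measure) \<Rightarrow> (real \<Rightarrow> 'a \<Rightarrow> real) \<Rightarrow> bool" where
  "adapted_process F X \<longleftrightarrow> (\<forall>t\<ge>0. X t \<in> borel_measurable (F t))"

definition martingale :: "'a measure \<Rightarrow> (real \<Rightarrow> 'a measure) \<Rightarrow> (real \<Rightarrow> 'a \<Rightarrow> real) \<Rightarrow> bool" where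
  "martingale M F X \<longleftrightarrow>
     adapted_process F X \<and> (\<forall>t\<ge>0. integrable M (X t)) \<and>
     (\<forall>s t. 0 \<le> s \<and> s \<le> t \<longrightarrow> (AE \<omega> in M. real_cond_exp M (F s) (X t) \<omega> = X s \<omega>))"

definition cadlag :: "(real \<Rightarrow> real) \<Rightarrow> bool" where
  "cadlag f \<longleftrightarrow>
     (\<forall>t\<ge>0. (f \<longlongrightarrow> f t) (at_right t)) \<and> (\<forall>t>0. \<exists>l. (f \<longlongrightarrow> l) (at_left t))"

definition finite_variation :: "(real \<Rightarrow> real) \<Rightarrow> bool" where
  "finite_variation f \<longleftrightarrow>
     (\<forall>T\<ge>0. \<exists>C. \<forall>n (p :: nat \<Rightarrow> real).
        mono p \<and> range p \<subseteq> {0..T} \<longrightarrow> (\<Sum>i<n. \<bar>f (p (Suc i)) - f (p i)\<bar>) \<le> C)"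

text \<open>
  Localizing times may be taken finite, since \<open>\<tau> n\<close> can be replaced by \<open>min (\<tau> n) n\<close>. The initial
  value is subtracted, so that no integrability of \<open>L 0\<close> is required.
\<close>

definition local_martingale ::
  "'a measure \<Rightarrow> (real \<Rightarrow> 'a measure) \<Rightarrow> (real \<Rightarrow> 'a \<Rightarrow> real) \<Rightarrow> bool" where
  "local_martingale M F L \<longleftrightarrow>
     adapted_process F L \<and> (AE \<omega> in M. cadlag (\<lambda>t. L t \<omega>)) \<and>
     (\<exists>\<tau> :: nat \<Rightarrow> 'a \<Rightarrow> real.
        (\<forall>n. stopping_time F (\<tau> n) \<and> (\<forall>\<omega>\<in>space M. 0 \<le> \<tau> n \<omega>)) \<and>
        (AE \<omega> in M. incseq (\<lambda>n. \<tau> n \<omega>) \<and> filterlim (\<lambda>n. \<tau> n \<omega>) at_top sequentially) \<and>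
        (\<forall>n. martingale M F (\<lambda>t \<omega>. L (min t (\<tau> n \<omega>)) \<omega> - L 0 \<omega>)))"

text \<open>
  The decomposition is only required up to modification. Thus \<open>semimartingale M F X\<close> means that some
  version of \<open>X\<close> is a (cadlag) semimartingale, and its negation does not depend on the choice of
  paths of \<open>X\<close>. The initial value \<open>X 0\<close> is absorbed in \<open>A\<close>.
\<close>

definition semimartingale ::
  "'a measure \<Rightarrow> (real \<Rightarrow> 'a measure) \<Rightarrow> (real \<Rightarrow> 'a \<Rightarrow> real) \<Rightarrow> bool" where
  "semimartingale M F X \<longleftrightarrow>
     (\<exists>L A. local_martingale M F L \<and> adapted_process F A \<and>
        (AE \<omega> in M. cadlag (\<lambda>t. A t \<omega>) \<and> finite_variation (\<lambda>t. A t \<omega>)) \<and>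
        (\<forall>t\<ge>0. AE \<omega> in M. X t \<omega> = L t \<omega> + A t \<omega>))"

end

theory Submission
  imports Defs "HOL-Real_Asymp.Real_Asymp"
begin

text \<open>
  The law of \<open>\<xi>\<close> is controlled by the single integral \<open>W(r, v, t) = \<integral>\<^sub>r\<^sup>v u\<^sup>a (t - u)\<^sup>b du\<close>: the covariance is
  \<open>W(0, s, t) + W(0, s, s)\<close> for \<open>s \<le> t\<close>, so that \<open>E(\<xi>\<^sub>t - \<xi>\<^sub>s)\<^sup>2 = 2 W(s, t, t)\<close>, and (1)--(7) come from
  bounds and limits of \<open>W\<close>. Continuity is obtained from the Kolmogorov criterion with a high even
  Gaussian moment; if \<open>a + b = -1\<close>, the law of \<open>\<xi>\<^sub>t\<close> is the same non-degenerate one for all \<open>t > 0\<close>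
  while \<open>\<xi>\<^sub>0 = 0\<close>, so \<open>\<xi>\<close> is discontinuous at \<open>0\<close>.

  For (8), elementary integrals \<open>\<Sum> H\<^sub>i D\<^sub>i\<close> of the increments \<open>D\<^sub>i\<close> of a semimartingale, with \<open>\<bar>H\<^sub>i\<bar> \<le> 1\<close>,
  are bounded in probability. If \<open>b < 0\<close>, suitable deterministic signs \<open>H\<^sub>i\<close> make the variance over the grid of mesh
  \<open>1/n\<close> at least of order \<open>n powr (-b)\<close>. If \<open>b > 0\<close>, one takes \<open>H\<^sub>i\<close> to be the sign of the conditional
  expectation of the increment: the predictable part is of order \<open>n powr ((1 - b) / 2)\<close>, because
  neighbouring increments are positively correlated, whereas the martingale part stays bounded in
  \<open>L\<^sup>2\<close>. For (9), a Gaussian Markov process with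
  covariance \<open>K\<close> satisfies \<open>K(r, t) K(s, s) = K(r, s) K(s, t)\<close>, which fails
  as \<open>r \<rightarrow> 0\<close>.
\<close>

section \<open>The weighted integral\<close>

text \<open>All Gaussian input passes through E(cos U) = exp(- E(U^2) / 2) for linear combinations U
  of the process. Cosines of linear forms determine finite-dimensional laws and their limits, with
  second moment bounds in place of tightness, so equality and convergence of covariances suffice.
  Differentiated in a direction W, the formula becomes E(W sin U) = E(U W) exp(- E(U^2) / 2): a
  bounded test variable that reads off a covariance. It gives the lower bound for conditional means
  of increments in (8) and the last step of (9).

  The obstacle in (8) is that a stopped local martingale is merely integrable, so orthogonality in
  L^2 is not at hand. Boundedness in probability comes from a weak-type inequality instead: the
  martingale is split into two nonnegative ones, and truncation at a level K turns each into a
  bounded supermartingale whose martingale part and compensator are both controlled by its mean.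
  Only times in [1, 2] are used there, since u^a is bounded away from 0 and infinity on that
  interval for either sign of a.\<close>

lemma set_integral_pos:
  fixes f :: "real \<Rightarrow> real"
  assumes f: "set_integrable lborel {r..v} f" and "r < v"
    and pos: "\<And>u. r < u \<Longrightarrow> u < v \<Longrightarrow> f u > 0"
  shows "(LINT u:{r..v}|lborel. f u) > 0"
proof -
  have ae: "AE u in lborel. 0 \<le> indicator {r..v} u *\<^sub>R f u"
    using AE_lborel_singleton[of r] AE_lborel_singleton[of v]
  proof eventually_elim
    case (elim u)
    then show ?case using pos[of u] by (cases "u \<in> {r..v}") (auto simp: less_le)
  qed
  then have "(LINT u:{r..v}|lborel. f u) \<ge> 0"
    unfolding set_lebesgue_integral_def by (rule integral_nonneg_AE)
  moreover have "(LINT u:{r..v}|lborel. f u) \<noteq> 0"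
  proof
    assume "(LINT u:{r..v}|lborel. f u) = 0"
    then have "AE u in lborel. indicator {r..v} u *\<^sub>R f u = 0"
      using integral_nonneg_eq_0_iff_AE[OF f[unfolded set_integrable_def] ae]
      by (simp add: set_lebesgue_integral_def)
    then have "AE u in lborel. u \<notin> {r<..<v}"
      by eventually_elim (use pos in \<open>auto simp: indicator_def split: if_splits\<close>, fastforce)
    then have "emeasure lborel {r<..<v} = 0" by (subst (asm) AE_iff_measurable[of "{r<..<v}"]) auto
    with \<open>r < v\<close> show False by simp
  qed
  ultimately show ?thesis by simp
qed

text \<open>Comparison is asked for inside the interval only: at an end point where a base vanishes
  \<open>powr\<close> is 0 whatever the exponent, and the pointwise bounds used below may fail
  there.\<close>

lemma set_integral_mono_interior:
  fixes f g :: "real \<Rightarrow> real"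
  assumes "set_integrable lborel {r..v} f" "set_integrable lborel {r..v} g"
    and le: "\<And>u. r < u \<Longrightarrow> u < v \<Longrightarrow> f u \<le> g u"
  shows "(LINT u:{r..v}|lborel. f u) \<le> (LINT u:{r..v}|lborel. g u)"
proof (rule set_integral_mono_AE[OF assms(1,2)])
  show "AE u\<in>{r..v} in lborel. f u \<le> g u"
    using AE_lborel_singleton[of r] AE_lborel_singleton[of v]
    by eventually_elim (use le in \<open>auto simp: less_le\<close>)
qed

lemma powr_integral_from_0:
  assumes "p > -1" "c \<ge> (0::real)"
  shows "set_integrable lborel {0..c} (\<lambda>u. u powr p)"
    "(LINT u:{0..c}|lborel. u powr p) = c powr (p + 1) / (p + 1)"
proof -
  have h: "((\<lambda>u. u powr p) has_integral (c powr (p + 1) / (p + 1))) {0..c}"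
    by (rule has_integral_powr_from_0) (use assms in auto)
  then have "(\<lambda>u. u powr p) absolutely_integrable_on {0..c}"
    by (subst absolutely_integrable_on_iff_nonneg) auto
  then show i: "set_integrable lborel {0..c} (\<lambda>u. u powr p)"
    unfolding set_integrable_def by (subst (asm) integrable_completion) auto
  show "(LINT u:{0..c}|lborel. u powr p) = c powr (p + 1) / (p + 1)"
    using set_borel_integral_eq_integral(2)[OF i] h by (simp add: integral_unique)
qed

lemma set_integral_split:
  fixes f :: "real \<Rightarrow> real"
  assumes f: "set_integrable lborel {r..w} f" and "r \<le> v" "v \<le> w"
  shows "(LINT u:{r..w}|lborel. f u) = (LINT u:{r..v}|lborel. f u) + (LINT u:{v..w}|lborel. f u)"
proof -
  have "{r..w} = {r..v} \<union> {v<..w}" using assms by auto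
  then have "(LINT u:{r..w}|lborel. f u) = (LINT u:{r..v} \<union> {v<..w}|lborel. f u)" by simp
  also have "\<dots> = (LINT u:{r..v}|lborel. f u) + (LINT u:{v<..w}|lborel. f u)"
    by (intro set_integral_Un set_integrable_subset[OF f]) (use assms in auto)
  also have "(LINT u:{v<..w}|lborel. f u) = (LINT u:{v..w}|lborel. f u)"
    by (intro set_integral_discrete_difference[where X = "{v}"]) (use assms in auto)
  finally show ?thesis .
qed

lemma powr_integral:
  assumes "p > -1" "0 \<le> r" "r \<le> (v::real)"
  shows "set_integrable lborel {r..v} (\<lambda>u. u powr p)"
    "(LINT u:{r..v}|lborel. u powr p) = (v powr (p + 1) - r powr (p + 1)) / (p + 1)"
proof -
  have i: "set_integrable lborel {0..v} (\<lambda>u. u powr p)" by (rule powr_integral_from_0(1)) (use assms in auto)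
  then show "set_integrable lborel {r..v} (\<lambda>u. u powr p)" by (rule set_integrable_subset) (use assms in auto)
  show "(LINT u:{r..v}|lborel. u powr p) = (v powr (p + 1) - r powr (p + 1)) / (p + 1)"
    using set_integral_split[OF i, of r] powr_integral_from_0(2)[of p v] powr_integral_from_0(2)[of p r] assms
    by (simp add: diff_divide_distrib)
qed

lemma powr_integral_reflected:
  assumes "p > -1" "s \<le> (t::real)"
  shows "set_integrable lborel {s..t} (\<lambda>u. (t - u) powr p)"
    "(LINT u:{s..t}|lborel. (t - u) powr p) = (t - s) powr (p + 1) / (p + 1)"
proof -
  define f where "f u = indicator {s..t} u *\<^sub>R (t - u) powr p" for u
  \<comment> \<open>The reflection u = t - x carries the singularity at t to the origin.\<close>
  have e: "f (t + (-1) * x) = indicator {0..t - s} x *\<^sub>R x powr p" for x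
    by (auto simp: f_def indicator_def)
  have i: "set_integrable lborel {0..t - s} (\<lambda>u. u powr p)"
    and v: "(LINT u:{0..t - s}|lborel. u powr p) = (t - s) powr (p + 1) / (p + 1)"
    using assms by (auto intro!: powr_integral_from_0)
  have "integrable lborel f"
    using i lborel_integrable_real_affine_iff[of "-1" f t] unfolding e set_integrable_def by simp
  then show "set_integrable lborel {s..t} (\<lambda>u. (t - u) powr p)"
    by (simp add: set_integrable_def f_def[abs_def])
  have "(LINT u:{s..t}|lborel. (t - u) powr p) = (\<integral>u. f u \<partial>lborel)"
    by (simp add: set_lebesgue_integral_def f_def)
  also have "\<dots> = (LINT u:{0..t - s}|lborel. u powr p)"
    using lborel_integral_real_affine[of "-1" f t] unfolding e by (simp add: set_lebesgue_integral_def)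
  finally show "(LINT u:{s..t}|lborel. (t - u) powr p) = (t - s) powr (p + 1) / (p + 1)" using v by simp
qed

section \<open>Scaling, bounds and limits of the incomplete Beta integral\<close>

definition wint :: "real \<Rightarrow> real \<Rightarrow> real \<Rightarrow> real \<Rightarrow> real \<Rightarrow> real" where
  "wint a b r v t = (LINT u:{r..v}|lborel. u powr a * (t - u) powr b)"

context
  fixes a b :: real
  assumes a: "a > -1" and b: "b > -1"
begin

text \<open>The scaling u = t x carries {0..t} to {0..1}, where the integrand is that of the Beta
  function with the positive parameters a + 1 and b + 1; {r..v} is then a subset.\<close>

lemma wint_integrable:
  assumes "0 \<le> r" "v \<le> t"
  shows "set_integrable lborel {r..v} (\<lambda>u. u powr a * (t - u) powr b)"
proof -
  have "set_integrable lborel {0..t} (\<lambda>u. u powr a * (t - u) powr b)"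
  proof (cases "t > 0")
    case True
    define f where "f u = indicator {0..t} u *\<^sub>R (u powr a * (t - u) powr b)" for u
    have e: "f (0 + t * x) = t powr (a + b) * (indicator {0..1} x *\<^sub>R (x powr a * (1 - x) powr b))" for x
    proof (cases "x \<in> {0..1}")
      case x: True
      have "t - t * x = t * (1 - x)" by (simp add: algebra_simps)
      then show ?thesis using x True
        by (auto simp: f_def powr_mult powr_add mult_le_cancel_left2)
    next
      case False
      then have "t * x \<notin> {0..t}" using True by (auto simp: mult_le_cancel_left2 zero_le_mult_iff)
      then show ?thesis using False by (simp add: f_def)
    qed
    have "set_integrable lborel {0..1} (\<lambda>x. x powr a * (1 - x) powr b)"
      using integrable_Beta[of "a + 1" "b + 1"] a b by simp
    then have "integrable lborel (\<lambda>x. f (0 + t * x))"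
      unfolding e set_integrable_def by (rule integrable_mult_right)
    then have "integrable lborel f" using True lborel_integrable_real_affine_iff[of t f 0] by simp
    then show ?thesis by (simp add: set_integrable_def f_def[abs_def])
  next
    \<comment> \<open>Here {0..t} is empty or {0}, and \<open>0 powr a = 0\<close>.\<close>
    case False
    have "(\<lambda>u. indicator {0..t} u *\<^sub>R (u powr a * (t - u) powr b)) = (\<lambda>_. 0)"
      using False by (auto simp: indicator_def fun_eq_iff)
    then show ?thesis by (simp add: set_integrable_def)
  qed
  then show ?thesis by (rule set_integrable_subset) (use assms in auto)
qed

lemma wint_split:
  assumes "0 \<le> r" "r \<le> v" "v \<le> w" "w \<le> t"
  shows "wint a b r w t = wint a b r v t + wint a b v w t"
  unfolding wint_def by (intro set_integral_split wint_integrable) (use assms in auto)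

lemma wint_empty: "wint a b r r t = 0"
proof -
  have "AE u in lborel. indicator {r..r} u *\<^sub>R (u powr a * (t - u) powr b) = 0"
    using AE_lborel_singleton[of r] by eventually_elim auto
  then show ?thesis unfolding wint_def set_lebesgue_integral_def by (rule integral_eq_zero_AE)
qed

text \<open>Under u = c x the integrand contributes c^(a + b) and the Jacobian one more factor c.
  This homogeneity is the source both of the self-similarity of the process and of the exact value
  of its variance.\<close>

lemma wint_scale:
  assumes "c > 0" "0 \<le> r" "v \<le> t"
  shows "wint a b (c * r) (c * v) (c * t) = c powr (1 + a + b) * wint a b r v t"
proof -
  define f where "f u = indicator {c * r..c * v} u *\<^sub>R (u powr a * (c * t - u) powr b)" for u
  have e: "f (0 + c * x) = c powr (a + b) * (indicator {r..v} x *\<^sub>R (x powr a * (t - x) powr b))" for x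
  proof (cases "x \<in> {r..v}")
    case True
    have "c * t - c * x = c * (t - x)" by (simp add: algebra_simps)
    then show ?thesis using True assms by (simp add: f_def powr_mult powr_add)
  next
    case False
    then have "c * x \<notin> {c * r..c * v}" using assms by auto
    then show ?thesis using False by (simp add: f_def)
  qed
  have "wint a b (c * r) (c * v) (c * t) = (\<integral>u. f u \<partial>lborel)"
    by (simp add: wint_def set_lebesgue_integral_def f_def)
  also have "\<dots> = c * (\<integral>x. f (0 + c * x) \<partial>lborel)"
    using assms lborel_integral_real_affine[of c f 0] by simp
  also have "\<dots> = c * (c powr (a + b) * wint a b r v t)"
    unfolding e by (simp add: wint_def set_lebesgue_integral_def)
  also have "\<dots> = (c * c powr (a + b)) * wint a b r v t" by simp
  also have "c * c powr (a + b) = c powr (1 + a + b)"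
    using assms by (simp add: powr_add)
  finally show ?thesis .
qed

text \<open>Euler's Beta function at (a + 1, b + 1); twice this value is the variance of the process
  at time 1.\<close>

definition wB :: real where "wB = wint a b 0 1 1"

lemma wint_full: "t \<ge> 0 \<Longrightarrow> wint a b 0 t t = t powr (1 + a + b) * wB"
  using wint_scale[of t 0 1 1] wint_empty[of 0 0] by (cases "t > 0") (auto simp: wB_def)

lemma wint_pos:
  assumes "0 \<le> r" "r < v" "v \<le> t"
  shows "wint a b r v t > 0"
  unfolding wint_def by (rule set_integral_pos[OF wint_integrable]) (use assms in auto)

lemma wB_pos: "wB > 0"
  unfolding wB_def by (rule wint_pos) auto

text \<open>The weight u^a is frozen between constants, and the kernel, singular at t when b < 0, is
  integrated exactly; this produces the exponent b + 1 of the local bounds.\<close>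

lemma wint_bounds_right:
  assumes "0 \<le> s" "s \<le> t" and m: "\<And>u. s < u \<Longrightarrow> u < t \<Longrightarrow> m \<le> u powr a \<and> u powr a \<le> m'"
  shows "m * ((t - s) powr (b + 1) / (b + 1)) \<le> wint a b s t t" "wint a b s t t \<le> m' * ((t - s) powr (b + 1) / (b + 1))"
proof -
  have i: "set_integrable lborel {s..t} (\<lambda>u. (t - u) powr b)"
    and v: "(LINT u:{s..t}|lborel. (t - u) powr b) = (t - s) powr (b + 1) / (b + 1)"
    using powr_integral_reflected[of b s t] b assms by auto
  have "(LINT u:{s..t}|lborel. m * (t - u) powr b) \<le> wint a b s t t"
    unfolding wint_def by (rule set_integral_mono_interior) (use i wint_integrable assms in \<open>auto intro!: mult_right_mono\<close>)
  then show "m * ((t - s) powr (b + 1) / (b + 1)) \<le> wint a b s t t" using v by simp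
  have "wint a b s t t \<le> (LINT u:{s..t}|lborel. m' * (t - u) powr b)"
    unfolding wint_def by (rule set_integral_mono_interior) (use i wint_integrable assms in \<open>auto intro!: mult_right_mono\<close>)
  then show "wint a b s t t \<le> m' * ((t - s) powr (b + 1) / (b + 1))" using v by simp
qed

text \<open>The opposite split: the kernel is frozen and the weight, singular at 0 when a < 0, is
  integrated exactly.\<close>

lemma wint_bounds_left:
  assumes "0 \<le> r" "r \<le> v" "v \<le> t" and m: "\<And>u. r < u \<Longrightarrow> u < v \<Longrightarrow> m \<le> (t - u) powr b \<and> (t - u) powr b \<le> m'"
  shows "m * ((v powr (a + 1) - r powr (a + 1)) / (a + 1)) \<le> wint a b r v t"
    "wint a b r v t \<le> m' * ((v powr (a + 1) - r powr (a + 1)) / (a + 1))"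
proof -
  have i: "set_integrable lborel {r..v} (\<lambda>u. u powr a)"
    and v: "(LINT u:{r..v}|lborel. u powr a) = (v powr (a + 1) - r powr (a + 1)) / (a + 1)"
    using powr_integral[of a r v] a assms by auto
  have "(LINT u:{r..v}|lborel. m * u powr a) \<le> wint a b r v t"
    unfolding wint_def mult.commute[of m] by (rule set_integral_mono_interior) (use i wint_integrable assms in \<open>auto intro!: mult_left_mono\<close>)
  then show "m * ((v powr (a + 1) - r powr (a + 1)) / (a + 1)) \<le> wint a b r v t" using v by simp
  have "wint a b r v t \<le> (LINT u:{r..v}|lborel. m' * u powr a)"
    unfolding wint_def mult.commute[of m'] by (rule set_integral_mono_interior) (use i wint_integrable assms in \<open>auto intro!: mult_left_mono\<close>)
  then show "wint a b r v t \<le> m' * ((v powr (a + 1) - r powr (a + 1)) / (a + 1))" using v by simp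
qed

text \<open>Shifting by s turns the weight into (s + x)^a, which is at most x^a because a \<le> 0.
  Thus the increment starting at 0 dominates all others of the same length, and it scales
  exactly.\<close>

lemma wint_le_self_similar:
  assumes "a \<le> 0" "0 \<le> s" "s \<le> t"
  shows "wint a b s t t \<le> (t - s) powr (1 + a + b) * wB"
proof -
  define f where "f u = indicator {s..t} u *\<^sub>R (u powr a * (t - u) powr b)" for u
  have e: "f (s + 1 * x) = indicator {0..t - s} x *\<^sub>R ((s + x) powr a * ((t - s) - x) powr b)" for x
    by (auto simp: f_def indicator_def algebra_simps)
  have "integrable lborel f"
    using wint_integrable[of s t t] assms by (simp add: set_integrable_def f_def[abs_def])
  then have "integrable lborel (\<lambda>x. f (s + 1 * x))" by (rule lborel_integrable_real_affine) simp
  then have i: "set_integrable lborel {0..t - s} (\<lambda>x. (s + x) powr a * ((t - s) - x) powr b)"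
    unfolding e set_integrable_def .
  have "wint a b s t t = (\<integral>u. f u \<partial>lborel)"
    by (simp add: wint_def set_lebesgue_integral_def f_def)
  also have "\<dots> = (LINT x:{0..t - s}|lborel. (s + x) powr a * ((t - s) - x) powr b)"
    using lborel_integral_real_affine[of 1 f s] unfolding e by (simp add: set_lebesgue_integral_def)
  also have "\<dots> \<le> wint a b 0 (t - s) (t - s)"
    unfolding wint_def
    by (rule set_integral_mono_interior[OF i wint_integrable])
      (use assms in \<open>auto intro!: mult_right_mono powr_mono2'\<close>)
  also have "\<dots> = (t - s) powr (1 + a + b) * wB" using assms by (intro wint_full) auto
  finally show ?thesis .
qed

lemma wint_diff:
  assumes "0 \<le> r" "r < v" "v \<le> s" "s < t"
  shows "wint a b r v t - wint a b r v s = (LINT u:{r..v}|lborel. u powr a * ((t - u) powr b - (s - u) powr b))"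
    and "b > 0 \<Longrightarrow> wint a b r v t - wint a b r v s > 0"
    and "b < 0 \<Longrightarrow> wint a b r v t - wint a b r v s < 0"
proof -
  have i: "set_integrable lborel {r..v} (\<lambda>u. u powr a * (t - u) powr b)" "set_integrable lborel {r..v} (\<lambda>u. u powr a * (s - u) powr b)"
    by (rule wint_integrable; use assms in simp)+
  have d: "u powr a * ((t - u) powr b - (s - u) powr b) = u powr a * (t - u) powr b - u powr a * (s - u) powr b" for u
    by (simp add: algebra_simps)
  show e: "wint a b r v t - wint a b r v s = (LINT u:{r..v}|lborel. u powr a * ((t - u) powr b - (s - u) powr b))"
    unfolding wint_def d using set_integral_diff(2)[OF i] by simp
  have id: "set_integrable lborel {r..v} (\<lambda>u. u powr a * ((t - u) powr b - (s - u) powr b))"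
    unfolding d by (rule set_integral_diff(1)[OF i])
  show "wint a b r v t - wint a b r v s > 0" if "b > 0"
    unfolding e by (rule set_integral_pos[OF id]) (use assms that in \<open>auto intro!: mult_pos_pos powr_less_mono2\<close>)
  have "(LINT u:{r..v}|lborel. - (u powr a * ((t - u) powr b - (s - u) powr b))) > 0" if "b < 0"
  proof (rule set_integral_pos)
    show "set_integrable lborel {r..v} (\<lambda>u. - (u powr a * ((t - u) powr b - (s - u) powr b)))"
      using id set_integrable_mult_right[of "-1" lborel "{r..v}"] by simp
    show "0 < - (u powr a * ((t - u) powr b - (s - u) powr b))" if "r < u" "u < v" for u
    proof -
      have "(t - u) powr b < (s - u) powr b" using assms that \<open>b < 0\<close> by (intro powr_less_mono2_neg) auto
      moreover have "u powr a > 0" using assms that by simp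
      ultimately show ?thesis by (simp add: mult_less_0_iff)
    qed
  qed (use assms in auto)
  then show "wint a b r v t - wint a b r v s < 0" if "b < 0"
    unfolding e using that set_integral_uminus[OF id] by simp
qed

text \<open>By the mean value theorem the kernel difference is (t - s) b z^(b - 1) with z between T
  + s - v and T + t. All these powers are asymptotic to T^(b - 1), so the kernel leaves the integral
  as a constant and the integral of u^a over {r..v} remains.\<close>

lemma wint_long_range:
  assumes "b < 1" "0 \<le> r" "r < v" "v \<le> s" "s < t"
  shows "((\<lambda>T. T powr (1 - b) * (wint a b r v (t + T) - wint a b r v (s + T))) \<longlongrightarrow>
    b / (a + 1) * (t - s) * (v powr (a + 1) - r powr (a + 1))) at_top"
proof -
  define P where "P = (v powr (a + 1) - r powr (a + 1)) / (a + 1)"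
  \<comment> \<open>Up to the factor |b| (t - s) this is the oscillation of z^(b - 1) over the range
    of z, a decreasing function because b < 1; it is o(T^(b - 1)).\<close>
  define R where "R T = \<bar>b\<bar> * (t - s) * ((T + s - v) powr (b - 1) - (T + t) powr (b - 1))" for T
  have bd: "\<bar>(wint a b r v (t + T) - wint a b r v (s + T)) - b * (t - s) * (T + t) powr (b - 1) * P\<bar> \<le> R T * P"
    if T: "T > 0" for T
  proof -
    let ?h = "\<lambda>u. (t + T - u) powr b - (s + T - u) powr b"
    have pt: "\<bar>?h u - b * (t - s) * (T + t) powr (b - 1)\<bar> \<le> R T" if u: "r < u" "u < v" for u
    proof -
      have "\<exists>z. s + T - u < z \<and> z < t + T - u \<and>
        (t + T - u) powr b - (s + T - u) powr b = (t + T - u - (s + T - u)) * (b * z powr (b - 1))"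
        using assms u T by (intro MVT2) (auto intro!: derivative_eq_intros simp: powr_diff)
      then obtain z where z: "s + T - u < z" "z < t + T - u" "?h u = (t - s) * (b * z powr (b - 1))" by auto
      have "(T + t) powr (b - 1) \<le> z powr (b - 1)" "z powr (b - 1) \<le> (T + s - v) powr (b - 1)"
        using z assms u T by (auto intro!: powr_mono2')
      then have "\<bar>z powr (b - 1) - (T + t) powr (b - 1)\<bar> \<le> (T + s - v) powr (b - 1) - (T + t) powr (b - 1)" by linarith
      then have "\<bar>b\<bar> * (t - s) * \<bar>z powr (b - 1) - (T + t) powr (b - 1)\<bar> \<le> R T"
        unfolding R_def using assms by (intro mult_left_mono) auto
      moreover have "\<bar>?h u - b * (t - s) * (T + t) powr (b - 1)\<bar> = \<bar>b\<bar> * (t - s) * \<bar>z powr (b - 1) - (T + t) powr (b - 1)\<bar>"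
      proof -
        have "?h u - b * (t - s) * (T + t) powr (b - 1) = b * (t - s) * (z powr (b - 1) - (T + t) powr (b - 1))"
          unfolding z(3) by (simp add: algebra_simps)
        then show ?thesis using assms by (simp add: abs_mult)
      qed
      ultimately show ?thesis by simp
    qed
    have i: "set_integrable lborel {r..v} (\<lambda>u. u powr a)" and Pv: "(LINT u:{r..v}|lborel. u powr a) = P"
      using powr_integral[of a r v] a assms by (auto simp: P_def)
    have id: "set_integrable lborel {r..v} (\<lambda>u. u powr a * ?h u)"
    proof -
      have "set_integrable lborel {r..v} (\<lambda>u. u powr a * (t + T - u) powr b - u powr a * (s + T - u) powr b)"
        by (intro set_integral_diff(1) wint_integrable) (use assms T in auto)
      then show ?thesis by (simp add: algebra_simps)
    qed
    have D: "wint a b r v (t + T) - wint a b r v (s + T) = (LINT u:{r..v}|lborel. u powr a * ?h u)"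
      by (rule wint_diff(1)) (use assms T in auto)
    define q where "q = b * (t - s) * (T + t) powr (b - 1)"
    have pt': "q - R T \<le> ?h u \<and> ?h u \<le> q + R T" if "r < u" "u < v" for u
      using pt[OF that] unfolding q_def[symmetric] by linarith
    have ic: "set_integrable lborel {r..v} (\<lambda>u. u powr a * c)" for c
      using i by simp
    have Pc: "(LINT u:{r..v}|lborel. u powr a * c) = P * c" for c using Pv by simp
    define I where "I = (LINT u:{r..v}|lborel. u powr a * ?h u)"
    have "I \<le> (LINT u:{r..v}|lborel. u powr a * (q + R T))"
      unfolding I_def by (rule set_integral_mono_interior[OF id ic]) (use pt' in \<open>auto intro!: mult_left_mono\<close>)
    moreover have "(LINT u:{r..v}|lborel. u powr a * (q - R T)) \<le> I"
      unfolding I_def by (rule set_integral_mono_interior[OF ic id]) (use pt' in \<open>auto intro!: mult_left_mono\<close>)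
    ultimately have "I \<le> P * (q + R T)" "P * (q - R T) \<le> I" unfolding Pc by auto
    then show ?thesis unfolding D q_def[symmetric] I_def[symmetric] by (simp add: algebra_simps abs_le_iff)
  qed
  have "((\<lambda>T. T powr (1 - b) * (wint a b r v (t + T) - wint a b r v (s + T)) - T powr (1 - b) * (b * (t - s) * (T + t) powr (b - 1) * P)) \<longlongrightarrow> 0) at_top"
  proof (rule Lim_null_comparison)
    show "\<forall>\<^sub>F T in at_top. norm (T powr (1 - b) * (wint a b r v (t + T) - wint a b r v (s + T)) - T powr (1 - b) * (b * (t - s) * (T + t) powr (b - 1) * P))
      \<le> T powr (1 - b) * (R T * P)"
      using eventually_gt_at_top[of 0]
    proof eventually_elim
      case (elim T)
      have "T powr (1 - b) * (wint a b r v (t + T) - wint a b r v (s + T)) - T powr (1 - b) * (b * (t - s) * (T + t) powr (b - 1) * P)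
        = T powr (1 - b) * ((wint a b r v (t + T) - wint a b r v (s + T)) - b * (t - s) * (T + t) powr (b - 1) * P)"
        by (simp add: right_diff_distrib)
      also have "norm \<dots> = T powr (1 - b) * \<bar>(wint a b r v (t + T) - wint a b r v (s + T)) - b * (t - s) * (T + t) powr (b - 1) * P\<bar>"
        by (simp add: abs_mult)
      also have "\<dots> \<le> T powr (1 - b) * (R T * P)" by (intro mult_left_mono bd elim) simp
      finally show ?case .
    qed
    have "((\<lambda>T. T powr (1 - b) * ((T + s - v) powr (b - 1) - (T + t) powr (b - 1))) \<longlongrightarrow> 0) at_top"
      by real_asymp
    from tendsto_mult_right[OF this, of "\<bar>b\<bar> * (t - s) * P"]
    show "((\<lambda>T. T powr (1 - b) * (R T * P)) \<longlongrightarrow> 0) at_top"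
      by (simp add: R_def algebra_simps)
  qed
  moreover have "((\<lambda>T. T powr (1 - b) * (b * (t - s) * (T + t) powr (b - 1) * P)) \<longlongrightarrow> b * (t - s) * P) at_top"
  proof -
    have "((\<lambda>T. T powr (1 - b) * (T + t) powr (b - 1)) \<longlongrightarrow> 1) at_top" by real_asymp
    from tendsto_mult_right[OF this, of "b * (t - s) * P"] show ?thesis by (simp add: algebra_simps)
  qed
  ultimately have "((\<lambda>T. T powr (1 - b) * (wint a b r v (t + T) - wint a b r v (s + T))) \<longlongrightarrow> b * (t - s) * P) at_top"
    using tendsto_add by fastforce
  then show ?thesis by (simp add: P_def)
qed

text \<open>Extending the interval to {0..t + T} gives an exact power by scaling. The part over
  {0..t} thereby added is O(T^b), negligible against T^(1 + a + b) because a > -1.\<close>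

lemma wint_long:
  assumes "t \<ge> 0"
  shows "((\<lambda>T. T powr (- (1 + a + b)) * wint a b t (t + T) (t + T)) \<longlongrightarrow> wB) at_top"
proof -
  define P where "P = t powr (a + 1) / (a + 1)"
  have P: "P \<ge> 0" using a by (simp add: P_def)
  have eq: "wint a b t (t + T) (t + T) = (t + T) powr (1 + a + b) * wB - wint a b 0 t (t + T)" if "T > 0" for T
    using wint_split[of 0 t "t + T" "t + T"] wint_full[of "t + T"] that assms by simp
  have bd: "\<bar>wint a b 0 t (t + T)\<bar> \<le> (T powr b + (t + T) powr b) * P" if T: "T > 0" for T
  proof -
    have "0 \<le> wint a b 0 t (t + T)"
      using wint_pos[of 0 t "t + T"] wint_empty[of 0 "t + T"] assms T by (cases "t > 0") auto
    moreover have "wint a b 0 t (t + T) \<le> (T powr b + (t + T) powr b) * ((t powr (a + 1) - 0 powr (a + 1)) / (a + 1))"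
    proof (rule wint_bounds_left(2))
      fix u assume u: "0 < u" "u < t"
      \<comment> \<open>The sum serves both signs of b: the kernel is monotone in u, so it is
        bounded by its value at u = 0 or by its value at u = t.\<close>
      have "(t + T - u) powr b \<le> T powr b + (t + T) powr b"
      proof (cases "b \<ge> 0")
        case True
        then have "(t + T - u) powr b \<le> (t + T) powr b" using u T by (intro powr_mono2) auto
        then show ?thesis by (simp add: add_increasing)
      next
        case False
        then have "(t + T - u) powr b \<le> T powr b" using u T by (intro powr_mono2') auto
        then show ?thesis by (simp add: add_increasing2)
      qed
      then show "0 \<le> (t + T - u) powr b \<and> (t + T - u) powr b \<le> T powr b + (t + T) powr b" by simp
    qed (use assms T in auto)
    ultimately show ?thesis by (simp add: P_def)
  qed
  have "((\<lambda>T. T powr (- (1 + a + b)) * wint a b 0 t (t + T)) \<longlongrightarrow> 0) at_top"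
  proof (rule Lim_null_comparison)
    show "\<forall>\<^sub>F T in at_top. norm (T powr (- (1 + a + b)) * wint a b 0 t (t + T)) \<le> T powr (- (1 + a + b)) * (T powr b + (t + T) powr b) * P"
      using eventually_gt_at_top[of 0]
      by eventually_elim (use bd in \<open>auto simp: abs_mult mult.assoc intro!: mult_left_mono\<close>)
    have "((\<lambda>T. T powr (- (1 + a + b)) * (T powr b + (t + T) powr b)) \<longlongrightarrow> 0) at_top" using a by real_asymp
    from tendsto_mult_right[OF this, of P]
    show "((\<lambda>T. T powr (- (1 + a + b)) * (T powr b + (t + T) powr b) * P) \<longlongrightarrow> 0) at_top" by (simp add: mult.commute)
  qed
  moreover have "((\<lambda>T. T powr (- (1 + a + b)) * (t + T) powr (1 + a + b) * wB) \<longlongrightarrow> 1 * wB) at_top"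
    by (intro tendsto_mult_right tendsto_mult tendsto_const) real_asymp
  ultimately have "((\<lambda>T. T powr (- (1 + a + b)) * (t + T) powr (1 + a + b) * wB - T powr (- (1 + a + b)) * wint a b 0 t (t + T)) \<longlongrightarrow> 1 * wB - 0) at_top"
    by (rule tendsto_diff[rotated])
  moreover have "\<forall>\<^sub>F T in at_top. T powr (- (1 + a + b)) * (t + T) powr (1 + a + b) * wB - T powr (- (1 + a + b)) * wint a b 0 t (t + T)
    = T powr (- (1 + a + b)) * wint a b t (t + T) (t + T)"
    using eventually_gt_at_top[of 0] by eventually_elim (simp add: eq right_diff_distrib)
  ultimately show ?thesis by (simp add: tendsto_cong)
qed

end

section \<open>Convergence of finite-dimensional distributions\<close>

instance "fun" :: (type, t0_space) t0_space
proof
  fix f g :: "'a \<Rightarrow> 'b"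
  assume "f \<noteq> g"
  then obtain i where "f i \<noteq> g i" by blast
  then obtain U where U: "open U" "\<not> (f i \<in> U \<longleftrightarrow> g i \<in> U)" using t0_space_class.t0_space by metis
  have "open ((\<lambda>h :: 'a \<Rightarrow> 'b. h i) -` U)" using U(1) by (intro open_vimage) auto
  then show "\<exists>U. open U \<and> \<not> (f \<in> U \<longleftrightarrow> g \<in> U)"
    using U(2) by (intro exI[of _ "(\<lambda>h. h i) -` U"]) simp
qed

instance "fun" :: (type, t1_space) t1_space
proof
  fix f g :: "'a \<Rightarrow> 'b"
  assume "f \<noteq> g"
  then obtain i where "f i \<noteq> g i" by blast
  then obtain U where "open U" "f i \<in> U" "g i \<notin> U" using t1_space by blast
  then show "\<exists>U. open U \<and> f \<in> U \<and> g \<notin> U"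
    by (intro exI[of _ "(\<lambda>h. h i) -` U"]) (auto intro!: open_vimage)
qed

text \<open>The Stone-Weierstrass theorem is applied below to a compact set of functions, whose type
  has to be Hausdorff.\<close>

instance "fun" :: (type, t2_space) t2_space
proof
  fix f g :: "'a \<Rightarrow> 'b"
  assume "f \<noteq> g"
  then obtain i where "f i \<noteq> g i" by blast
  then obtain U V where "open U" "open V" "f i \<in> U" "g i \<in> V" "U \<inter> V = {}"
    using hausdorff by metis
  then show "\<exists>U V. open U \<and> open V \<and> f \<in> U \<and> g \<in> V \<and> U \<inter> V = {}"
    by (intro exI[of _ "(\<lambda>h. h i) -` U"] exI[of _ "(\<lambda>h. h i) -` V"]) (auto intro!: open_vimage)
qed

text \<open>The real linear span of the cosines of affine forms. The phase d brings in the sines and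
  makes the span closed under products; linear statements about expectations then need checking on
  single cosines only.\<close>

inductive_set trig_polys :: "'i set \<Rightarrow> (('i \<Rightarrow> real) \<Rightarrow> real) set" for J where
  wave: "(\<lambda>x. cos ((\<Sum>i\<in>J. c i * x i) + d)) \<in> trig_polys J"
| add: "p \<in> trig_polys J \<Longrightarrow> q \<in> trig_polys J \<Longrightarrow> (\<lambda>x. p x + q x) \<in> trig_polys J"
| scale: "p \<in> trig_polys J \<Longrightarrow> (\<lambda>x. k * p x) \<in> trig_polys J"

lemma trig_polys_const: "(\<lambda>_. k) \<in> trig_polys J"
  using trig_polys.scale[OF trig_polys.wave[of "\<lambda>_. 0" _ 0], of k] by simp

lemma trig_polys_mult_wave:
  assumes "p \<in> trig_polys J"
  shows "(\<lambda>x. cos ((\<Sum>i\<in>J. c i * x i) + d) * p x) \<in> trig_polys J"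
  using assms
proof induction
  case (wave c' d')
  have "(\<lambda>x. cos ((\<Sum>i\<in>J. c i * x i) + d) * cos ((\<Sum>i\<in>J. c' i * x i) + d')) =
    (\<lambda>x. (1/2) * (cos ((\<Sum>i\<in>J. (c i - c' i) * x i) + (d - d'))
       + cos ((\<Sum>i\<in>J. (c i + c' i) * x i) + (d + d'))))"
    by (auto simp: cos_times_cos ring_distribs sum.distrib sum_subtractf algebra_simps)
  then show ?case by (simp only: trig_polys.intros)
next
  case (add p q)
  then show ?case by (simp only: distrib_left trig_polys.add)
next
  case (scale p k)
  then show ?case using trig_polys.scale[OF scale.IH, of k] by (simp add: ac_simps)
qed

lemma trig_polys_mult:
  assumes "p \<in> trig_polys J" "q \<in> trig_polys J"
  shows "(\<lambda>x. p x * q x) \<in> trig_polys J"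
  using assms
proof induction
  case (wave c d)
  then show ?case by (rule trig_polys_mult_wave)
next
  case (add p p')
  then show ?case by (simp only: distrib_right trig_polys.add)
next
  case (scale p k)
  then show ?case using trig_polys.scale[OF scale.IH[OF scale.prems], of k] by (simp add: ac_simps)
qed

lemma trig_polys_measurable:
  assumes "p \<in> trig_polys J" "finite J"
  shows "p \<in> borel_measurable (Pi\<^sub>M J (\<lambda>_. borel))"
  using assms(1)
proof induction
  case (wave c d)
  then show ?case using assms(2) by measurable
qed auto

lemma trig_polys_bounded:
  assumes "p \<in> trig_polys J"
  shows "\<exists>C. \<forall>x. \<bar>p x\<bar> \<le> C"
  using assms
proof induction
  case (wave c d)
  then show ?case by (auto intro!: exI[of _ 1])
next
  case (add p q)
  then obtain C D where "\<forall>x. \<bar>p x\<bar> \<le> C" "\<forall>x. \<bar>q x\<bar> \<le> D" by blast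
  then show ?case by (intro exI[of _ "C + D"]) (metis abs_triangle_ineq add_mono order_trans)
next
  case (scale p k)
  then obtain C where "\<forall>x. \<bar>p x\<bar> \<le> C" by blast
  then show ?case by (intro exI[of _ "\<bar>k\<bar> * C"]) (auto simp: abs_mult mult_left_mono)
qed

text \<open>
  The substitution \<open>y i = sin (w * x i)\<close> turns the polynomials of the Stone-Weierstrass theorem on
  \<open>[-1, 1]\<^sup>J\<close> into trigonometric polynomials, which are controlled on all of \<open>\<real>\<^sup>J\<close>.
\<close>

lemma trig_polys_approx:
  fixes f :: "('i \<Rightarrow> real) \<Rightarrow> real"
  assumes J: "finite J"
    and f: "continuous_map (product_topology (\<lambda>_. euclideanreal) J) euclideanreal f"
    and B: "\<And>x. x \<in> (\<Pi>\<^sub>E i\<in>J. UNIV) \<Longrightarrow> \<bar>f x\<bar> \<le> B"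
    and R: "R > 0" and e: "e > 0"
  obtains p where "p \<in> trig_polys J"
    "\<And>x. x \<in> (\<Pi>\<^sub>E i\<in>J. UNIV) \<Longrightarrow> (\<And>i. i \<in> J \<Longrightarrow> \<bar>x i\<bar> \<le> R) \<Longrightarrow> \<bar>f x - p x\<bar> < e"
    "\<And>x. \<bar>p x\<bar> \<le> B + e"
proof -
  define S :: "('i \<Rightarrow> real) set" where "S = (\<Pi>\<^sub>E i\<in>J. {-1..1})"
  \<comment> \<open>With this frequency |x| \<le> R means that w x lies in [-pi/2, pi/2], where
    \<open>arcsin\<close> inverts \<open>sin\<close>.\<close>
  define w where "w = pi / (2 * R)"
  have w: "w > 0" using R by (simp add: w_def)
  \<comment> \<open>The algebra of continuous functions on the cube whose pull-back under the sine
    substitution is a trigonometric polynomial.\<close>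
  define P where "P g \<longleftrightarrow> continuous_on S g \<and> (\<lambda>x. g (\<lambda>i\<in>J. sin (w * x i))) \<in> trig_polys J"
    for g :: "('i \<Rightarrow> real) \<Rightarrow> real"
  \<comment> \<open>The function f seen on the cube. Its values are values of f, hence bounded by B,
    and this keeps the approximant bounded outside the box of radius R as well.\<close>
  define G where "G y = f (\<lambda>i\<in>J. arcsin (y i) / w)" for y
  \<comment> \<open>Written as a product over all indices, with a one-point factor off J, the cube
    is compact by Tychonoff.\<close>
  have SU: "S = (\<Pi>\<^sub>E i\<in>UNIV. if i \<in> J then {-1..1} else {undefined})"
  proof (intro set_eqI iffI)
    fix x assume "x \<in> S"
    then show "x \<in> (\<Pi>\<^sub>E i\<in>UNIV. if i \<in> J then {-1..1} else {undefined})"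
      unfolding S_def by (simp add: PiE_iff extensional_def)
  next
    fix x :: "'i \<Rightarrow> real" assume x: "x \<in> (\<Pi>\<^sub>E i\<in>UNIV. if i \<in> J then {-1..1} else {undefined})"
    have "x i \<in> {-1..1}" if "i \<in> J" for i using PiE_mem[OF x, of i] that by simp
    moreover have "x i = undefined" if "i \<notin> J" for i using PiE_mem[OF x, of i] that by simp
    ultimately show "x \<in> S" unfolding S_def by (simp add: PiE_iff extensional_def)
  qed
  have "compactin (product_topology (\<lambda>_. euclidean) UNIV) S"
    unfolding SU compactin_PiE by simp
  then have S: "compact S"
    by (simp add: euclidean_product_topology)
  have PJ: "P (\<lambda>y. y i)" if "i \<in> J" for i
  proof -
    have "(\<lambda>x. sin (w * x i)) = (\<lambda>x. cos ((\<Sum>j\<in>J. (if j = i then w else 0) * x j) + (- (pi/2))))"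
    proof
      fix x
      have "(\<Sum>j\<in>J. (if j = i then w else 0) * x j) = (\<Sum>j\<in>J. if j = i then w * x j else 0)"
        by (intro sum.cong) auto
      also have "\<dots> = w * x i" using that J by simp
      finally show "sin (w * x i) = cos ((\<Sum>j\<in>J. (if j = i then w else 0) * x j) + (- (pi/2)))"
        by (simp add: cos_diff)
    qed
    then have "(\<lambda>x. sin (w * x i)) \<in> trig_polys J" by (simp only: trig_polys.wave)
    then show ?thesis using that unfolding P_def
      by (auto intro: continuous_on_subset[OF continuous_on_product_coordinates])
  qed
  have G: "continuous_on S G"
  proof -
    have "continuous_map (top_of_set S) (product_topology (\<lambda>_. euclideanreal) J) (\<lambda>y. \<lambda>i\<in>J. arcsin (y i) / w)"
      unfolding continuous_map_componentwise
      using w by (auto simp: S_def intro!: continuous_intros continuous_on_subset[OF continuous_on_product_coordinates])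
    then have "continuous_map (top_of_set S) euclideanreal (f \<circ> (\<lambda>y. \<lambda>i\<in>J. arcsin (y i) / w))"
      using f continuous_map_compose by blast
    then show ?thesis by (simp add: G_def[abs_def] o_def)
  qed
  have "\<exists>g. P g \<and> (\<forall>x\<in>S. \<bar>G x - g x\<bar> < e)"
  proof (rule Stone_Weierstrass_HOL[OF S])
    show "P (\<lambda>x. c)" for c unfolding P_def by (auto simp: trig_polys_const)
    show "\<And>f. P f \<Longrightarrow> continuous_on S f" by (simp add: P_def)
    show "\<And>f g. P f \<and> P g \<Longrightarrow> P (\<lambda>x. f x + g x)"
      unfolding P_def by (auto intro: continuous_intros trig_polys.add)
    show "\<And>f g. P f \<and> P g \<Longrightarrow> P (\<lambda>x. f x * g x)"
      unfolding P_def by (auto intro: continuous_intros trig_polys_mult)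
    show "\<exists>f. P f \<and> f x \<noteq> f y" if "x \<in> S \<and> y \<in> S \<and> x \<noteq> y" for x y
    proof -
      obtain i where i: "x i \<noteq> y i" using \<open>x \<in> S \<and> y \<in> S \<and> x \<noteq> y\<close> by blast
      have "i \<in> J" using that i unfolding S_def by (metis PiE_arb)
      with i PJ show ?thesis by blast
    qed
  qed (use G e in auto)
  then obtain g where g: "P g" "\<And>y. y \<in> S \<Longrightarrow> \<bar>G y - g y\<bar> < e" by blast
  define p where "p x = g (\<lambda>i\<in>J. sin (w * x i))" for x
  have inS: "(\<lambda>i\<in>J. sin (w * x i)) \<in> S" for x by (auto simp: S_def)
  show ?thesis
  proof (rule that[of p])
    show "p \<in> trig_polys J" using g(1) by (simp add: P_def p_def[abs_def])
    fix x
    have "\<bar>G (\<lambda>i\<in>J. sin (w * x i))\<bar> \<le> B" unfolding G_def by (intro B) auto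
    with g(2)[OF inS, of x] show "\<bar>p x\<bar> \<le> B + e" unfolding p_def by linarith
  next
    fix x assume x: "x \<in> (\<Pi>\<^sub>E i\<in>J. UNIV)" and xR: "\<And>i. i \<in> J \<Longrightarrow> \<bar>x i\<bar> \<le> R"
    have "arcsin (sin (w * x i)) / w = x i" if "i \<in> J" for i
    proof -
      have "\<bar>w * x i\<bar> \<le> pi / 2"
        using xR[OF that] R mult_left_mono[OF xR[OF that], of w] w by (simp add: abs_mult w_def)
      then have "arcsin (sin (w * x i)) = w * x i" by (intro arcsin_sin) auto
      then show ?thesis using w by simp
    qed
    then have "G (\<lambda>i\<in>J. sin (w * x i)) = f x"
    proof -
      assume *: "\<And>i. i \<in> J \<Longrightarrow> arcsin (sin (w * x i)) / w = x i"
      have "(\<lambda>i\<in>J. arcsin ((\<lambda>i\<in>J. sin (w * x i)) i) / w) = x"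
      proof
        fix i show "(\<lambda>i\<in>J. arcsin ((\<lambda>i\<in>J. sin (w * x i)) i) / w) i = x i"
          using *[of i] PiE_arb[OF x, of i] by (cases "i \<in> J") auto
      qed
      then show ?thesis by (simp add: G_def)
    qed
    with g(2)[OF inS, of x] show "\<bar>f x - p x\<bar> < e" by (simp add: p_def)
  qed
qed

text \<open>Continuity refers to the product topology, measurability to the product sigma-algebra.
  Trigonometric polynomials are measurable for the latter, and those approximating f on growing
  boxes converge to it pointwise.\<close>

lemma continuous_map_measurable_PiM:
  fixes f :: "('i \<Rightarrow> real) \<Rightarrow> real"
  assumes J: "finite J"
    and f: "continuous_map (product_topology (\<lambda>_. euclideanreal) J) euclideanreal f"
    and B: "\<And>x. x \<in> (\<Pi>\<^sub>E i\<in>J. UNIV) \<Longrightarrow> \<bar>f x\<bar> \<le> B"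
  shows "f \<in> borel_measurable (Pi\<^sub>M J (\<lambda>_. borel))"
proof -
  have "\<exists>p. p \<in> trig_polys J \<and> (\<forall>x\<in>(\<Pi>\<^sub>E i\<in>J. UNIV). (\<forall>i\<in>J. \<bar>x i\<bar> \<le> real (Suc n)) \<longrightarrow> \<bar>f x - p x\<bar> < 1 / real (Suc n))" for n
    using trig_polys_approx[OF J f B, of "real (Suc n)" "1 / real (Suc n)"]
    by (metis of_nat_0_less_iff zero_less_Suc zero_less_divide_1_iff)
  then obtain p where p: "\<And>n. p n \<in> trig_polys J"
    "\<And>n x. x \<in> (\<Pi>\<^sub>E i\<in>J. UNIV) \<Longrightarrow> (\<forall>i\<in>J. \<bar>x i\<bar> \<le> real (Suc n)) \<Longrightarrow> \<bar>f x - p n x\<bar> < 1 / real (Suc n)"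
    by metis
  show ?thesis
  proof (rule borel_measurable_LIMSEQ_real)
    show "p n \<in> borel_measurable (Pi\<^sub>M J (\<lambda>_. borel))" for n
      using p(1) J by (rule trig_polys_measurable)
    fix x assume "x \<in> space (Pi\<^sub>M J (\<lambda>_. borel :: real measure))"
    then have x: "x \<in> (\<Pi>\<^sub>E i\<in>J. UNIV)" by (simp add: space_PiM)
    obtain m where m: "(\<Sum>i\<in>J. \<bar>x i\<bar>) \<le> real m" using real_arch_simple by blast
    have "\<forall>\<^sub>F n in sequentially. norm (p n x - f x) \<le> 1 / real (Suc n)"
      using eventually_ge_at_top[of m]
    proof eventually_elim
      case (elim n)
      have "\<bar>x i\<bar> \<le> real (Suc n)" if "i \<in> J" for i
      proof -
        have "\<bar>x i\<bar> \<le> (\<Sum>i\<in>J. \<bar>x i\<bar>)" using that J by (intro member_le_sum) auto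
        with m elim show ?thesis by linarith
      qed
      then show ?case using p(2)[OF x, of n] by (simp add: abs_minus_commute)
    qed
    moreover have "(\<lambda>n. 1 / real (Suc n)) \<longlonglongrightarrow> 0" by real_asymp
    ultimately have "(\<lambda>n. p n x - f x) \<longlonglongrightarrow> 0" by (rule Lim_null_comparison)
    then show "(\<lambda>n. p n x) \<longlonglongrightarrow> f x" by (simp add: LIM_zero_iff)
  qed
qed

section \<open>Weak convergence from cosines of linear forms and second moments\<close>

lemma (in prob_space) trig_approx_error:
  assumes J: "finite J" and X: "\<And>i. i \<in> J \<Longrightarrow> X i \<in> borel_measurable M"
    "\<And>i. i \<in> J \<Longrightarrow> integrable M (\<lambda>\<omega>. (X i \<omega>)\<^sup>2)" "\<And>i. i \<in> J \<Longrightarrow> expectation (\<lambda>\<omega>. (X i \<omega>)\<^sup>2) \<le> C"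
    and f[measurable]: "f \<in> borel_measurable (Pi\<^sub>M J (\<lambda>_. borel))"
    and p[measurable]: "p \<in> borel_measurable (Pi\<^sub>M J (\<lambda>_. borel))"
    and fB: "\<And>x. x \<in> (\<Pi>\<^sub>E i\<in>J. UNIV) \<Longrightarrow> \<bar>f x\<bar> \<le> B" and pB: "\<And>x. \<bar>p x\<bar> \<le> B + e"
    and fp: "\<And>x. x \<in> (\<Pi>\<^sub>E i\<in>J. UNIV) \<Longrightarrow> (\<And>i. i \<in> J \<Longrightarrow> \<bar>x i\<bar> \<le> R) \<Longrightarrow> \<bar>f x - p x\<bar> < e"
    and e: "e > 0" and R: "R > 0" and B: "B \<ge> 0"
  shows "\<bar>expectation (\<lambda>\<omega>. f (\<lambda>i\<in>J. X i \<omega>)) - expectation (\<lambda>\<omega>. p (\<lambda>i\<in>J. X i \<omega>))\<bar>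
    \<le> e + 2 * B * (real (card J) * C / R\<^sup>2)"
proof -
  let ?X = "\<lambda>\<omega>. \<lambda>i\<in>J. X i \<omega>"
  have Xm[measurable]: "?X \<in> measurable M (Pi\<^sub>M J (\<lambda>_. borel))"
    using X(1) by (rule measurable_restrict)
  have XE: "?X \<omega> \<in> (\<Pi>\<^sub>E i\<in>J. UNIV)" for \<omega> by simp
  have fi: "integrable M (\<lambda>\<omega>. f (?X \<omega>))"
    by (rule integrable_const_bound[of _ B]) (use fB[OF XE] in auto)
  have pi: "integrable M (\<lambda>\<omega>. p (?X \<omega>))"
    by (rule integrable_const_bound[of _ "B + e"]) (use pB in auto)
  \<comment> \<open>Inside the box the error is below e. Outside it, |f| + |p| \<le> 2 B + e and
    some summand is at least 1: a pointwise form of the Chebyshev inequality.\<close>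
  have bd: "\<bar>f (?X \<omega>) - p (?X \<omega>)\<bar> \<le> e + 2 * B * (\<Sum>i\<in>J. (X i \<omega>)\<^sup>2 / R\<^sup>2)" for \<omega>
  proof (cases "\<forall>i\<in>J. \<bar>X i \<omega>\<bar> \<le> R")
    case True
    then have "\<bar>f (?X \<omega>) - p (?X \<omega>)\<bar> < e" by (intro fp XE) auto
    moreover have "0 \<le> 2 * B * (\<Sum>i\<in>J. (X i \<omega>)\<^sup>2 / R\<^sup>2)" using B by (intro mult_nonneg_nonneg sum_nonneg) auto
    ultimately show ?thesis by linarith
  next
    case False
    then obtain i where i: "i \<in> J" "R < \<bar>X i \<omega>\<bar>" by (auto simp: not_le)
    have "R\<^sup>2 \<le> (X i \<omega>)\<^sup>2" using i R by (simp add: abs_le_square_iff[symmetric])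
    then have "1 \<le> (X i \<omega>)\<^sup>2 / R\<^sup>2" using R by simp
    also have "\<dots> \<le> (\<Sum>i\<in>J. (X i \<omega>)\<^sup>2 / R\<^sup>2)" using i J by (intro member_le_sum) auto
    finally have "2 * B * 1 \<le> 2 * B * (\<Sum>i\<in>J. (X i \<omega>)\<^sup>2 / R\<^sup>2)" using B by (intro mult_left_mono) auto
    moreover have "\<bar>f (?X \<omega>) - p (?X \<omega>)\<bar> \<le> B + (B + e)" using fB[OF XE, of \<omega>] pB[of "?X \<omega>"] by linarith
    ultimately show ?thesis by linarith
  qed
  have si: "integrable M (\<lambda>\<omega>. e + 2 * B * (\<Sum>i\<in>J. (X i \<omega>)\<^sup>2 / R\<^sup>2))" using X(2) by auto
  have "\<bar>expectation (\<lambda>\<omega>. f (?X \<omega>)) - expectation (\<lambda>\<omega>. p (?X \<omega>))\<bar> = \<bar>expectation (\<lambda>\<omega>. f (?X \<omega>) - p (?X \<omega>))\<bar>"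
    using fi pi by simp
  also have "\<dots> \<le> expectation (\<lambda>\<omega>. \<bar>f (?X \<omega>) - p (?X \<omega>)\<bar>)" by (rule integral_abs_bound)
  also have "\<dots> \<le> expectation (\<lambda>\<omega>. e + 2 * B * (\<Sum>i\<in>J. (X i \<omega>)\<^sup>2 / R\<^sup>2))"
    using fi pi si by (intro integral_mono bd) auto
  also have "\<dots> = e + 2 * B * (\<Sum>i\<in>J. expectation (\<lambda>\<omega>. (X i \<omega>)\<^sup>2) / R\<^sup>2)"
    using X(2) by (simp add: prob_space)
  also have "\<dots> \<le> e + 2 * B * (\<Sum>i\<in>J. C / R\<^sup>2)"
    using B by (intro add_left_mono mult_left_mono sum_mono divide_right_mono X(3)) auto
  also have "(\<Sum>i\<in>J. C / R\<^sup>2) = real (card J) * C / R\<^sup>2" by simp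
  finally show ?thesis .
qed

lemma trig_polys_tendsto:
  assumes "p \<in> trig_polys J" and "finite J"
    and M: "prob_space M" and N: "prob_space N"
    and X: "\<forall>\<^sub>F T in F. \<forall>i\<in>J. X T i \<in> borel_measurable M"
    and Y: "\<And>i. i \<in> J \<Longrightarrow> Y i \<in> borel_measurable N"
    and cos: "\<And>c d. ((\<lambda>T. \<integral>\<omega>. cos ((\<Sum>i\<in>J. c i * X T i \<omega>) + d) \<partial>M) \<longlongrightarrow>
       (\<integral>\<omega>. cos ((\<Sum>i\<in>J. c i * Y i \<omega>) + d) \<partial>N)) F"
  shows "((\<lambda>T. \<integral>\<omega>. p (\<lambda>i\<in>J. X T i \<omega>) \<partial>M) \<longlongrightarrow> (\<integral>\<omega>. p (\<lambda>i\<in>J. Y i \<omega>) \<partial>N)) F"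
proof -
  interpret M: prob_space M by (rule M)
  interpret N: prob_space N by (rule N)
  have int: "integrable P (\<lambda>\<omega>. p (\<lambda>i\<in>J. Z i \<omega>))"
    if p: "p \<in> trig_polys J" and Z: "\<And>i. i \<in> J \<Longrightarrow> Z i \<in> borel_measurable P" and P: "prob_space P" for p P and Z :: "'a \<Rightarrow> 'e \<Rightarrow> real"
  proof -
    interpret P: prob_space P by (rule P)
    obtain C where "\<And>x. \<bar>p x\<bar> \<le> C" using trig_polys_bounded[OF p] by blast
    moreover have "(\<lambda>\<omega>. p (\<lambda>i\<in>J. Z i \<omega>)) \<in> borel_measurable P"
      by (rule measurable_compose[OF measurable_restrict trig_polys_measurable[OF p \<open>finite J\<close>]])
        (use Z in auto)
    ultimately show ?thesis by (intro P.integrable_const_bound[of _ C]) auto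
  qed
  show ?thesis using assms(1)
  proof induction
    case (wave c d)
    then show ?case using cos[of c d] by (simp cong: sum.cong)
  next
    case (add p q)
    have "\<forall>\<^sub>F T in F. (\<integral>\<omega>. p (\<lambda>i\<in>J. X T i \<omega>) \<partial>M) + (\<integral>\<omega>. q (\<lambda>i\<in>J. X T i \<omega>) \<partial>M) =
      (\<integral>\<omega>. p (\<lambda>i\<in>J. X T i \<omega>) + q (\<lambda>i\<in>J. X T i \<omega>) \<partial>M)"
      using X
    proof eventually_elim
      case (elim T)
      show ?case using int[OF add(1) _ M, of "X T"] int[OF add(2) _ M, of "X T"] elim
        by (intro Bochner_Integration.integral_add[symmetric]) auto
    qed
    note ev = this
    have "(\<integral>\<omega>. p (\<lambda>i\<in>J. Y i \<omega>) + q (\<lambda>i\<in>J. Y i \<omega>) \<partial>N) =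
       (\<integral>\<omega>. p (\<lambda>i\<in>J. Y i \<omega>) \<partial>N) + (\<integral>\<omega>. q (\<lambda>i\<in>J. Y i \<omega>) \<partial>N)"
      using int[OF add(1) _ N, of Y] int[OF add(2) _ N, of Y] Y by (intro Bochner_Integration.integral_add) auto
    then show ?case using Lim_transform_eventually[OF tendsto_add[OF add.IH] ev] by (simp only:)
  next
    case (scale p k)
    show ?case using tendsto_mult_left[OF scale.IH, of k] by simp
  qed
qed

text \<open>A continuity theorem in several variables: the uniform second moment bound controls the
  mass outside a box, and inside the box f is replaced by a trigonometric polynomial, whose
  expectations converge by linearity.\<close>

lemma weak_convergence_criterion:
  fixes X :: "'p \<Rightarrow> 'i \<Rightarrow> 'a \<Rightarrow> real" and Y :: "'i \<Rightarrow> 'b \<Rightarrow> real"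
  assumes M: "prob_space M" and N: "prob_space N" and J: "finite J"
    and X: "\<forall>\<^sub>F T in F. \<forall>i\<in>J. X T i \<in> borel_measurable M \<and> integrable M (\<lambda>\<omega>. (X T i \<omega>)\<^sup>2) \<and> (\<integral>\<omega>. (X T i \<omega>)\<^sup>2 \<partial>M) \<le> C"
    and Y: "\<And>i. i \<in> J \<Longrightarrow> Y i \<in> borel_measurable N" "\<And>i. i \<in> J \<Longrightarrow> integrable N (\<lambda>\<omega>. (Y i \<omega>)\<^sup>2)"
       "\<And>i. i \<in> J \<Longrightarrow> (\<integral>\<omega>. (Y i \<omega>)\<^sup>2 \<partial>N) \<le> C"
    and cos: "\<And>c d. ((\<lambda>T. \<integral>\<omega>. cos ((\<Sum>i\<in>J. c i * X T i \<omega>) + d) \<partial>M) \<longlongrightarrow>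
       (\<integral>\<omega>. cos ((\<Sum>i\<in>J. c i * Y i \<omega>) + d) \<partial>N)) F"
    and f: "continuous_map (product_topology (\<lambda>_. euclideanreal) J) euclideanreal f"
    and fB: "\<And>x. x \<in> (\<Pi>\<^sub>E i\<in>J. UNIV) \<Longrightarrow> \<bar>f x\<bar> \<le> B"
  shows "((\<lambda>T. \<integral>\<omega>. f (\<lambda>i\<in>J. X T i \<omega>) \<partial>M) \<longlongrightarrow> (\<integral>\<omega>. f (\<lambda>i\<in>J. Y i \<omega>) \<partial>N)) F"
proof (rule tendstoI)
  fix e :: real assume e: "e > 0"
  interpret M: prob_space M by (rule M)
  interpret N: prob_space N by (rule N)
  have B: "B \<ge> 0" using fB[of "\<lambda>i\<in>J. 0"] by (auto intro: order_trans[OF abs_ge_zero])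
  have fm: "f \<in> borel_measurable (Pi\<^sub>M J (\<lambda>_. borel))" by (rule continuous_map_measurable_PiM[OF J f fB])
  \<comment> \<open>Large enough that the Chebyshev term is at most e / 8 under either law; the
    summand 1 keeps R positive when the rest vanishes. The replacement of f then costs e / 4 under
    each law, and the two expectations of p differ by less than e / 4.\<close>
  define R where "R = sqrt (1 + 2 * B * real (card J) * \<bar>C\<bar> * 8 / e)"
  have R2: "R\<^sup>2 = 1 + 2 * B * real (card J) * \<bar>C\<bar> * 8 / e" using B e by (simp add: R_def)
  have "R \<ge> 1" unfolding R_def using B e by simp
  then have R: "R > 0" by linarith
  have RC: "2 * B * (real (card J) * C / R\<^sup>2) \<le> e / 8"
  proof -
    have "2 * B * (real (card J) * C) \<le> 2 * B * (real (card J) * \<bar>C\<bar>)"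
      using B by (intro mult_left_mono) auto
    also have "\<dots> \<le> e / 8 * R\<^sup>2" unfolding R2 using e B by (simp add: field_simps)
    finally show ?thesis using R by (simp add: field_simps)
  qed
  obtain p where p: "p \<in> trig_polys J" "\<And>x. x \<in> (\<Pi>\<^sub>E i\<in>J. UNIV) \<Longrightarrow> (\<And>i. i \<in> J \<Longrightarrow> \<bar>x i\<bar> \<le> R) \<Longrightarrow> \<bar>f x - p x\<bar> < e / 8"
    "\<And>x. \<bar>p x\<bar> \<le> B + e / 8"
    using trig_polys_approx[OF J f fB R, of "e / 8"] e by auto
  have pm: "p \<in> borel_measurable (Pi\<^sub>M J (\<lambda>_. borel))" using p(1) J by (rule trig_polys_measurable)
  have eY: "\<bar>(\<integral>\<omega>. f (\<lambda>i\<in>J. Y i \<omega>) \<partial>N) - (\<integral>\<omega>. p (\<lambda>i\<in>J. Y i \<omega>) \<partial>N)\<bar> \<le> e / 8 + e / 8"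
    by (rule order_trans[OF N.trig_approx_error[OF J Y fm pm fB p(3) p(2) _ R B]]) (use e RC in auto)
  have "((\<lambda>T. \<integral>\<omega>. p (\<lambda>i\<in>J. X T i \<omega>) \<partial>M) \<longlongrightarrow> (\<integral>\<omega>. p (\<lambda>i\<in>J. Y i \<omega>) \<partial>N)) F"
  proof (rule trig_polys_tendsto[OF p(1) J M N _ Y(1) cos])
    show "\<forall>\<^sub>F T in F. \<forall>i\<in>J. X T i \<in> borel_measurable M" using X by eventually_elim blast
  qed
  then have "\<forall>\<^sub>F T in F. dist (\<integral>\<omega>. p (\<lambda>i\<in>J. X T i \<omega>) \<partial>M) (\<integral>\<omega>. p (\<lambda>i\<in>J. Y i \<omega>) \<partial>N) < e / 4"
    using e by (intro tendstoD) auto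
  then show "\<forall>\<^sub>F T in F. dist (\<integral>\<omega>. f (\<lambda>i\<in>J. X T i \<omega>) \<partial>M) (\<integral>\<omega>. f (\<lambda>i\<in>J. Y i \<omega>) \<partial>N) < e"
    using X
  proof eventually_elim
    case (elim T)
    have "\<bar>(\<integral>\<omega>. f (\<lambda>i\<in>J. X T i \<omega>) \<partial>M) - (\<integral>\<omega>. p (\<lambda>i\<in>J. X T i \<omega>) \<partial>M)\<bar> \<le> e / 8 + e / 8"
      by (rule order_trans[OF M.trig_approx_error[OF J _ _ _ fm pm fB p(3) p(2) _ R B]]) (use elim(2) e RC in auto)
    then show ?case using eY elim(1) e unfolding dist_real_def by linarith
  qed
qed

section \<open>Uniqueness of finite-dimensional laws\<close>

lemma sets_PiM_atMost:
  assumes "finite J"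
  shows "sets (Pi\<^sub>M J (\<lambda>_. borel :: real measure)) =
    sigma_sets (\<Pi>\<^sub>E i\<in>J. UNIV) {\<Pi>\<^sub>E i\<in>J. {..a i} | a. True}"
proof -
  define P :: "('a \<Rightarrow> real) set set" where
    "P = {{f\<in>(\<Pi>\<^sub>E i\<in>J. UNIV). \<forall>i\<in>j. f i \<in> A i} | A j. j \<in> {J} \<and> A \<in> Pi j (\<lambda>_. range atMost)}"
  have "sets (Pi\<^sub>M J (\<lambda>_. borel :: real measure)) = sets (sigma (\<Pi>\<^sub>E i\<in>J. UNIV) P)"
    unfolding borel_eq_atMost P_def
  proof (rule sets_PiM_sigma)
    have "(UNIV :: real set) = \<Union> (range (\<lambda>n. {..real n}))" by (auto simp: real_arch_simple)
    moreover have "range (\<lambda>n. {..real n}) \<subseteq> range atMost" by blast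
    ultimately show "\<exists>S\<subseteq>range atMost. countable S \<and> (UNIV :: real set) = \<Union>S"
      by (intro exI[of _ "range (\<lambda>n. {..real n})"]) simp
  qed (use assms in auto)
  also have "\<dots> = sigma_sets (\<Pi>\<^sub>E i\<in>J. UNIV) P" by (rule sets_measure_of) (auto simp: P_def)
  also have "P = {\<Pi>\<^sub>E i\<in>J. {..a i} | a. True}"
  proof (intro equalityI subsetI)
    fix S assume "S \<in> P"
    then obtain A where A: "S = {f\<in>(\<Pi>\<^sub>E i\<in>J. UNIV). \<forall>i\<in>J. f i \<in> A i}" "A \<in> Pi J (\<lambda>_. range atMost)"
      unfolding P_def by auto
    then have "\<forall>i\<in>J. \<exists>b. A i = {..b}" by blast
    from bchoice[OF this] obtain a where a: "\<forall>i\<in>J. A i = {..a i}" ..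
    have "S = (\<Pi>\<^sub>E i\<in>J. {..a i})" unfolding A(1) using a by (auto simp: PiE_iff extensional_def)
    then show "S \<in> {\<Pi>\<^sub>E i\<in>J. {..a i} | a. True}" by blast
  next
    fix S :: "('a \<Rightarrow> real) set" assume "S \<in> {\<Pi>\<^sub>E i\<in>J. {..a i} | a. True}"
    then obtain a :: "'a \<Rightarrow> real" where a: "S = (\<Pi>\<^sub>E i\<in>J. {..a i})" by blast
    then have "S = {f\<in>(\<Pi>\<^sub>E i\<in>J. UNIV). \<forall>i\<in>J. f i \<in> {..a i}}" by (auto simp: PiE_iff extensional_def)
    then show "S \<in> P" unfolding P_def by (intro CollectI exI[of _ "\<lambda>i. {..a i}"] exI[of _ J]) auto
  qed
  finally show ?thesis .
qed

text \<open>Convergence of a constant sequence is equality, so the criterion above shows that the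
  two laws integrate bounded continuous functions alike. Lower orthants, an intersection-stable
  generator, are reached as limits of such functions.\<close>

lemma distr_eq_of_cos:
  fixes X :: "'i \<Rightarrow> 'a \<Rightarrow> real" and Y :: "'i \<Rightarrow> 'b \<Rightarrow> real"
  assumes M: "prob_space M" and N: "prob_space N" and J: "finite J"
    and X: "\<And>i. i \<in> J \<Longrightarrow> X i \<in> borel_measurable M" "\<And>i. i \<in> J \<Longrightarrow> integrable M (\<lambda>\<omega>. (X i \<omega>)\<^sup>2)"
    and Y: "\<And>i. i \<in> J \<Longrightarrow> Y i \<in> borel_measurable N" "\<And>i. i \<in> J \<Longrightarrow> integrable N (\<lambda>\<omega>. (Y i \<omega>)\<^sup>2)"
    and cos: "\<And>c d. (\<integral>\<omega>. cos ((\<Sum>i\<in>J. c i * X i \<omega>) + d) \<partial>M) = (\<integral>\<omega>. cos ((\<Sum>i\<in>J. c i * Y i \<omega>) + d) \<partial>N)"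
  shows "distr M (Pi\<^sub>M J (\<lambda>_. borel)) (\<lambda>\<omega>. \<lambda>i\<in>J. X i \<omega>) = distr N (Pi\<^sub>M J (\<lambda>_. borel)) (\<lambda>\<omega>. \<lambda>i\<in>J. Y i \<omega>)"
proof -
  interpret M: prob_space M by (rule M)
  interpret N: prob_space N by (rule N)
  let ?X = "\<lambda>\<omega>. \<lambda>i\<in>J. X i \<omega>" and ?Y = "\<lambda>\<omega>. \<lambda>i\<in>J. Y i \<omega>"
  let ?P = "Pi\<^sub>M J (\<lambda>_. borel :: real measure)"
  have Xm[measurable]: "?X \<in> measurable M ?P" using X(1) by (rule measurable_restrict)
  have Ym[measurable]: "?Y \<in> measurable N ?P" using Y(1) by (rule measurable_restrict)
  interpret DX: prob_space "distr M ?P ?X" by (rule M.prob_space_distr[OF Xm])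
  interpret DY: prob_space "distr N ?P ?Y" by (rule N.prob_space_distr[OF Ym])
  define C where "C = (\<Sum>i\<in>J. (\<integral>\<omega>. (X i \<omega>)\<^sup>2 \<partial>M)) + (\<Sum>i\<in>J. (\<integral>\<omega>. (Y i \<omega>)\<^sup>2 \<partial>N))"
  have C: "(\<integral>\<omega>. (X i \<omega>)\<^sup>2 \<partial>M) \<le> C" "(\<integral>\<omega>. (Y i \<omega>)\<^sup>2 \<partial>N) \<le> C" if "i \<in> J" for i
  proof -
    have "(\<integral>\<omega>. (X i \<omega>)\<^sup>2 \<partial>M) \<le> (\<Sum>i\<in>J. (\<integral>\<omega>. (X i \<omega>)\<^sup>2 \<partial>M))"
      "(\<integral>\<omega>. (Y i \<omega>)\<^sup>2 \<partial>N) \<le> (\<Sum>i\<in>J. (\<integral>\<omega>. (Y i \<omega>)\<^sup>2 \<partial>N))"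
      using that J by (auto intro!: member_le_sum)
    moreover have "0 \<le> (\<Sum>i\<in>J. (\<integral>\<omega>. (X i \<omega>)\<^sup>2 \<partial>M))" "0 \<le> (\<Sum>i\<in>J. (\<integral>\<omega>. (Y i \<omega>)\<^sup>2 \<partial>N))"
      by (auto intro!: sum_nonneg)
    ultimately show "(\<integral>\<omega>. (X i \<omega>)\<^sup>2 \<partial>M) \<le> C" "(\<integral>\<omega>. (Y i \<omega>)\<^sup>2 \<partial>N) \<le> C" unfolding C_def by linarith+
  qed
  have eq: "(\<integral>\<omega>. f (?X \<omega>) \<partial>M) = (\<integral>\<omega>. f (?Y \<omega>) \<partial>N)"
    if f: "continuous_map (product_topology (\<lambda>_. euclideanreal) J) euclideanreal f"
      "\<And>x. x \<in> (\<Pi>\<^sub>E i\<in>J. UNIV) \<Longrightarrow> \<bar>f x\<bar> \<le> B" for f B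
  proof -
    have "((\<lambda>T::nat. \<integral>\<omega>. f (?X \<omega>) \<partial>M) \<longlongrightarrow> (\<integral>\<omega>. f (?Y \<omega>) \<partial>N)) sequentially"
      by (rule weak_convergence_criterion[OF M N J _ Y C(2) _ f]) (use X C cos in auto)
    then show ?thesis by (simp add: LIMSEQ_const_iff)
  qed
  have box: "emeasure (distr M ?P ?X) (\<Pi>\<^sub>E i\<in>J. {..a i}) = emeasure (distr N ?P ?Y) (\<Pi>\<^sub>E i\<in>J. {..a i})" for a
  proof -
    \<comment> \<open>A product of ramps that leave the value 1 at a i with slope -n and stop at 0;
      as n grows they decrease to the indicator of the orthant.\<close>
    define h where "h n x = (\<Prod>i\<in>J. max 0 (min 1 (1 - real n * (x i - a i))))" for n :: nat and x :: "'i \<Rightarrow> real"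
    have h01: "0 \<le> h n x" "h n x \<le> 1" for n x
      unfolding h_def by (auto intro!: prod_nonneg prod_le_1)
    have hc: "continuous_map (product_topology (\<lambda>_. euclideanreal) J) euclideanreal (h n)" for n
      unfolding h_def[abs_def]
      by (intro continuous_map_prod J continuous_map_real_max continuous_map_real_min continuous_map_diff
          continuous_map_real_mult continuous_map_product_projection continuous_map_const[THEN iffD2]) auto
    have hm[measurable]: "h n \<in> borel_measurable ?P" for n
      by (rule continuous_map_measurable_PiM[OF J hc, of _ 1]) (use h01 in auto)
    have hl: "(\<lambda>n. h n x) \<longlonglongrightarrow> indicator (\<Pi>\<^sub>E i\<in>J. {..a i}) x" if x: "x \<in> (\<Pi>\<^sub>E i\<in>J. UNIV)" for x
    proof -
      have 1: "(\<lambda>n. max 0 (min 1 (1 - real n * (x i - a i)))) \<longlonglongrightarrow> (if x i \<le> a i then 1 else 0)" for i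
      proof (cases "x i \<le> a i")
        case True
        then have "real n * (x i - a i) \<le> 0" for n by (intro mult_nonneg_nonpos) auto
        then have "max 0 (min 1 (1 - real n * (x i - a i))) = 1" for n by (simp add: min_def max_def)
        then show ?thesis using True by simp
      next
        case False
        obtain m :: nat where m: "1 / (x i - a i) \<le> real m" using real_arch_simple by blast
        have "\<forall>\<^sub>F n in sequentially. max 0 (min 1 (1 - real n * (x i - a i))) = 0"
          using eventually_ge_at_top[of m]
        proof eventually_elim
          case (elim n)
          then have "1 / (x i - a i) \<le> real n" using m by linarith
          then have "1 \<le> real n * (x i - a i)" using False by (simp add: divide_le_eq)
          then show ?case by simp
        qed
        then show ?thesis using False by (simp add: tendsto_eventually)
      qed
      have "(\<lambda>n. h n x) \<longlonglongrightarrow> (\<Prod>i\<in>J. if x i \<le> a i then 1 else 0)"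
        unfolding h_def by (intro tendsto_prod 1)
      also have "(\<Prod>i\<in>J. if x i \<le> a i then 1 else 0) = (indicator (\<Pi>\<^sub>E i\<in>J. {..a i}) x :: real)"
      proof (cases "x \<in> (\<Pi>\<^sub>E i\<in>J. {..a i})")
        case True
        then have "x i \<le> a i" if "i \<in> J" for i using PiE_mem[OF True that] by simp
        then show ?thesis using True by simp
      next
        case False
        then obtain i where "i \<in> J" "\<not> x i \<le> a i" using x by (auto simp: PiE_iff)
        then show ?thesis using False J by (auto simp: prod_zero_iff)
      qed
      finally show ?thesis .
    qed
    have A[measurable]: "(\<Pi>\<^sub>E i\<in>J. {..a i}) \<in> sets ?P" using J by (intro sets_PiM_I_finite) auto
    have l: "(\<lambda>n. \<integral>\<omega>. h n (Z \<omega>) \<partial>Q) \<longlonglongrightarrow> measure (distr Q ?P Z) (\<Pi>\<^sub>E i\<in>J. {..a i})"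
      if Q: "prob_space Q" and Z[measurable]: "Z \<in> measurable Q ?P" for Z and Q :: "'z measure"
    proof -
      interpret Q: prob_space Q by (rule Q)
      interpret DQ: prob_space "distr Q ?P Z" by (rule Q.prob_space_distr[OF Z])
      have "(\<lambda>n. \<integral>x. h n x \<partial>distr Q ?P Z) \<longlonglongrightarrow> (\<integral>x. indicator (\<Pi>\<^sub>E i\<in>J. {..a i}) x \<partial>distr Q ?P Z)"
      proof (rule integral_dominated_convergence[where w = "\<lambda>_. 1"])
        show "AE x in distr Q ?P Z. (\<lambda>n. h n x) \<longlonglongrightarrow> indicator (\<Pi>\<^sub>E i\<in>J. {..a i}) x"
          using hl by (intro AE_I2) (simp add: space_PiM)
      qed (use h01 in auto)
      moreover have "(\<integral>x. h n x \<partial>distr Q ?P Z) = (\<integral>\<omega>. h n (Z \<omega>) \<partial>Q)" for n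
        by (rule integral_distr[OF Z hm])
      ultimately show ?thesis by simp
    qed
    have "(\<integral>\<omega>. h n (?X \<omega>) \<partial>M) = (\<integral>\<omega>. h n (?Y \<omega>) \<partial>N)" for n
      by (rule eq[OF hc, of _ 1]) (use h01 in auto)
    with l[OF M Xm] l[OF N Ym] have "measure (distr M ?P ?X) (\<Pi>\<^sub>E i\<in>J. {..a i}) = measure (distr N ?P ?Y) (\<Pi>\<^sub>E i\<in>J. {..a i})"
      by (simp add: LIMSEQ_unique)
    then show ?thesis by (simp add: DX.emeasure_eq_measure DY.emeasure_eq_measure)
  qed
  show ?thesis
  proof (rule measure_eqI_generator_eq[where E = "{\<Pi>\<^sub>E i\<in>J. {..a i} | a. True}" and A = "\<lambda>n. \<Pi>\<^sub>E i\<in>J. {..real n}"])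
    show "Int_stable {\<Pi>\<^sub>E i\<in>J. {..a i} | a :: 'i \<Rightarrow> real. True}"
    proof (rule Int_stableI)
      fix A B assume "A \<in> {\<Pi>\<^sub>E i\<in>J. {..a i} | a :: 'i \<Rightarrow> real. True}" "B \<in> {\<Pi>\<^sub>E i\<in>J. {..a i} | a :: 'i \<Rightarrow> real. True}"
      then obtain a b :: "'i \<Rightarrow> real" where "A = (\<Pi>\<^sub>E i\<in>J. {..a i})" "B = (\<Pi>\<^sub>E i\<in>J. {..b i})" by blast
      then have "A \<inter> B = (\<Pi>\<^sub>E i\<in>J. {..min (a i) (b i)})" by (auto simp: PiE_iff)
      then show "A \<inter> B \<in> {\<Pi>\<^sub>E i\<in>J. {..a i} | a :: 'i \<Rightarrow> real. True}"
        by (intro CollectI exI[of _ "\<lambda>i. min (a i) (b i)"] conjI TrueI)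
    qed
    show "(\<Union>n. \<Pi>\<^sub>E i\<in>J. {..real n}) = (\<Pi>\<^sub>E i\<in>J. UNIV)"
    proof (intro set_eqI iffI)
      fix x :: "'i \<Rightarrow> real" assume x: "x \<in> (\<Pi>\<^sub>E i\<in>J. UNIV)"
      obtain n where n: "(\<Sum>i\<in>J. \<bar>x i\<bar>) \<le> real n" using real_arch_simple ..
      have "x i \<le> real n" if "i \<in> J" for i
      proof -
        have "\<bar>x i\<bar> \<le> (\<Sum>i\<in>J. \<bar>x i\<bar>)" using that J by (intro member_le_sum) auto
        with n show ?thesis by linarith
      qed
      then show "x \<in> (\<Union>n. \<Pi>\<^sub>E i\<in>J. {..real n})" using x by (auto simp: PiE_iff)
    qed auto
  qed (use box sets_PiM_atMost[OF J] in \<open>auto simp: DX.emeasure_eq_measure\<close>)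
qed

section \<open>Gaussian spaces\<close>

text \<open>The degenerate law is included, so that later Gaussian integrals of any variance become
  integrals against the standard normal law without a case distinction.\<close>

lemma normal_law_eq_distr:
  assumes "\<sigma> \<ge> 0"
  shows "normal_law \<mu> \<sigma> = distr std_normal_distribution borel (\<lambda>x. \<mu> + \<sigma> * x)"
proof (cases "\<sigma> = 0")
  case True
  interpret prob_space std_normal_distribution by (rule prob_space_normal_density) simp
  show ?thesis using True by (simp add: normal_law_def distr_const)
next
  case False
  then have s: "\<sigma> > 0" using assms by simp
  interpret prob_space std_normal_distribution by (rule prob_space_normal_density) simp
  have "distributed std_normal_distribution lborel (\<lambda>x. x) (\<lambda>x. ennreal (normal_density 0 1 x))"
    unfolding distributed_def by (auto simp: distr_id2)
  then have "distributed std_normal_distribution lborel (\<lambda>x. \<mu> + \<sigma> * x) (normal_density (\<mu> + \<sigma> * 0) (\<bar>\<sigma>\<bar> * 1))"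
    using s by (intro normal_density_affine) auto
  then have "distr std_normal_distribution lborel (\<lambda>x. \<mu> + \<sigma> * x) = density lborel (normal_density \<mu> \<sigma>)"
    using s by (simp add: distributed_def)
  moreover have "distr std_normal_distribution lborel (\<lambda>x. \<mu> + \<sigma> * x) = distr std_normal_distribution borel (\<lambda>x. \<mu> + \<sigma> * x)"
    by (intro distr_cong) auto
  ultimately show ?thesis using s by (simp add: normal_law_def)
qed

lemma integrable_std_normal_power: "integrable std_normal_distribution (\<lambda>x. x ^ k)"
  by (subst integrable_density) (use integrable_std_normal_moment[of k] in auto)

lemma integral_std_normal_power:
  "(\<integral>x. x ^ (2 * k) \<partial>std_normal_distribution) = fact (2 * k) / (2 ^ k * fact k)"
  "(\<integral>x. x \<partial>std_normal_distribution) = 0"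
  using integral_std_normal_moment_even[of k] integral_std_normal_moment_odd[of 0]
  by (simp_all add: integral_density)

lemma std_normal_cos_sin:
  "(\<integral>x. cos (t * x) \<partial>std_normal_distribution) = exp (- t\<^sup>2 / 2)"
  "(\<integral>x. sin (t * x) \<partial>std_normal_distribution) = 0"
proof -
  interpret prob_space std_normal_distribution by (rule prob_space_normal_density) simp
  have i: "complex_integrable std_normal_distribution (\<lambda>x. iexp (t * x))"
    by (rule integrable_const_bound[of _ 1]) auto
  have c: "(CLINT x|std_normal_distribution. iexp (t * x)) = complex_of_real (exp (- t\<^sup>2 / 2))"
    using fun_cong[OF char_std_normal_distribution, of t] by (simp add: char_def)
  show "(\<integral>x. cos (t * x) \<partial>std_normal_distribution) = exp (- t\<^sup>2 / 2)"
    using integral_Re[OF i] unfolding c by (simp add: Re_exp)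
  show "(\<integral>x. sin (t * x) \<partial>std_normal_distribution) = 0"
    using integral_Im[OF i] unfolding c by (simp add: Im_exp)
qed

text \<open>A remainder quadratic in h and uniform in u: it allows E(cos(U + s W)) to be
  differentiated in s at 0 using the second moment of W alone.\<close>

lemma cos_taylor_bound: "\<bar>cos (u + h) - cos u + h * sin u\<bar> \<le> (h :: real)\<^sup>2"
proof -
  have s: "\<bar>sin h - h\<bar> \<le> h\<^sup>2 / 2"
    using Maclaurin_sin_bound[of h 2] by (simp add: numeral_2_eq_2 sin_coeff_def)
  have "cos h = 1 - 2 * (sin (h / 2))\<^sup>2" using cos_double_sin[of "h / 2"] by simp
  moreover have "(sin (h / 2))\<^sup>2 \<le> (h / 2)\<^sup>2"
    using abs_sin_x_le_abs_x[of "h / 2"] by (simp only: abs_le_square_iff)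
  ultimately have c: "\<bar>cos h - 1\<bar> \<le> h\<^sup>2 / 2" by (simp add: power2_eq_square)
  have "cos (u + h) - cos u + h * sin u = cos u * (cos h - 1) - sin u * (sin h - h)"
    by (simp add: cos_add algebra_simps)
  also have "\<bar>\<dots>\<bar> \<le> \<bar>cos u * (cos h - 1)\<bar> + \<bar>sin u * (sin h - h)\<bar>" by (rule abs_triangle_ineq4)
  also have "\<dots> \<le> h\<^sup>2 / 2 + h\<^sup>2 / 2"
  proof (intro add_mono)
    show "\<bar>cos u * (cos h - 1)\<bar> \<le> h\<^sup>2 / 2"
      using mult_mono[OF abs_cos_le_one c] by (simp add: abs_mult)
    show "\<bar>sin u * (sin h - h)\<bar> \<le> h\<^sup>2 / 2"
      using mult_mono[OF abs_sin_le_one s] by (simp add: abs_mult)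
  qed
  finally show ?thesis by simp
qed

text \<open>Closure under linear combinations is what makes finite families in V jointly Gaussian:
  every linear form of them is again centered normal, so that second moments carry their
  law.\<close>

locale gaussian_space = prob_space M for M :: "'a measure" +
  fixes V :: "('a \<Rightarrow> real) set"
  assumes meas: "U \<in> V \<Longrightarrow> U \<in> borel_measurable M"
    and law: "U \<in> V \<Longrightarrow> \<exists>\<sigma>\<ge>0. distr M borel U = normal_law 0 \<sigma>"
    and zero: "(\<lambda>_. 0) \<in> V"
    and add: "U \<in> V \<Longrightarrow> W \<in> V \<Longrightarrow> (\<lambda>\<omega>. U \<omega> + W \<omega>) \<in> V"
    and scale: "U \<in> V \<Longrightarrow> (\<lambda>\<omega>. c * U \<omega>) \<in> V"
begin

lemma diff: "U \<in> V \<Longrightarrow> W \<in> V \<Longrightarrow> (\<lambda>\<omega>. U \<omega> - W \<omega>) \<in> V"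
  using add[OF _ scale[of W "-1"], of U] by simp

lemma sum: "(\<And>i. i \<in> I \<Longrightarrow> U i \<in> V) \<Longrightarrow> (\<lambda>\<omega>. \<Sum>i\<in>I. U i \<omega>) \<in> V"
  by (induction I rule: infinite_finite_induct) (auto intro: zero add)

lemma std_law:
  assumes "U \<in> V"
  shows "\<exists>\<sigma>. \<sigma>\<^sup>2 = expectation (\<lambda>\<omega>. (U \<omega>)\<^sup>2) \<and>
    (\<forall>f :: real \<Rightarrow> real. f \<in> borel_measurable borel \<longrightarrow>
       expectation (\<lambda>\<omega>. f (U \<omega>)) = (\<integral>x. f (\<sigma> * x) \<partial>std_normal_distribution) \<and>
       (integrable M (\<lambda>\<omega>. f (U \<omega>)) \<longleftrightarrow> integrable std_normal_distribution (\<lambda>x. f (\<sigma> * x))))"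
proof -
  note [measurable] = meas[OF assms]
  obtain \<sigma> where s: "\<sigma> \<ge> 0" "distr M borel U = normal_law 0 \<sigma>" using law[OF assms] by blast
  then have d: "distr M borel U = distr std_normal_distribution borel (\<lambda>x. \<sigma> * x)"
    using normal_law_eq_distr[of \<sigma> 0] by simp
  have e: "expectation (\<lambda>\<omega>. f (U \<omega>)) = (\<integral>x. f (\<sigma> * x) \<partial>std_normal_distribution)"
    if [measurable]: "f \<in> borel_measurable borel" for f :: "real \<Rightarrow> real"
  proof -
    have "expectation (\<lambda>\<omega>. f (U \<omega>)) = (\<integral>x. f x \<partial>distr M borel U)" by (simp add: integral_distr)
    also have "\<dots> = (\<integral>x. f (\<sigma> * x) \<partial>std_normal_distribution)" unfolding d by (simp add: integral_distr)
    finally show ?thesis .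
  qed
  have i: "integrable M (\<lambda>\<omega>. f (U \<omega>)) \<longleftrightarrow> integrable std_normal_distribution (\<lambda>x. f (\<sigma> * x))"
    if [measurable]: "f \<in> borel_measurable borel" for f :: "real \<Rightarrow> real"
  proof -
    have "integrable M (\<lambda>\<omega>. f (U \<omega>)) \<longleftrightarrow> integrable (distr M borel U) f" by (simp add: integrable_distr_eq)
    also have "\<dots> \<longleftrightarrow> integrable std_normal_distribution (\<lambda>x. f (\<sigma> * x))" unfolding d by (simp add: integrable_distr_eq)
    finally show ?thesis .
  qed
  have "\<sigma>\<^sup>2 = expectation (\<lambda>\<omega>. (U \<omega>)\<^sup>2)"
    unfolding e[of "\<lambda>x. x\<^sup>2", simplified] using integral_std_normal_power(1)[of 1]
    by (simp add: power_mult_distrib)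
  then show ?thesis using e i by (intro exI[of _ \<sigma>]) simp
qed

lemma integrable_power:
  assumes "U \<in> V"
  shows "integrable M (\<lambda>\<omega>. U \<omega> ^ k)"
proof -
  obtain \<sigma> where "\<forall>f :: real \<Rightarrow> real. f \<in> borel_measurable borel \<longrightarrow>
    (integrable M (\<lambda>\<omega>. f (U \<omega>)) \<longleftrightarrow> integrable std_normal_distribution (\<lambda>x. f (\<sigma> * x)))"
    using std_law[OF assms] by meson
  from this[rule_format, of "\<lambda>x. x ^ k"] show ?thesis
    using integrable_std_normal_power[of k] by (simp add: power_mult_distrib)
qed

lemma integrable_product: "U \<in> V \<Longrightarrow> W \<in> V \<Longrightarrow> integrable M (\<lambda>\<omega>. U \<omega> * W \<omega>)"
proof -
  assume UW: "U \<in> V" "W \<in> V"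
  have "integrable M (\<lambda>\<omega>. ((U \<omega> + W \<omega>)\<^sup>2 - (U \<omega>)\<^sup>2 - (W \<omega>)\<^sup>2) / 2)"
    using integrable_power[OF add[OF UW], of 2] integrable_power[OF UW(1), of 2] integrable_power[OF UW(2), of 2] by auto
  moreover have "((U \<omega> + W \<omega>)\<^sup>2 - (U \<omega>)\<^sup>2 - (W \<omega>)\<^sup>2) / 2 = U \<omega> * W \<omega>" for \<omega> by (simp add: power2_sum)
  ultimately show ?thesis by simp
qed

lemma integrable_single: "U \<in> V \<Longrightarrow> integrable M U"
  using integrable_power[of U 1] by simp

lemma std_expectation:
  assumes "U \<in> V"
  obtains \<sigma> where "\<sigma>\<^sup>2 = expectation (\<lambda>\<omega>. (U \<omega>)\<^sup>2)"
    "\<forall>f\<in>(borel_measurable borel :: (real \<Rightarrow> real) set). expectation (\<lambda>\<omega>. f (U \<omega>)) = (\<integral>x. f (\<sigma> * x) \<partial>std_normal_distribution)"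
proof -
  from std_law[OF assms] obtain \<sigma> where s: "\<sigma>\<^sup>2 = expectation (\<lambda>\<omega>. (U \<omega>)\<^sup>2) \<and>
    (\<forall>f :: real \<Rightarrow> real. f \<in> borel_measurable borel \<longrightarrow>
       expectation (\<lambda>\<omega>. f (U \<omega>)) = (\<integral>x. f (\<sigma> * x) \<partial>std_normal_distribution) \<and>
       (integrable M (\<lambda>\<omega>. f (U \<omega>)) \<longleftrightarrow> integrable std_normal_distribution (\<lambda>x. f (\<sigma> * x))))" ..
  show ?thesis by (rule that[of \<sigma>]) (use s in blast)+
qed

lemma even_moment:
  assumes "U \<in> V"
  shows "expectation (\<lambda>\<omega>. U \<omega> ^ (2 * k)) = fact (2 * k) / (2 ^ k * fact k) * expectation (\<lambda>\<omega>. (U \<omega>)\<^sup>2) ^ k"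
proof -
  obtain \<sigma> where s: "\<sigma>\<^sup>2 = expectation (\<lambda>\<omega>. (U \<omega>)\<^sup>2)" and e: "\<forall>f\<in>(borel_measurable borel :: (real \<Rightarrow> real) set). expectation (\<lambda>\<omega>. f (U \<omega>)) = (\<integral>x. f (\<sigma> * x) \<partial>std_normal_distribution)"
    by (rule std_expectation[OF assms])
  have "expectation (\<lambda>\<omega>. U \<omega> ^ (2 * k)) = \<sigma> ^ (2 * k) * (fact (2 * k) / (2 ^ k * fact k))"
    using bspec[OF e, of "\<lambda>x. x ^ (2 * k)"] integral_std_normal_power(1)[of k] by (simp add: power_mult_distrib)
  then show ?thesis unfolding s[symmetric] power_mult[symmetric] by (simp add: mult.commute)
qed

lemma expectation_cos_sin:
  assumes "U \<in> V"
  shows "expectation (\<lambda>\<omega>. cos (U \<omega>)) = exp (- expectation (\<lambda>\<omega>. (U \<omega>)\<^sup>2) / 2)"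
    "expectation (\<lambda>\<omega>. sin (U \<omega>)) = 0"
proof -
  obtain \<sigma> where s: "\<sigma>\<^sup>2 = expectation (\<lambda>\<omega>. (U \<omega>)\<^sup>2)" and e: "\<forall>f\<in>(borel_measurable borel :: (real \<Rightarrow> real) set). expectation (\<lambda>\<omega>. f (U \<omega>)) = (\<integral>x. f (\<sigma> * x) \<partial>std_normal_distribution)"
    by (rule std_expectation[OF assms])
  show "expectation (\<lambda>\<omega>. cos (U \<omega>)) = exp (- expectation (\<lambda>\<omega>. (U \<omega>)\<^sup>2) / 2)"
    using bspec[OF e, of cos] by (simp add: std_normal_cos_sin s)
  show "expectation (\<lambda>\<omega>. sin (U \<omega>)) = 0"
    using bspec[OF e, of sin] by (simp add: std_normal_cos_sin)
qed

lemma expectation_cos_shift: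
  assumes "U \<in> V"
  shows "expectation (\<lambda>\<omega>. cos (U \<omega> + d)) = cos d * exp (- expectation (\<lambda>\<omega>. (U \<omega>)\<^sup>2) / 2)"
proof -
  note [measurable] = meas[OF assms]
  have "integrable M (\<lambda>\<omega>. cos (U \<omega>))" "integrable M (\<lambda>\<omega>. sin (U \<omega>))"
    by (rule integrable_const_bound[of _ 1]; simp)+
  then show ?thesis using expectation_cos_sin[OF assms]
    by (simp add: cos_add)
qed

lemma square_sum:
  assumes "U \<in> V" "W \<in> V"
  shows "expectation (\<lambda>\<omega>. (U \<omega> + W \<omega>)\<^sup>2) =
    expectation (\<lambda>\<omega>. (U \<omega>)\<^sup>2) + 2 * expectation (\<lambda>\<omega>. U \<omega> * W \<omega>) + expectation (\<lambda>\<omega>. (W \<omega>)\<^sup>2)"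
  using integrable_power[OF assms(1), of 2] integrable_power[OF assms(2), of 2] integrable_product[OF assms]
  by (simp add: power2_sum mult.assoc)

text \<open>Gaussian integration by parts for the sine. The function \<open>\<phi>\<close>, the
  expected cosine of U + s W, is differentiated at s = 0 in two ways: the Taylor bound gives - E(W
  sin U), and the closed form, the exponential of a quadratic in s, gives - E(U W) exp(- E(U^2) /
  2).\<close>

lemma expectation_mult_sin:
  assumes UW: "U \<in> V" "W \<in> V"
  shows "expectation (\<lambda>\<omega>. W \<omega> * sin (U \<omega>)) = expectation (\<lambda>\<omega>. U \<omega> * W \<omega>) * exp (- expectation (\<lambda>\<omega>. (U \<omega>)\<^sup>2) / 2)"
proof -
  note [measurable] = meas[OF UW(1)] meas[OF UW(2)]
  define \<phi> where "\<phi> s = expectation (\<lambda>\<omega>. cos (U \<omega> + s * W \<omega>))" for s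
  define A where "A = expectation (\<lambda>\<omega>. (U \<omega>)\<^sup>2)"
  define B where "B = expectation (\<lambda>\<omega>. U \<omega> * W \<omega>)"
  define C where "C = expectation (\<lambda>\<omega>. (W \<omega>)\<^sup>2)"
  define D where "D = expectation (\<lambda>\<omega>. W \<omega> * sin (U \<omega>))"
  have Wi: "integrable M W" "integrable M (\<lambda>\<omega>. (W \<omega>)\<^sup>2)"
    using integrable_single[OF UW(2)] integrable_power[OF UW(2)] by auto
  have ci: "integrable M (\<lambda>\<omega>. cos (U \<omega> + s * W \<omega>))" for s
    by (rule integrable_const_bound[of _ 1]) auto
  have si: "integrable M (\<lambda>\<omega>. W \<omega> * sin (U \<omega>))"
    by (rule Bochner_Integration.integrable_bound[OF Wi(1)])
      (auto simp: abs_mult intro!: mult_right_le_one_le)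
  have \<phi>: "\<phi> s = exp (- (A + 2 * s * B + s\<^sup>2 * C) / 2)" for s
  proof -
    have "\<phi> s = exp (- expectation (\<lambda>\<omega>. (U \<omega> + s * W \<omega>)\<^sup>2) / 2)"
      unfolding \<phi>_def by (intro expectation_cos_sin(1) add scale UW)
    also have "expectation (\<lambda>\<omega>. (U \<omega> + s * W \<omega>)\<^sup>2) = A + 2 * (s * B) + s\<^sup>2 * C"
      using square_sum[OF UW(1) scale[OF UW(2)], of s]
      by (simp add: A_def B_def C_def mult.left_commute[of _ s] power_mult_distrib)
    finally show ?thesis by (simp add: mult.assoc)
  qed
  have "\<bar>\<phi> s - \<phi> 0 + s * D\<bar> \<le> s\<^sup>2 * C" for s
  proof -
    have "\<phi> s - \<phi> 0 + s * D = expectation (\<lambda>\<omega>. cos (U \<omega> + s * W \<omega>) - cos (U \<omega>) + (s * W \<omega>) * sin (U \<omega>))"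
      unfolding \<phi>_def D_def using ci[of s] ci[of 0] si by (simp add: mult.assoc)
    also have "\<bar>\<dots>\<bar> \<le> expectation (\<lambda>\<omega>. \<bar>cos (U \<omega> + s * W \<omega>) - cos (U \<omega>) + (s * W \<omega>) * sin (U \<omega>)\<bar>)"
      by (rule integral_abs_bound)
    also have "\<dots> \<le> expectation (\<lambda>\<omega>. (s * W \<omega>)\<^sup>2)"
      using ci[of s] ci[of 0] si Wi(2)
      by (intro integral_mono cos_taylor_bound) (auto simp: mult.assoc power_mult_distrib)
    finally show ?thesis by (simp add: power_mult_distrib C_def)
  qed
  note bd = this
  have C0: "C \<ge> 0" unfolding C_def by simp
  have "(\<phi> has_real_derivative - D) (at 0)"
    unfolding DERIV_def
  proof (rule LIM_zero_cancel, rule Lim_null_comparison)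
    show "((\<lambda>s. \<bar>s\<bar> * C) \<longlongrightarrow> 0) (at 0)" by (auto intro!: tendsto_eq_intros)
    show "\<forall>\<^sub>F s in at 0. norm ((\<phi> (0 + s) - \<phi> 0) / s - (- D)) \<le> \<bar>s\<bar> * C"
      unfolding eventually_at_filter
    proof (intro always_eventually allI impI)
      fix s :: real assume s: "s \<noteq> 0"
      have "(\<phi> (0 + s) - \<phi> 0) / s - (- D) = (\<phi> s - \<phi> 0 + s * D) / s" using s by (simp add: add_divide_distrib)
      also have "norm \<dots> = \<bar>\<phi> s - \<phi> 0 + s * D\<bar> / \<bar>s\<bar>" by simp
      also have "\<dots> \<le> s\<^sup>2 * C / \<bar>s\<bar>" by (intro divide_right_mono bd) simp
      also have "\<dots> = \<bar>s\<bar> * C"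
        using s by (cases "s > 0") (auto simp: power2_eq_square)
      finally show "norm ((\<phi> (0 + s) - \<phi> 0) / s - (- D)) \<le> \<bar>s\<bar> * C" .
    qed
  qed
  moreover have "(\<phi> has_real_derivative (- B * exp (- A / 2))) (at 0)"
    unfolding \<phi>[abs_def] by (auto intro!: derivative_eq_intros)
  ultimately have "- D = - B * exp (- A / 2)" by (rule DERIV_unique)
  then show ?thesis by (simp add: A_def B_def D_def)
qed

text \<open>The pairs \<open>(U, W)\<close> and \<open>(- U, W)\<close> have the same law.\<close>

lemma reflection:
  assumes UW: "U \<in> V" "W \<in> V" and orth: "expectation (\<lambda>\<omega>. U \<omega> * W \<omega>) = 0"
    and f[measurable]: "f \<in> borel_measurable borel"
  shows "expectation (\<lambda>\<omega>. U \<omega> * f (W \<omega>)) = 0"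
proof -
  note [measurable] = meas[OF UW(1)] meas[OF UW(2)]
  define X where "X b = (if b then U else W)" for b :: bool
  define Y where "Y b = (if b then (\<lambda>\<omega>. - U \<omega>) else W)" for b :: bool
  have U': "(\<lambda>\<omega>. - U \<omega>) \<in> V" using scale[OF UW(1), of "-1"] by simp
  have XV: "X b \<in> V" "Y b \<in> V" for b using UW U' by (auto simp: X_def Y_def)
  note [measurable] = meas[OF XV(1)] meas[OF XV(2)]
  have eq: "distr M (Pi\<^sub>M UNIV (\<lambda>_. borel)) (\<lambda>\<omega>. \<lambda>b\<in>UNIV. X b \<omega>) = distr M (Pi\<^sub>M UNIV (\<lambda>_. borel)) (\<lambda>\<omega>. \<lambda>b\<in>UNIV. Y b \<omega>)"
  proof (rule distr_eq_of_cos)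
    fix c d
    have XS: "(\<lambda>\<omega>. \<Sum>b\<in>UNIV. c b * X b \<omega>) \<in> V" "(\<lambda>\<omega>. \<Sum>b\<in>UNIV. c b * Y b \<omega>) \<in> V"
      by (intro sum scale XV)+
    have "expectation (\<lambda>\<omega>. (\<Sum>b\<in>UNIV. c b * X b \<omega>)\<^sup>2) = expectation (\<lambda>\<omega>. (\<Sum>b\<in>UNIV. c b * Y b \<omega>)\<^sup>2)"
    proof -
      \<comment> \<open>Orthogonality removes the mixed term, so the variance depends on k only
        through k^2 and does not see the sign of U.\<close>
      have 1: "expectation (\<lambda>\<omega>. (k * U \<omega> + c False * W \<omega>)\<^sup>2) = k\<^sup>2 * expectation (\<lambda>\<omega>. (U \<omega>)\<^sup>2) + (c False)\<^sup>2 * expectation (\<lambda>\<omega>. (W \<omega>)\<^sup>2)" for k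
      proof -
        have "expectation (\<lambda>\<omega>. k * U \<omega> * (c False * W \<omega>)) = k * c False * expectation (\<lambda>\<omega>. U \<omega> * W \<omega>)"
          by (subst integral_mult_right_zero[symmetric]) (simp add: ac_simps)
        then show ?thesis using square_sum[OF scale[OF UW(1), of k] scale[OF UW(2), of "c False"]] orth
          by (simp add: power_mult_distrib)
      qed
      show ?thesis using 1[of "c True"] 1[of "- c True"] by (simp add: UNIV_bool X_def Y_def add.commute)
    qed
    then show "(\<integral>\<omega>. cos ((\<Sum>i\<in>UNIV. c i * X i \<omega>) + d) \<partial>M) = (\<integral>\<omega>. cos ((\<Sum>i\<in>UNIV. c i * Y i \<omega>) + d) \<partial>M)"
      unfolding expectation_cos_shift[OF XS(1)] expectation_cos_shift[OF XS(2)] by simp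
  qed (use XV in \<open>auto intro: meas integrable_power prob_space_axioms\<close>)
  have "expectation (\<lambda>\<omega>. X True \<omega> * f (X False \<omega>)) = (\<integral>x. x True * f (x False) \<partial>distr M (Pi\<^sub>M UNIV (\<lambda>_. borel)) (\<lambda>\<omega>. \<lambda>b\<in>UNIV. X b \<omega>))"
    by (subst integral_distr) auto
  also have "\<dots> = expectation (\<lambda>\<omega>. Y True \<omega> * f (Y False \<omega>))"
    unfolding eq by (subst integral_distr) auto
  finally show ?thesis by (simp add: X_def Y_def)
qed

end

lemma gaussian_space_span:
  assumes X: "centered_gaussian_process M K X"
  defines "V \<equiv> {\<lambda>\<omega>. \<Sum>t\<in>J. c t * X t \<omega> | J c. finite J \<and> J \<subseteq> {0..}}"
  shows "gaussian_space M V" "\<And>t. t \<ge> 0 \<Longrightarrow> X t \<in> V"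
proof -
  have g: "gaussian_process M X" and mean: "\<And>t. t \<ge> 0 \<Longrightarrow> (\<integral>\<omega>. X t \<omega> \<partial>M) = 0"
    using X unfolding centered_gaussian_process_def by auto
  have ps: "prob_space M" and m: "\<And>t. t \<ge> 0 \<Longrightarrow> X t \<in> borel_measurable M"
    and l: "\<And>J c. finite J \<Longrightarrow> J \<subseteq> {0..} \<Longrightarrow> \<exists>\<mu> \<sigma>. 0 \<le> \<sigma> \<and> distr M borel (\<lambda>\<omega>. \<Sum>t\<in>J. c t * X t \<omega>) = normal_law \<mu> \<sigma>"
    using g unfolding gaussian_process_def by auto
  interpret prob_space M by (rule ps)
  have XV: "X t \<in> V" if "t \<ge> 0" for t
    unfolding V_def using that by (intro CollectI exI[of _ "{t}"] exI[of _ "\<lambda>_. 1"]) auto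
  then show "\<And>t. t \<ge> 0 \<Longrightarrow> X t \<in> V" .
  have VD: "\<exists>J c. finite J \<and> J \<subseteq> {0..} \<and> U = (\<lambda>\<omega>. \<Sum>t\<in>J. c t * X t \<omega>)" if "U \<in> V" for U
    using that unfolding V_def by blast
  have Vm: "U \<in> borel_measurable M" if "U \<in> V" for U
    using that m unfolding V_def by (auto intro!: borel_measurable_sum borel_measurable_times)
  \<comment> \<open>Transport to the standard normal law identifies the parameter \<mu> with the
    mean; linear combinations of the process have mean 0, whence \<mu> = 0 below.\<close>
  have trans: "integrable M U \<and> expectation U = \<mu>" if U: "U \<in> V" and s: "\<sigma> \<ge> 0" "distr M borel U = normal_law \<mu> \<sigma>" for U \<mu> \<sigma>
  proof -
    note [measurable] = Vm[OF U]
    interpret S: prob_space std_normal_distribution by (rule prob_space_normal_density) simp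
    have d: "distr M borel U = distr std_normal_distribution borel (\<lambda>x. \<mu> + \<sigma> * x)"
      unfolding s(2) by (rule normal_law_eq_distr[OF s(1)])
    have i: "integrable std_normal_distribution (\<lambda>x. \<mu> + \<sigma> * x)"
      using integrable_std_normal_power[of 1] by auto
    have "integrable (distr M borel U) (\<lambda>x. x)" unfolding d using i by (simp add: integrable_distr_eq)
    then have 1: "integrable M U" by (simp add: integrable_distr_eq)
    have "expectation U = (\<integral>x. x \<partial>distr M borel U)" by (simp add: integral_distr)
    also have "\<dots> = (\<integral>x. \<mu> + \<sigma> * x \<partial>std_normal_distribution)" unfolding d by (simp add: integral_distr)
    also have "\<dots> = \<mu>" using integrable_std_normal_power[of 1] integral_std_normal_power(2)
      using S.prob_space by simp
    finally show ?thesis using 1 by simp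
  qed
  have Xi: "integrable M (X t)" if "t \<ge> 0" for t
  proof -
    have "\<exists>\<mu> \<sigma>. 0 \<le> \<sigma> \<and> distr M borel (X t) = normal_law \<mu> \<sigma>"
      using l[of "{t}" "\<lambda>_. 1"] that by simp
    then obtain \<mu> \<sigma> where s: "0 \<le> \<sigma>" "distr M borel (X t) = normal_law \<mu> \<sigma>" by blast
    show ?thesis using trans[OF XV[OF that] s] ..
  qed
  show "gaussian_space M V"
  proof
    show "U \<in> borel_measurable M" if "U \<in> V" for U by (rule Vm[OF that])
    show "\<exists>\<sigma>\<ge>0. distr M borel U = normal_law 0 \<sigma>" if "U \<in> V" for U
    proof -
      obtain J c where J: "finite J" "J \<subseteq> {0..}" "U = (\<lambda>\<omega>. \<Sum>t\<in>J. c t * X t \<omega>)"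
        using VD[OF \<open>U \<in> V\<close>] by (elim exE conjE)
      obtain \<mu> \<sigma> where s: "0 \<le> \<sigma>" "distr M borel U = normal_law \<mu> \<sigma>"
        using l[OF J(1,2), of c] unfolding J(3) by blast
      have "expectation U = (\<Sum>t\<in>J. c t * expectation (X t))"
        unfolding J(3) using J(2) Xi by (subst Bochner_Integration.integral_sum) auto
      also have "\<dots> = 0" using J(2) mean by (intro sum.neutral) auto
      finally have "\<mu> = 0" using conjunct2[OF trans[OF \<open>U \<in> V\<close> s]] by simp
      then show ?thesis using s by (intro exI[of _ \<sigma>]) simp
    qed
    show "(\<lambda>_. 0) \<in> V" unfolding V_def by (intro CollectI exI[of _ "{}"]) auto
    show "(\<lambda>\<omega>. U \<omega> + W \<omega>) \<in> V" if UW: "U \<in> V" "W \<in> V" for U W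
    proof -
      from VD[OF UW(1)] obtain J c where J: "finite J" "J \<subseteq> {0..}" "U = (\<lambda>\<omega>. \<Sum>t\<in>J. c t * X t \<omega>)"
        by (elim exE conjE)
      from VD[OF UW(2)] obtain I d where I: "finite I" "I \<subseteq> {0..}" "W = (\<lambda>\<omega>. \<Sum>t\<in>I. d t * X t \<omega>)"
        by (elim exE conjE)
      \<comment> \<open>Both coefficient families are extended by 0 to the union of the two index
        sets.\<close>
      have 1: "(\<Sum>t\<in>J. c t * X t \<omega>) = (\<Sum>t\<in>J \<union> I. (if t \<in> J then c t else 0) * X t \<omega>)" for \<omega>
        using J(1) I(1) by (intro sum.mono_neutral_cong_left) auto
      have 2: "(\<Sum>t\<in>I. d t * X t \<omega>) = (\<Sum>t\<in>J \<union> I. (if t \<in> I then d t else 0) * X t \<omega>)" for \<omega>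
        using J(1) I(1) by (intro sum.mono_neutral_cong_left) auto
      have "(\<lambda>\<omega>. U \<omega> + W \<omega>) = (\<lambda>\<omega>. \<Sum>t\<in>J \<union> I. ((if t \<in> J then c t else 0) + (if t \<in> I then d t else 0)) * X t \<omega>)"
        unfolding J(3) I(3) 1 2 by (simp add: sum.distrib distrib_right)
      then show ?thesis unfolding V_def using J I
        by (intro CollectI exI[of _ "J \<union> I"] exI[of _ "\<lambda>t. (if t \<in> J then c t else 0) + (if t \<in> I then d t else 0)"]) auto
    qed
    show "(\<lambda>\<omega>. k * U \<omega>) \<in> V" if U: "U \<in> V" for U k
    proof -
      obtain J c where J: "finite J" "J \<subseteq> {0..}" "U = (\<lambda>\<omega>. \<Sum>t\<in>J. c t * X t \<omega>)"
        using VD[OF U] by (elim exE conjE)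
      then have "(\<lambda>\<omega>. k * U \<omega>) = (\<lambda>\<omega>. \<Sum>t\<in>J. (k * c t) * X t \<omega>)" by (simp add: sum_distrib_left mult.assoc)
      then show ?thesis unfolding V_def using J by (intro CollectI exI[of _ J] exI[of _ "\<lambda>t. k * c t"]) auto
    qed
  qed
qed

section \<open>The Kolmogorov criterion\<close>

definition dyadic_floor :: "nat \<Rightarrow> real \<Rightarrow> real" where
  "dyadic_floor n t = of_int \<lfloor>2 ^ n * t\<rfloor> / 2 ^ n"

lemma dyadic_floor_nat:
  assumes "t \<ge> 0"
  shows "dyadic_floor n t = real (nat \<lfloor>2 ^ n * t\<rfloor>) / 2 ^ n"
  using assms by (simp add: dyadic_floor_def)

lemma dyadic_floor_nonneg: "t \<ge> 0 \<Longrightarrow> dyadic_floor n t \<ge> 0"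
  by (simp add: dyadic_floor_def)

lemma dyadic_floor_bounds: "dyadic_floor n t \<le> t" "t < dyadic_floor n t + 1 / 2 ^ n"
proof -
  have "of_int \<lfloor>2 ^ n * t\<rfloor> \<le> 2 ^ n * t" "2 ^ n * t < of_int \<lfloor>2 ^ n * t\<rfloor> + 1" by linarith+
  then show "dyadic_floor n t \<le> t" "t < dyadic_floor n t + 1 / 2 ^ n"
    by (auto simp: dyadic_floor_def field_simps)
qed

text \<open>Holder regularity along dyadic points, with exponent the negative binary logarithm of q.
  Only countably many evaluations occur, so for a process the paths with this property form a
  measurable set.\<close>

definition dyadic_holder :: "real \<Rightarrow> (real \<Rightarrow> real) \<Rightarrow> bool" where
  "dyadic_holder q f \<longleftrightarrow> (\<forall>m::nat. \<exists>N. \<forall>n\<ge>N. \<forall>k<m * 2 ^ n.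
     \<bar>f (real (Suc k) / 2 ^ n) - f (real k / 2 ^ n)\<bar> \<le> q ^ n)"

text \<open>Passing from level n to n + 1 moves the dyadic approximation of t by at most one step of
  the finer grid, so the changes are dominated by a geometric series, uniformly for t < m.
  Continuity follows by comparing two nearby times at one fixed level.\<close>

lemma dyadic_holder_limit:
  assumes f: "dyadic_holder q f" and q: "0 < q" "q < 1"
  shows "\<And>t. t \<ge> 0 \<Longrightarrow> convergent (\<lambda>n. f (dyadic_floor n t))"
    and "continuous_on {0..} (\<lambda>t. lim (\<lambda>n. f (dyadic_floor n t)))"
proof -
  define g where "g n t = f (dyadic_floor n t)" for n t
  have step: "\<bar>g n s - g n t\<bar> \<le> q ^ n"
    if n: "\<forall>k<m * 2 ^ n. \<bar>f (real (Suc k) / 2 ^ n) - f (real k / 2 ^ n)\<bar> \<le> q ^ n"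
      and "0 \<le> s" "s \<le> t" "t < real m" "t - s \<le> 1 / 2 ^ n" for m n s t
  proof -
    define k where "k = nat \<lfloor>2 ^ n * s\<rfloor>"
    have gs: "dyadic_floor n s = real k / 2 ^ n" using that dyadic_floor_nat by (simp add: k_def)
    have l: "dyadic_floor n t = real (nat \<lfloor>2 ^ n * t\<rfloor>) / 2 ^ n" using that dyadic_floor_nat[of t n] by linarith
    have m1: "2 ^ n * s \<le> 2 ^ n * t" "2 ^ n * t \<le> 2 ^ n * s + 1" using that by (auto simp: field_simps)
    \<comment> \<open>Times at most one mesh apart have equal or adjacent dyadic floors.\<close>
    then have "\<lfloor>2 ^ n * t\<rfloor> = \<lfloor>2 ^ n * s\<rfloor> \<or> \<lfloor>2 ^ n * t\<rfloor> = \<lfloor>2 ^ n * s\<rfloor> + 1" by linarith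
    moreover have "\<lfloor>2 ^ n * s\<rfloor> \<ge> 0" using that by simp
    ultimately have "nat \<lfloor>2 ^ n * t\<rfloor> = k \<or> nat \<lfloor>2 ^ n * t\<rfloor> = Suc k" unfolding k_def by linarith
    moreover have "k < m * 2 ^ n"
    proof -
      have "real k \<le> 2 ^ n * s" using that unfolding k_def by (simp add: of_nat_floor)
      also have "\<dots> < 2 ^ n * real m" using that by simp
      finally have "real k < real (m * 2 ^ n)" by (simp add: mult.commute)
      then show ?thesis by (simp only: of_nat_less_iff)
    qed
    ultimately show ?thesis using n q unfolding g_def gs l by (auto simp: abs_minus_commute)
  qed
  have refine: "\<bar>g (Suc n) t - g n t\<bar> \<le> q ^ Suc n"
    if n: "\<forall>k<m * 2 ^ Suc n. \<bar>f (real (Suc k) / 2 ^ Suc n) - f (real k / 2 ^ Suc n)\<bar> \<le> q ^ Suc n"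
      and t: "0 \<le> t" "t < real m" for m n t
  proof -
    let ?s = "dyadic_floor n t"
    have s: "0 \<le> ?s" "?s \<le> t" using t dyadic_floor_nonneg dyadic_floor_bounds by auto
    define j where "j = nat \<lfloor>2 ^ n * t\<rfloor>"
    define k where "k = nat \<lfloor>2 ^ Suc n * t\<rfloor>"
    have gj: "?s = real (2 * j) / 2 ^ Suc n" "dyadic_floor (Suc n) t = real k / 2 ^ Suc n"
      using t dyadic_floor_nat[of t n] dyadic_floor_nat[of t "Suc n"] by (auto simp: j_def k_def)
    have "\<lfloor>2 * (2 ^ n * t)\<rfloor> = 2 * \<lfloor>2 ^ n * t\<rfloor> \<or> \<lfloor>2 * (2 ^ n * t)\<rfloor> = 2 * \<lfloor>2 ^ n * t\<rfloor> + 1" by linarith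
    moreover have "\<lfloor>2 ^ n * t\<rfloor> \<ge> 0" using t by simp
    ultimately have "k = 2 * j \<or> k = Suc (2 * j)" unfolding k_def j_def by (simp add: mult.assoc) linarith
    moreover have "2 * j < m * 2 ^ Suc n"
    proof -
      have "real j \<le> 2 ^ n * t" using t unfolding j_def by (simp add: of_nat_floor)
      also have "\<dots> < 2 ^ n * real m" using t by simp
      finally have "real j < real (m * 2 ^ n)" by (simp add: mult.commute)
      then show ?thesis by (simp only: of_nat_less_iff) simp
    qed
    ultimately show ?thesis using n q unfolding g_def gj by (auto simp del: power_Suc of_nat_Suc of_nat_mult)
  qed
  have key: "\<exists>N. \<forall>n\<ge>N. \<forall>t\<in>{0..<real m}. \<forall>k. \<bar>g (n + k) t - g n t\<bar> \<le> q ^ n / (1 - q)" for m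
  proof -
    obtain N where N: "\<And>n. n \<ge> N \<Longrightarrow> \<forall>k<m * 2 ^ n. \<bar>f (real (Suc k) / 2 ^ n) - f (real k / 2 ^ n)\<bar> \<le> q ^ n"
      using f unfolding dyadic_holder_def by blast
    have "\<bar>g (n + k) t - g n t\<bar> \<le> (\<Sum>i<k. q ^ (n + i))" if "n \<ge> N" "t \<in> {0..<real m}" for n k t
    proof (induction k)
      case (Suc k)
      have "\<bar>g (Suc (n + k)) t - g (n + k) t\<bar> \<le> q ^ Suc (n + k)"
        using that by (intro refine[of m] N) auto
      also have "\<dots> \<le> q ^ (n + k)" using q by (intro power_decreasing) auto
      finally show ?case using Suc by simp
    qed simp
    moreover have "(\<Sum>i<k. q ^ (n + i)) \<le> q ^ n / (1 - q)" for n k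
    proof -
      have "(\<Sum>i<k. q ^ (n + i)) = q ^ n * (\<Sum>i<k. q ^ i)" by (simp add: power_add sum_distrib_left)
      also have "(\<Sum>i<k. q ^ i) \<le> 1 / (1 - q)"
        using q by (simp add: sum_gp_strict divide_right_mono)
      finally show ?thesis using q by (simp add: mult_left_mono)
    qed
    ultimately show ?thesis by (meson order_trans)
  qed
  have qlim: "(\<lambda>n. q ^ n / (1 - q)) \<longlonglongrightarrow> 0"
    using tendsto_divide[OF LIMSEQ_power_zero[of q] tendsto_const, of "1 - q"] q by simp
  have conv: "convergent (\<lambda>n. g n t)" if "t \<ge> 0" for t
  proof -
    obtain m :: nat where m: "t < real m" using reals_Archimedean2 by blast
    obtain N where N: "\<And>n k. n \<ge> N \<Longrightarrow> \<bar>g (n + k) t - g n t\<bar> \<le> q ^ n / (1 - q)"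
      using key[of m] \<open>t \<ge> 0\<close> m by (metis atLeastLessThan_iff)
    have "Cauchy (\<lambda>n. g n t)"
    proof (rule CauchyI')
      fix e :: real assume "e > 0"
      then have "\<forall>\<^sub>F n in sequentially. q ^ n / (1 - q) < e" using qlim by (intro order_tendstoD(2)) auto
      then obtain N' where N': "\<And>n. n \<ge> N' \<Longrightarrow> q ^ n / (1 - q) < e" unfolding eventually_sequentially by blast
      have "dist (g i t) (g j t) < e" if "i \<ge> max N N'" "j > i" for i j
        using N[of i "j - i"] N'[of i] that by (simp add: dist_real_def abs_minus_commute)
      then show "\<exists>M. \<forall>m\<ge>M. \<forall>n>m. dist (g m t) (g n t) < e" by blast
    qed
    then show ?thesis by (simp add: Cauchy_convergent_iff)
  qed
  then show "convergent (\<lambda>n. f (dyadic_floor n t))" if "t \<ge> 0" for t using that by (simp add: g_def)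
  define G where "G t = lim (\<lambda>n. g n t)" for t
  have Glim: "(\<lambda>n. g n t) \<longlonglongrightarrow> G t" if "t \<ge> 0" for t
    unfolding G_def using conv[OF that] by (simp add: convergent_LIMSEQ_iff)
  have "continuous_on {0..} G"
  proof (unfold continuous_on_iff, intro ballI allI impI)
    fix t e :: real assume t: "t \<in> {0..}" and e: "e > 0"
    \<comment> \<open>The margin 1 keeps every s within 2^(-n) of t below m as well.\<close>
    obtain m :: nat where m: "t + 1 < real m" using reals_Archimedean2 by blast
    obtain N where N: "\<And>n k u. n \<ge> N \<Longrightarrow> 0 \<le> u \<Longrightarrow> u < real m \<Longrightarrow> \<bar>g (n + k) u - g n u\<bar> \<le> q ^ n / (1 - q)"
      using key[of m] by (metis atLeastLessThan_iff)
    obtain N2 where N2: "\<And>n. n \<ge> N2 \<Longrightarrow> \<forall>k<m * 2 ^ n. \<bar>f (real (Suc k) / 2 ^ n) - f (real k / 2 ^ n)\<bar> \<le> q ^ n"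
      using f unfolding dyadic_holder_def by blast
    have "\<forall>\<^sub>F n in sequentially. q ^ n / (1 - q) < e / 3" using qlim e by (intro order_tendstoD(2)) auto
    then obtain N' where N': "\<And>n. n \<ge> N' \<Longrightarrow> q ^ n / (1 - q) < e / 3" unfolding eventually_sequentially by blast
    define n where "n = max N (max N2 N')"
    have n: "n \<ge> N" "n \<ge> N2" "n \<ge> N'" by (auto simp: n_def)
    have Gg: "\<bar>G u - g n u\<bar> \<le> q ^ n / (1 - q)" if "0 \<le> u" "u < real m" for u
    proof (rule LIMSEQ_le_const2)
      show "(\<lambda>k. \<bar>g (n + k) u - g n u\<bar>) \<longlonglongrightarrow> \<bar>G u - g n u\<bar>"
        using LIMSEQ_ignore_initial_segment[OF Glim[OF that(1)], of n]
        by (intro tendsto_intros) (simp add: add.commute)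
    qed (use N n that in auto)
    have qn: "q ^ n \<le> q ^ n / (1 - q)" using q by (simp add: field_simps)
    show "\<exists>d>0. \<forall>s\<in>{0..}. dist s t < d \<longrightarrow> dist (G s) (G t) < e"
    proof (intro exI[of _ "1 / 2 ^ n"] conjI ballI impI)
      fix s assume s: "s \<in> {0..}" "dist s t < 1 / 2 ^ n"
      have n1: "(1::real) / 2 ^ n \<le> 1" by simp
      have sm: "s < real m" using n1 s(2) m unfolding dist_real_def by linarith
      have "\<bar>g n s - g n t\<bar> \<le> q ^ n"
      proof (cases "s \<le> t")
        case True then show ?thesis using step[OF N2[OF n(2)], of s t] s t m by (auto simp: dist_real_def)
      next
        case False then show ?thesis using step[OF N2[OF n(2)], of t s] s t sm by (auto simp: dist_real_def)
      qed
      moreover have "\<bar>G s - g n s\<bar> \<le> q ^ n / (1 - q)" using s sm by (intro Gg) auto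
      moreover have "\<bar>G t - g n t\<bar> \<le> q ^ n / (1 - q)" using t m by (intro Gg) auto
      ultimately show "dist (G s) (G t) < e" using N'[OF n(3)] qn unfolding dist_real_def by linarith
    qed simp
  qed
  then show "continuous_on {0..} (\<lambda>t. lim (\<lambda>n. f (dyadic_floor n t)))" by (simp add: G_def[abs_def] g_def)
qed

lemma (in prob_space) kolmogorov_continuity:
  fixes X :: "real \<Rightarrow> 'a \<Rightarrow> real"
  assumes X: "\<And>t. t \<ge> 0 \<Longrightarrow> X t \<in> borel_measurable M"
    and p: "even p" "\<And>s t. s \<ge> 0 \<Longrightarrow> t \<ge> 0 \<Longrightarrow> integrable M (\<lambda>x. (X t x - X s x) ^ p)"
    and b: "\<beta> > 0"
    and C: "\<And>m::nat. \<exists>C. \<forall>s\<in>{0..real m}. \<forall>t\<in>{0..real m}.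
      expectation (\<lambda>x. (X t x - X s x) ^ p) \<le> C * \<bar>t - s\<bar> powr (1 + \<beta>)"
  shows "continuous_process M X"
proof -
  \<comment> \<open>Half of the exponent \<beta> pays for the Holder modulus q^n, where q^p = r, and
    the other half keeps the probabilities summable: the Markov inequality gives C r^n 2^(-n) for
    one dyadic interval, hence m C r^n for all m 2^n of them.\<close>
  define r where "r = 2 powr (- \<beta> / 2)"
  have r: "0 < r" "r < 1" using b by (auto simp: r_def powr_less_one)
  have p0: "p > 0"
  proof (rule ccontr)
    assume "\<not> p > 0"
    then have "p = 0" by simp
    obtain C where "expectation (\<lambda>x. (X 0 x - X 0 x) ^ p) \<le> C * \<bar>0 - 0\<bar> powr (1 + \<beta>)"
      using C[of 0] by auto
    with \<open>p = 0\<close> show False by (simp add: prob_space)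
  qed
  define q where "q = root p r"
  have q: "0 < q" "q < 1" "q ^ p = r" using r p0 by (auto simp: q_def)
  have tail: "prob {x\<in>space M. \<bar>X t x - X s x\<bar> > q ^ n} \<le> C * r ^ n * (1 / 2 ^ n)"
    if st: "s \<ge> 0" "t \<ge> 0" "\<bar>t - s\<bar> \<le> 1 / 2 ^ n"
      and CC: "C \<ge> 0" "expectation (\<lambda>x. (X t x - X s x) ^ p) \<le> C * \<bar>t - s\<bar> powr (1 + \<beta>)" for C s t n
  proof -
    have [measurable]: "X s \<in> borel_measurable M" "X t \<in> borel_measurable M" using X st by auto
    have "prob {x\<in>space M. \<bar>X t x - X s x\<bar> > q ^ n} \<le> prob {x\<in>space M. (X t x - X s x) ^ p \<ge> r ^ n}"
    proof (intro finite_measure_mono)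
      show "{x\<in>space M. \<bar>X t x - X s x\<bar> > q ^ n} \<subseteq> {x\<in>space M. (X t x - X s x) ^ p \<ge> r ^ n}"
      proof safe
        fix x assume "\<bar>X t x - X s x\<bar> > q ^ n"
        then have "(q ^ n) ^ p \<le> \<bar>X t x - X s x\<bar> ^ p" using q by (intro power_mono) auto
        also have "\<bar>X t x - X s x\<bar> ^ p = (X t x - X s x) ^ p" using p(1) by (rule power_even_abs)
        also have "(q ^ n) ^ p = r ^ n" unfolding q(3)[symmetric] by (simp flip: power_mult add: mult.commute)
        finally show "(X t x - X s x) ^ p \<ge> r ^ n" .
      qed
    qed auto
    also have "\<dots> \<le> expectation (\<lambda>x. (X t x - X s x) ^ p) / r ^ n"
      by (rule integral_Markov_inequality_measure[where A = "{}", OF p(2)[OF st(1,2)]])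
        (use r p(1) in \<open>auto simp: zero_le_even_power\<close>)
    also have "\<dots> \<le> C * (1 / 2 ^ n) powr (1 + \<beta>) / r ^ n"
    proof (intro divide_right_mono order_trans[OF CC(2)] mult_left_mono CC(1))
      show "\<bar>t - s\<bar> powr (1 + \<beta>) \<le> (1 / 2 ^ n) powr (1 + \<beta>)" using st(3) b by (intro powr_mono2) auto
    qed (use r in auto)
    \<comment> \<open>Because r^2 = 2^(-\<beta>). One factor r^n then cancels against the threshold
      in the denominator.\<close>
    also have "(1 / 2 ^ n :: real) powr (1 + \<beta>) = (1 / 2 ^ n) * (r ^ n * r ^ n)"
    proof -
      have rr: "r * r = 2 powr (- \<beta>)" unfolding r_def by (simp flip: powr_add)
      have "r ^ n * r ^ n = 2 powr (- \<beta> * real n)"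
        unfolding power_mult_distrib[symmetric] rr by (simp add: powr_power mult.commute)
      moreover have "(1 / 2 ^ n :: real) = 2 powr (- real n)" by (simp add: powr_minus powr_realpow divide_inverse)
      ultimately show ?thesis by (simp add: powr_powr flip: powr_add) (simp add: algebra_simps)
    qed
    finally show ?thesis using r by (simp add: field_simps)
  qed
  define good where "good = {x\<in>space M. dyadic_holder q (\<lambda>t. X t x)}"
  have Xd[measurable]: "X (real k / 2 ^ n) \<in> borel_measurable M" for k n by (intro X) simp
  have good_sets[measurable]: "good \<in> sets M"
    unfolding good_def dyadic_holder_def by measurable
  have AE_good: "AE x in M. x \<in> good"
  proof -
    have "AE x in M. \<exists>N. \<forall>n\<ge>N. \<forall>k<m * 2 ^ n. \<bar>X (real (Suc k) / 2 ^ n) x - X (real k / 2 ^ n) x\<bar> \<le> q ^ n" for m :: nat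
    proof -
      obtain C0 where C0: "\<And>s t. s \<in> {0..real m} \<Longrightarrow> t \<in> {0..real m} \<Longrightarrow>
        expectation (\<lambda>x. (X t x - X s x) ^ p) \<le> C0 * \<bar>t - s\<bar> powr (1 + \<beta>)" using C[of m] by meson
      define C1 where "C1 = max 0 C0"
      have C1: "C1 \<ge> 0" "\<And>s t. s \<in> {0..real m} \<Longrightarrow> t \<in> {0..real m} \<Longrightarrow>
        expectation (\<lambda>x. (X t x - X s x) ^ p) \<le> C1 * \<bar>t - s\<bar> powr (1 + \<beta>)"
        unfolding C1_def by (auto intro!: order_trans[OF C0] mult_right_mono)
      define A where "A n = (\<Union>k<m * 2 ^ n. {x\<in>space M. \<bar>X (real (Suc k) / 2 ^ n) x - X (real k / 2 ^ n) x\<bar> > q ^ n})" for n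
      have Am[measurable]: "A n \<in> sets M" for n unfolding A_def by measurable
      have PA: "prob (A n) \<le> real m * C1 * r ^ n" for n
      proof -
        have "prob (A n) \<le> (\<Sum>k<m * 2 ^ n. prob {x\<in>space M. \<bar>X (real (Suc k) / 2 ^ n) x - X (real k / 2 ^ n) x\<bar> > q ^ n})"
          unfolding A_def by (intro finite_measure_subadditive_finite) (auto simp del: of_nat_Suc)
        also have "\<dots> \<le> (\<Sum>k<m * 2 ^ n. C1 * r ^ n * (1 / 2 ^ n))"
        proof (intro sum_mono tail C1)
          fix k assume "k \<in> {..<m * 2 ^ n}"
          then have "real (Suc k) \<le> real (m * 2 ^ n)" by (intro of_nat_mono) auto
          then show "real k / 2 ^ n \<in> {0..real m}" "real (Suc k) / 2 ^ n \<in> {0..real m}"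
            by (auto simp: divide_le_eq)
          show "\<bar>real (Suc k) / 2 ^ n - real k / 2 ^ n\<bar> \<le> 1 / 2 ^ n" by (simp add: field_simps)
        qed auto
        also have "\<dots> = real m * C1 * r ^ n" by simp
        finally show ?thesis .
      qed
      have "AE x in M. eventually (\<lambda>n. x \<in> space M - A n) sequentially"
      proof (rule borel_cantelli_AE1)
        show "summable (\<lambda>n. prob (A n))"
          by (rule summable_comparison_test'[where g = "\<lambda>n. real m * C1 * r ^ n" and N = 0])
            (use PA r in \<open>auto intro!: summable_mult summable_geometric\<close>)
      qed (auto simp: emeasure_eq_measure)
      then show ?thesis
        by eventually_elim (auto simp: eventually_sequentially A_def not_less)
    qed
    then have "AE x in M. \<forall>m::nat. \<exists>N. \<forall>n\<ge>N. \<forall>k<m * 2 ^ n. \<bar>X (real (Suc k) / 2 ^ n) x - X (real k / 2 ^ n) x\<bar> \<le> q ^ n"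
      by (simp add: AE_all_countable)
    then show ?thesis using AE_space by eventually_elim (auto simp: good_def dyadic_holder_def)
  qed
  \<comment> \<open>Off the almost sure event \<open>good\<close> the path is replaced by 0, so that
    the limit exists and the path is continuous at every sample point.\<close>
  define Y where "Y t x = lim (\<lambda>n. indicator good x * X (dyadic_floor n t) x)" for t x
  have Yc: "convergent (\<lambda>n. indicator good x * X (dyadic_floor n t) x)" if "t \<ge> 0" for t x
    using dyadic_holder_limit(1)[of q "\<lambda>t. X t x" t] q that
    by (cases "x \<in> good") (auto simp: good_def convergent_const)
  show ?thesis unfolding continuous_process_def modification_def
  proof (intro exI[of _ Y] conjI allI impI ballI)
    fix t :: real assume t: "t \<ge> 0"
    have Xf[measurable]: "X (dyadic_floor n t) \<in> borel_measurable M" for n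
      using t by (intro X dyadic_floor_nonneg)
    have Yl: "(\<lambda>n. indicator good x * X (dyadic_floor n t) x) \<longlonglongrightarrow> Y t x" for x
      unfolding Y_def using Yc[OF t] by (simp add: convergent_LIMSEQ_iff)
    show "Y t \<in> borel_measurable M"
    proof (rule borel_measurable_LIMSEQ_real)
      show "(\<lambda>n. indicator good x * X (dyadic_floor n t) x) \<longlonglongrightarrow> Y t x" for x by (rule Yl)
      show "(\<lambda>x. indicator good x * X (dyadic_floor n t) x) \<in> borel_measurable M" for n
        by (intro borel_measurable_times borel_measurable_indicator good_sets Xf)
    qed
    obtain m :: nat where m: "t < real m" using reals_Archimedean2[of t] ..
    obtain C0 where C0: "\<And>s t. s \<in> {0..real m} \<Longrightarrow> t \<in> {0..real m} \<Longrightarrow>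
      expectation (\<lambda>x. (X t x - X s x) ^ p) \<le> C0 * \<bar>t - s\<bar> powr (1 + \<beta>)" using C[of m] by meson
    define C1 where "C1 = max 0 C0"
    have C1: "C1 \<ge> 0" "\<And>s t. s \<in> {0..real m} \<Longrightarrow> t \<in> {0..real m} \<Longrightarrow>
      expectation (\<lambda>x. (X t x - X s x) ^ p) \<le> C1 * \<bar>t - s\<bar> powr (1 + \<beta>)"
      unfolding C1_def by (auto intro!: order_trans[OF C0] mult_right_mono)
    have Xt[measurable]: "X t \<in> borel_measurable M" using X t by simp
    \<comment> \<open>At a fixed t, which need not be dyadic, a second Borel-Cantelli argument shows
      that the values of X at the dyadic floors converge almost surely to X t.\<close>
    define A where "A n = {x\<in>space M. \<bar>X t x - X (dyadic_floor n t) x\<bar> > q ^ n}" for n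
    have [measurable]: "A n \<in> sets M" for n unfolding A_def by measurable
    have PA: "prob (A n) \<le> C1 * r ^ n" for n
    proof -
      have "prob (A n) \<le> C1 * r ^ n * (1 / 2 ^ n)"
        unfolding A_def using t m dyadic_floor_bounds(1)[of n t] dyadic_floor_bounds(2)[of t n] dyadic_floor_nonneg[OF t, of n]
        by (intro tail C1) auto
      also have "\<dots> \<le> C1 * r ^ n * 1" using C1 r by (intro mult_left_mono) auto
      finally show ?thesis by simp
    qed
    have "AE x in M. eventually (\<lambda>n. x \<in> space M - A n) sequentially"
    proof (rule borel_cantelli_AE1)
      show "summable (\<lambda>n. prob (A n))"
        by (rule summable_comparison_test'[where g = "\<lambda>n. C1 * r ^ n" and N = 0])
          (use PA r in \<open>auto intro!: summable_mult summable_geometric\<close>)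
    qed (auto simp: emeasure_eq_measure)
    then show "AE x in M. Y t x = X t x"
      using AE_good
    proof eventually_elim
      case (elim x)
      have "\<forall>\<^sub>F n in sequentially. norm (indicator good x * X (dyadic_floor n t) x - X t x) \<le> q ^ n"
        using elim(1) by eventually_elim (use elim(2) in \<open>auto simp: A_def abs_minus_commute\<close>)
      moreover have "(\<lambda>n. q ^ n) \<longlonglongrightarrow> 0" using q by (intro LIMSEQ_power_zero) auto
      ultimately have "(\<lambda>n. indicator good x * X (dyadic_floor n t) x - X t x) \<longlonglongrightarrow> 0"
        by (rule Lim_null_comparison)
      then have "(\<lambda>n. indicator good x * X (dyadic_floor n t) x) \<longlonglongrightarrow> X t x" by (simp add: LIM_zero_iff)
      then show ?case by (rule LIMSEQ_unique[OF Yl])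
    qed
  next
    fix x assume "x \<in> space M"
    show "continuous_on {0..} (\<lambda>t. Y t x)"
    proof (cases "x \<in> good")
      case True
      then have "continuous_on {0..} (\<lambda>t. lim (\<lambda>n. X (dyadic_floor n t) x))"
        using dyadic_holder_limit(2)[of q "\<lambda>t. X t x"] q by (simp add: good_def)
      with True show ?thesis by (simp add: Y_def)
    next
      case False
      then show ?thesis by (simp add: Y_def)
    qed
  qed
qed

section \<open>Semimartingales as good integrators\<close>

lemma (in finite_measure) integrable_mult_of_squares:
  fixes f g :: "'a \<Rightarrow> real"
  assumes [measurable]: "f \<in> borel_measurable M" "g \<in> borel_measurable M"
    and "integrable M (\<lambda>x. (f x)\<^sup>2)" "integrable M (\<lambda>x. (g x)\<^sup>2)"
  shows "integrable M (\<lambda>x. f x * g x)"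
proof (rule Bochner_Integration.integrable_bound)
  show "integrable M (\<lambda>x. (f x)\<^sup>2 + (g x)\<^sup>2)" using assms by simp
  have "\<bar>f x * g x\<bar> \<le> (f x)\<^sup>2 + (g x)\<^sup>2" for x
  proof -
    have "2 * (\<bar>f x\<bar> * \<bar>g x\<bar>) \<le> (f x)\<^sup>2 + (g x)\<^sup>2"
      using sum_squares_bound[of "\<bar>f x\<bar>" "\<bar>g x\<bar>"] by simp
    moreover have "0 \<le> \<bar>f x\<bar> * \<bar>g x\<bar>" by simp
    ultimately show ?thesis unfolding abs_mult by linarith
  qed
  then show "AE x in M. norm (f x * g x) \<le> norm ((f x)\<^sup>2 + (g x)\<^sup>2)" by simp
qed simp

lemma (in finite_measure) integrable_of_square:
  fixes f :: "'a \<Rightarrow> real"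
  assumes "f \<in> borel_measurable M" "integrable M (\<lambda>x. (f x)\<^sup>2)"
  shows "integrable M f"
  using integrable_mult_of_squares[OF assms(1) _ assms(2), of "\<lambda>_. 1"] by simp

lemma (in finite_measure) integrable_square_sum:
  fixes f g :: "'a \<Rightarrow> real"
  assumes [measurable]: "f \<in> borel_measurable M" "g \<in> borel_measurable M"
    and "integrable M (\<lambda>x. (f x)\<^sup>2)" "integrable M (\<lambda>x. (g x)\<^sup>2)"
  shows "integrable M (\<lambda>x. (f x + g x)\<^sup>2)" "integrable M (\<lambda>x. (f x - g x)\<^sup>2)"
  using integrable_mult_of_squares[OF assms] assms(3,4)
  by (auto simp: power2_sum power2_diff mult.assoc)

section \<open>Martingale transforms in discrete time\<close>

locale discrete_filtration = prob_space M for M :: "'a measure" +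
  fixes G :: "nat \<Rightarrow> 'a measure"
  assumes subalg: "subalgebra M (G i)"
    and subalg_mono: "i \<le> j \<Longrightarrow> subalgebra (G j) (G i)"
begin

lemma sigma_finite_G: "sigma_finite_subalgebra M (G i)"
  by (intro finite_measure_subalgebra_is_sigma_finite finite_measure_subalgebra.intro
      finite_measure_subalgebra_axioms.intro subalg) (rule finite_measure_axioms)

abbreviation CE :: "nat \<Rightarrow> ('a \<Rightarrow> real) \<Rightarrow> 'a \<Rightarrow> real" where
  "CE i \<equiv> real_cond_exp M (G i)"

lemmas CE_intg = sigma_finite_subalgebra.real_cond_exp_intg[OF sigma_finite_G]
  and CE_int = sigma_finite_subalgebra.real_cond_exp_int[OF sigma_finite_G]
  and CE_mono = sigma_finite_subalgebra.real_cond_exp_mono[OF sigma_finite_G]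
  and CE_cong = sigma_finite_subalgebra.real_cond_exp_cong[OF sigma_finite_G]
  and CE_diff = sigma_finite_subalgebra.real_cond_exp_diff[OF sigma_finite_G]
  and CE_pos = sigma_finite_subalgebra.real_cond_exp_pos[OF sigma_finite_G]
  and CE_F_meas = sigma_finite_subalgebra.real_cond_exp_F_meas[OF sigma_finite_G]
  and CE_nested = sigma_finite_subalgebra.real_cond_exp_nested_subalg[OF sigma_finite_G]
  and CE_jensens_inequality = sigma_finite_subalgebra.real_cond_exp_jensens_inequality[OF sigma_finite_G]

lemma G_meas: "f \<in> borel_measurable (G i) \<Longrightarrow> f \<in> borel_measurable M"
  using measurable_from_subalg[OF subalg] .

lemma G_meas_mono: "f \<in> borel_measurable (G i) \<Longrightarrow> i \<le> j \<Longrightarrow> f \<in> borel_measurable (G j)"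
  using measurable_from_subalg[OF subalg_mono] .

text \<open>Conditional expectation acts as an orthogonal projection of L^2: Jensen bounds its norm,
  and the cross term makes the squared residual a Pythagorean difference.\<close>

lemma CE_square:
  assumes [measurable]: "f \<in> borel_measurable M" and f2: "integrable M (\<lambda>x. (f x)\<^sup>2)"
  shows "integrable M (\<lambda>x. (CE i f x)\<^sup>2)"
    "(\<integral>x. (CE i f x)\<^sup>2 \<partial>M) \<le> (\<integral>x. (f x)\<^sup>2 \<partial>M)"
    "(\<integral>x. (f x - CE i f x)\<^sup>2 \<partial>M) \<le> (\<integral>x. (f x)\<^sup>2 \<partial>M)"
proof -
  have f1: "integrable M f" using f2 by (rule integrable_of_square[OF assms(1)])
  have jensen: "AE x in M. (CE i f x)\<^sup>2 \<le> CE i (\<lambda>x. (f x)\<^sup>2) x"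
  proof (rule CE_jensens_inequality(2)[OF f1, where I = UNIV and q = "\<lambda>x. x\<^sup>2"])
    show "convex_on UNIV (\<lambda>x::real. x\<^sup>2)" by (rule convex_power2)
    show "integrable M (\<lambda>x. (f x)\<^sup>2)" by (rule f2)
    show "(\<lambda>x::real. x\<^sup>2) \<in> borel_measurable borel" by measurable
  qed blast+
  have i2: "integrable M (CE i (\<lambda>x. (f x)\<^sup>2))" using CE_int(1)[OF f2] .
  show 1: "integrable M (\<lambda>x. (CE i f x)\<^sup>2)"
    by (rule Bochner_Integration.integrable_bound[OF i2]) (use jensen in auto)
  have "(\<integral>x. (CE i f x)\<^sup>2 \<partial>M) \<le> (\<integral>x. CE i (\<lambda>x. (f x)\<^sup>2) x \<partial>M)"
    using jensen by (intro integral_mono_AE 1 i2)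
  also have "\<dots> = (\<integral>x. (f x)\<^sup>2 \<partial>M)" using CE_int(2)[OF f2] .
  finally show "(\<integral>x. (CE i f x)\<^sup>2 \<partial>M) \<le> (\<integral>x. (f x)\<^sup>2 \<partial>M)" .
  have fc: "integrable M (\<lambda>x. CE i f x * f x)" using 1 f2 by (intro integrable_mult_of_squares) auto
  have "(\<integral>x. CE i f x * f x \<partial>M) = (\<integral>x. CE i f x * CE i f x \<partial>M)"
    using fc by (intro CE_intg(2)[symmetric]) auto
  then have cross: "(\<integral>x. CE i f x * f x \<partial>M) = (\<integral>x. (CE i f x)\<^sup>2 \<partial>M)" by (simp add: power2_eq_square)
  have "(\<integral>x. (f x - CE i f x)\<^sup>2 \<partial>M) = (\<integral>x. (f x)\<^sup>2 + (CE i f x)\<^sup>2 - 2 * (CE i f x * f x) \<partial>M)"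
    by (rule Bochner_Integration.integral_cong[OF refl]) (simp add: power2_diff)
  also have "\<dots> = (\<integral>x. (f x)\<^sup>2 \<partial>M) + (\<integral>x. (CE i f x)\<^sup>2 \<partial>M) - 2 * (\<integral>x. CE i f x * f x \<partial>M)"
    using f2 1 fc by simp
  also have "\<dots> \<le> (\<integral>x. (f x)\<^sup>2 \<partial>M)" unfolding cross by simp
  finally show "(\<integral>x. (f x - CE i f x)\<^sup>2 \<partial>M) \<le> (\<integral>x. (f x)\<^sup>2 \<partial>M)" .
qed

text \<open>The summand with index n has conditional mean 0 given G n, hence is orthogonal to the
  preceding sum, and only squares remain. Adaptedness and integrability go through the same
  induction because the orthogonality uses them.\<close>

lemma martingale_transform_square:
  assumes D: "\<And>i. D i \<in> borel_measurable (G (Suc i))" "\<And>i. integrable M (\<lambda>x. (D i x)\<^sup>2)"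
    and H: "\<And>i. H i \<in> borel_measurable (G i)" "\<And>i x. \<bar>H i x\<bar> \<le> 1"
  defines "S n x \<equiv> \<Sum>i<n. H i x * (D i x - CE i (D i) x)"
  shows "S n \<in> borel_measurable (G n)" "integrable M (\<lambda>x. (S n x)\<^sup>2)"
    "(\<integral>x. (S n x)\<^sup>2 \<partial>M) \<le> (\<Sum>i<n. \<integral>x. (D i x)\<^sup>2 \<partial>M)"
proof (induction n)
  case 0
  { case 1 show ?case by (simp add: S_def[abs_def]) }
  { case 2 show ?case by (simp add: S_def[abs_def]) }
  { case 3 show ?case by (simp add: S_def[abs_def]) }
next
  case (Suc n)
  have Dm[measurable]: "D n \<in> borel_measurable M" using D(1) by (rule G_meas)
  have Hm[measurable]: "H n \<in> borel_measurable M" using H(1) by (rule G_meas)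
  have Sm[measurable]: "S n \<in> borel_measurable M" using Suc(1) by (rule G_meas)
  define N where "N x = D n x - CE n (D n) x" for x
  have Nm[measurable]: "N \<in> borel_measurable M" unfolding N_def[abs_def] by measurable
  have N2: "integrable M (\<lambda>x. (N x)\<^sup>2)"
    unfolding N_def using D(2) CE_square(1)[OF Dm D(2)] by (intro integrable_square_sum) auto
  have H2: "(H n x)\<^sup>2 \<le> 1" for x using H(2)[of n x] by (simp add: abs_square_le_1)
  have HN: "(H n x * N x)\<^sup>2 \<le> (N x)\<^sup>2" for x
    using mult_right_mono[OF H2, of "(N x)\<^sup>2" x] by (simp add: power_mult_distrib)
  have HN2: "integrable M (\<lambda>x. (H n x * N x)\<^sup>2)"
    by (rule Bochner_Integration.integrable_bound[OF N2]) (use HN in auto)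
  have Seq: "S (Suc n) = (\<lambda>x. S n x + H n x * N x)" by (auto simp: S_def N_def)
  { case 1
    have [measurable]: "S n \<in> borel_measurable (G (Suc n))" "H n \<in> borel_measurable (G (Suc n))"
       "CE n (D n) \<in> borel_measurable (G (Suc n))" "D n \<in> borel_measurable (G (Suc n))"
      using Suc(1) H(1) D(1) by (auto intro: G_meas_mono[of _ n "Suc n"])
    show ?case unfolding Seq N_def by measurable }
  { case 2 show ?case unfolding Seq using Suc(2) HN2 by (intro integrable_square_sum) auto }
  { case 3
    have SH2: "integrable M (\<lambda>x. (S n x * H n x)\<^sup>2)"
    proof (rule Bochner_Integration.integrable_bound[OF Suc(2)])
      show "AE x in M. norm ((S n x * H n x)\<^sup>2) \<le> norm ((S n x)\<^sup>2)"
        using mult_left_mono[OF H2, of "(S n _)\<^sup>2"] by (auto simp: power_mult_distrib)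
    qed simp
    have [measurable]: "S n \<in> borel_measurable (G n)" "H n \<in> borel_measurable (G n)"
      using Suc(1) H(1) by auto
    have i1: "integrable M (\<lambda>x. (S n x * H n x) * D n x)"
      using SH2 D(2) by (intro integrable_mult_of_squares) auto
    have e1: "(\<integral>x. (S n x * H n x) * CE n (D n) x \<partial>M) = (\<integral>x. (S n x * H n x) * D n x \<partial>M)"
      using i1 by (intro CE_intg(2)) auto
    have i2: "integrable M (\<lambda>x. (S n x * H n x) * CE n (D n) x)"
      using i1 by (intro CE_intg(1)) auto
    have "(\<integral>x. S n x * (H n x * N x) \<partial>M) = (\<integral>x. (S n x * H n x) * D n x - (S n x * H n x) * CE n (D n) x \<partial>M)"
      by (simp add: N_def algebra_simps)
    also have "\<dots> = 0" using i1 i2 e1 by simp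
    finally have cross: "(\<integral>x. S n x * (H n x * N x) \<partial>M) = 0" .
    have ic: "integrable M (\<lambda>x. S n x * (H n x * N x))" using Suc(2) HN2 by (intro integrable_mult_of_squares) auto
    have "(\<integral>x. (S (Suc n) x)\<^sup>2 \<partial>M) = (\<integral>x. (S n x)\<^sup>2 + (H n x * N x)\<^sup>2 + 2 * (S n x * (H n x * N x)) \<partial>M)"
      unfolding Seq by (simp add: power2_sum mult.assoc)
    also have "\<dots> = (\<integral>x. (S n x)\<^sup>2 \<partial>M) + (\<integral>x. (H n x * N x)\<^sup>2 \<partial>M)"
      using Suc(2) HN2 ic cross by simp
    also have "(\<integral>x. (H n x * N x)\<^sup>2 \<partial>M) \<le> (\<integral>x. (N x)\<^sup>2 \<partial>M)" by (intro integral_mono HN2 N2 HN)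
    also have "\<dots> \<le> (\<integral>x. (D n x)\<^sup>2 \<partial>M)" unfolding N_def by (rule CE_square(3)[OF Dm D(2)])
    finally show ?case using Suc(3) by simp }
qed

lemma doob_maximal:
  assumes N: "\<And>i. N i \<in> borel_measurable (G i)" "\<And>i. integrable M (N i)" "\<And>i x. 0 \<le> N i x"
    and mart: "\<And>i. AE x in M. CE i (N (Suc i)) x = N i x"
    and l: "l > 0"
  shows "prob {x\<in>space M. \<exists>i\<le>n. N i x > l} \<le> expectation (N 0) / l"
proof -
  have mono_int: "(\<integral>x. indicator A x * N (i + k) x \<partial>M) = (\<integral>x. indicator A x * N i x \<partial>M)"
    if A: "A \<in> sets (G i)" for A i k
  proof (induction k)
    case (Suc k)
    have A': "A \<in> sets (G (i + k))" using A subalg_mono[of i "i + k"] by (auto simp: subalgebra_def)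
    have AM: "A \<in> sets M" using A subalg by (auto simp: subalgebra_def)
    have [measurable]: "N j \<in> borel_measurable M" for j using N(1) by (rule G_meas)
    have "(\<integral>x. indicator A x * N (Suc (i + k)) x \<partial>M) = (\<integral>x. indicator A x * CE (i + k) (N (Suc (i + k))) x \<partial>M)"
      using A' AM integrable_mult_indicator[OF AM N(2)]
      by (intro CE_intg(2)[symmetric]) auto
    also have "\<dots> = (\<integral>x. indicator A x * N (i + k) x \<partial>M)"
      using mart[of "i + k"] AM by (intro integral_cong_AE) auto
    finally show ?case using Suc by simp
  qed simp
  have [measurable]: "N j \<in> borel_measurable M" for j using N(1) by (rule G_meas)
  \<comment> \<open>First passage above l at index i. These events are disjoint, T i belongs to G i,
    and on it the martingale property allows N n to be replaced by N i > l under the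
    integral.\<close>
  define T where "T i = {x\<in>space M. N i x > l \<and> (\<forall>j<i. N j x \<le> l)}" for i
  have TG: "T i \<in> sets (G i)" for i
  proof -
    have [measurable]: "N j \<in> borel_measurable (G i)" if "j \<le> i" for j
      using N(1) that by (rule G_meas_mono)
    have "{x\<in>space (G i). N i x > l \<and> (\<forall>j\<in>{..<i}. N j x \<le> l)} \<in> sets (G i)"
      by (intro sets.sets_Collect_conj sets.sets_Collect_finite_All) auto
    moreover have sp: "space (G i) = space M" using subalg[of i] unfolding subalgebra_def by blast
    moreover have "T i = {x\<in>space (G i). N i x > l \<and> (\<forall>j\<in>{..<i}. N j x \<le> l)}"
      unfolding T_def sp by blast
    ultimately show ?thesis by metis
  qed
  have TM[measurable]: "T i \<in> sets M" for i using TG[of i] subalg[of i] by (auto simp: subalgebra_def)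
  have disj: "disjoint_family_on T {..n}"
    unfolding disjoint_family_on_def T_def
    by (auto simp: disjoint_iff) (metis linorder_neqE_nat not_le)
  have U: "{x\<in>space M. \<exists>i\<le>n. N i x > l} = (\<Union>i\<le>n. T i)"
  proof safe
    fix x i assume "x \<in> space M" "i \<le> n" "l < N i x"
    define k where "k = (LEAST k. l < N k x)"
    have "l < N k x" "k \<le> i" unfolding k_def using \<open>l < N i x\<close> by (auto intro: LeastI Least_le)
    moreover have "N j x \<le> l" if "j < k" for j using not_less_Least[OF that[unfolded k_def]] by simp
    ultimately show "x \<in> (\<Union>i\<le>n. T i)" using \<open>x \<in> space M\<close> \<open>i \<le> n\<close> unfolding T_def
      by (auto intro!: bexI[of _ k])
  qed (auto simp: T_def)
  have "l * prob {x\<in>space M. \<exists>i\<le>n. N i x > l} = (\<Sum>i\<le>n. l * prob (T i))"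
    unfolding U using disj by (subst finite_measure_finite_Union) (auto simp: sum_distrib_left)
  also have "\<dots> \<le> (\<Sum>i\<le>n. \<integral>x. indicator (T i) x * N n x \<partial>M)"
  proof (intro sum_mono)
    fix i assume "i \<in> {..n}"
    then have "(\<integral>x. indicator (T i) x * N n x \<partial>M) = (\<integral>x. indicator (T i) x * N i x \<partial>M)"
      using mono_int[OF TG[of i], of "n - i"] by simp
    moreover have "(\<integral>x. l * indicator (T i) x \<partial>M) \<le> (\<integral>x. indicator (T i) x * N i x \<partial>M)"
    proof (intro integral_mono)
      show "integrable M (\<lambda>x. l * indicator (T i) x)"
        by (intro integrable_mult_right integrable_real_indicator) (auto simp: less_top[symmetric])
      show "integrable M (\<lambda>x. indicator (T i) x * N i x)"
        using integrable_mult_indicator[OF TM N(2), of i i] by simp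
      show "l * indicator (T i) x \<le> indicator (T i) x * N i x" for x
        by (auto simp: indicator_def T_def)
    qed
    ultimately show "l * prob (T i) \<le> (\<integral>x. indicator (T i) x * N n x \<partial>M)" by simp
  qed
  also have "\<dots> = (\<integral>x. (\<Sum>i\<le>n. indicator (T i) x * N n x) \<partial>M)"
    using integrable_mult_indicator[OF TM N(2), of _ n] by (subst Bochner_Integration.integral_sum) auto
  also have "\<dots> \<le> (\<integral>x. N n x \<partial>M)"
  proof (intro integral_mono)
    show "integrable M (\<lambda>x. \<Sum>i\<le>n. indicator (T i) x * N n x)"
      using integrable_mult_indicator[OF TM N(2), of _ n] by (intro Bochner_Integration.integrable_sum) auto
    fix x
    have "(\<Sum>i\<le>n. indicator (T i) x * N n x) = indicator (\<Union>i\<le>n. T i) x * N n x"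
      using disj by (simp add: indicator_UN_disjoint sum_distrib_right)
    also have "\<dots> \<le> N n x" using N(3)[of n x] by (auto simp: indicator_def)
    finally show "(\<Sum>i\<le>n. indicator (T i) x * N n x) \<le> N n x" .
  qed (rule N)
  also have "\<dots> = expectation (N 0)"
  proof -
    have sp: "space M \<in> sets (G 0)" using subalg[of 0] sets.top[of "G 0"] unfolding subalgebra_def by metis
    have "(\<integral>x. indicator (space M) x * N n x \<partial>M) = (\<integral>x. indicator (space M) x * N 0 x \<partial>M)"
      using mono_int[of "space M" 0 n] sp by simp
    moreover have "(\<integral>x. indicator (space M) x * N k x \<partial>M) = expectation (N k)" for k
      by (intro Bochner_Integration.integral_cong) auto
    ultimately show ?thesis by simp
  qed
  finally show ?thesis using l by (simp add: field_simps)
qed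

text \<open>Truncation at K makes a bounded supermartingale Z, whose compensator has total variation
  of mean at most m = E(N 0) and whose transformed martingale part has second moment at most 3 K m.
  The exceptional events, N above K, martingale part at least K, compensator at least K, contribute
  m/K, 3m/K and m/K: hence the constant 5.\<close>

lemma weak_type_nonneg:
  assumes N: "\<And>i. N i \<in> borel_measurable (G i)" "\<And>i. integrable M (N i)" "\<And>i x. 0 \<le> N i x"
    and mart: "\<And>i. AE x in M. CE i (N (Suc i)) x = N i x"
    and H: "\<And>i. H i \<in> borel_measurable (G i)" "\<And>i x. \<bar>H i x\<bar> \<le> 1"
    and K: "K > 0"
  shows "prob {x\<in>space M. \<bar>\<Sum>i<n. H i x * (N (Suc i) x - N i x)\<bar> > 2 * K} \<le> 5 * expectation (N 0) / K"
proof -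
  have NM[measurable]: "N j \<in> borel_measurable M" for j using N(1) by (rule G_meas)
  have HM[measurable]: "H j \<in> borel_measurable M" for j using H(1) by (rule G_meas)
  define m where "m = expectation (N 0)"
  define Z where "Z i x = min (N i x) K" for i x
  have ZG[measurable]: "Z i \<in> borel_measurable (G i)" for i using N(1)[of i] unfolding Z_def[abs_def] by measurable
  have ZM[measurable]: "Z i \<in> borel_measurable M" for i using ZG by (rule G_meas)
  have Z0: "0 \<le> Z i x" and ZK: "Z i x \<le> K" and ZN: "Z i x \<le> N i x" for i x
    using N(3)[of i x] K by (auto simp: Z_def)
  have Zi: "integrable M (Z i)" for i
    by (rule integrable_const_bound[of _ K]) (use Z0 ZK in auto)
  define D where "D i x = Z (Suc i) x - Z i x" for i x
  have D1: "D i \<in> borel_measurable (G (Suc i))" for i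
    using ZG[of "Suc i"] G_meas_mono[OF ZG[of i], of "Suc i"] unfolding D_def[abs_def] by measurable
  have DM[measurable]: "D i \<in> borel_measurable M" for i using D1 by (rule G_meas)
  have Db: "\<bar>D i x\<bar> \<le> K" for i x using Z0[of "Suc i" x] ZK[of "Suc i" x] Z0[of i x] ZK[of i x] unfolding D_def by linarith
  have Di: "integrable M (D i)" for i unfolding D_def[abs_def] using Zi by simp
  have D2: "integrable M (\<lambda>x. (D i x)\<^sup>2)" for i
    by (rule integrable_const_bound[of _ "K\<^sup>2"]) (use Db in \<open>auto simp: abs_le_square_iff[symmetric] K less_imp_le\<close>)
  have CED: "AE x in M. CE i (D i) x \<le> 0" for i
  proof -
    have "AE x in M. CE i (D i) x = CE i (Z (Suc i)) x - CE i (Z i) x"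
      unfolding D_def[abs_def] by (rule CE_diff[OF Zi Zi])
    moreover have "AE x in M. CE i (Z i) x = Z i x" by (rule CE_F_meas[OF Zi ZG])
    moreover have "AE x in M. CE i (Z (Suc i)) x \<le> CE i (N (Suc i)) x"
      by (rule CE_mono[OF _ Zi N(2)]) (use ZN in auto)
    moreover have "AE x in M. CE i (Z (Suc i)) x \<le> CE i (\<lambda>_. K) x"
      by (rule CE_mono[OF _ Zi]) (use ZK in auto)
    moreover have "AE x in M. CE i (\<lambda>_. K) x = K" by (rule CE_F_meas) auto
    ultimately show ?thesis using mart[of i] by eventually_elim (auto simp: Z_def)
  qed
  have CEi: "integrable M (CE i (D i))" for i by (rule CE_int(1)[OF Di])
  have CEm[measurable]: "CE i (D i) \<in> borel_measurable M" for i by simp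
  have CEe: "expectation (CE i (D i)) = expectation (Z (Suc i)) - expectation (Z i)" for i
    unfolding CE_int(2)[OF Di] unfolding D_def[abs_def] using Zi by simp
  have Zm: "expectation (Z i) \<le> expectation (N i)" for i by (intro integral_mono Zi N ZN)
  have Nm: "expectation (N i) = m" for i
  proof (induction i)
    case (Suc i)
    have "expectation (N (Suc i)) = expectation (CE i (N (Suc i)))" using CE_int(2)[OF N(2)] by simp
    also have "\<dots> = expectation (N i)" using mart[of i] by (intro integral_cong_AE) auto
    finally show ?case using Suc by simp
  qed (simp add: m_def)
  have tele: "(\<Sum>i<n. expectation (\<lambda>x. - CE i (D i) x)) \<le> m"
  proof -
    have "(\<Sum>i<n. expectation (\<lambda>x. - CE i (D i) x)) = (\<Sum>i<n. expectation (Z i) - expectation (Z (Suc i)))"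
      using CEe CEi by (intro sum.cong) auto
    also have "\<dots> = expectation (Z 0) - expectation (Z n)" by (rule sum_lessThan_telescope')
    also have "\<dots> \<le> m"
    proof -
      have "0 \<le> expectation (Z n)" by (rule Bochner_Integration.integral_nonneg) (rule Z0)
      then show ?thesis using Zm[of 0] Nm[of 0] by linarith
    qed
    finally show ?thesis .
  qed
  \<comment> \<open>With Z' the next value, D^2 = Z'^2 - Z^2 - 2 Z D. The differences of squares
    telescope to at most K m; since 0 \<le> Z \<le> K and the conditional mean of D is nonpositive,
    the terms - 2 E(Z D) add at most 2 K m.\<close>
  have sq: "(\<Sum>i<n. expectation (\<lambda>x. (D i x)\<^sup>2)) \<le> 3 * K * m"
  proof -
    have ZZ: "integrable M (\<lambda>x. (Z i x)\<^sup>2)" for i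
      by (rule integrable_const_bound[of _ "K\<^sup>2"]) (use Z0 ZK in \<open>auto simp: power_mono\<close>)
    have ZD: "integrable M (\<lambda>x. Z i x * D i x)" for i
      using ZZ D2 by (rule integrable_mult_of_squares[rotated 2]) auto
    have ZCm: "integrable M (\<lambda>x. Z i x * CE i (D i) x)" "expectation (\<lambda>x. Z i x * CE i (D i) x) = expectation (\<lambda>x. Z i x * D i x)" for i
      using CE_intg[OF ZD, of i] by auto
    have "expectation (\<lambda>x. (D i x)\<^sup>2) \<le> (expectation (\<lambda>x. (Z (Suc i) x)\<^sup>2) - expectation (\<lambda>x. (Z i x)\<^sup>2))
        + 2 * K * expectation (\<lambda>x. - CE i (D i) x)" for i
    proof -
      have "expectation (\<lambda>x. (D i x)\<^sup>2) = expectation (\<lambda>x. (Z (Suc i) x)\<^sup>2 - (Z i x)\<^sup>2 - 2 * (Z i x * D i x))"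
        by (rule Bochner_Integration.integral_cong[OF refl]) (simp add: D_def power2_eq_square algebra_simps)
      also have "\<dots> = expectation (\<lambda>x. (Z (Suc i) x)\<^sup>2) - expectation (\<lambda>x. (Z i x)\<^sup>2) - 2 * expectation (\<lambda>x. Z i x * D i x)"
        using ZZ ZD by simp
      also have "- expectation (\<lambda>x. Z i x * D i x) = expectation (\<lambda>x. Z i x * - CE i (D i) x)"
        using ZCm[of i] by simp
      then have "- 2 * expectation (\<lambda>x. Z i x * D i x) = 2 * expectation (\<lambda>x. Z i x * - CE i (D i) x)" by simp
      moreover have "expectation (\<lambda>x. Z i x * - CE i (D i) x) \<le> expectation (\<lambda>x. K * - CE i (D i) x)"
      proof (rule integral_mono_AE)
        show "AE x in M. Z i x * - CE i (D i) x \<le> K * - CE i (D i) x"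
          using CED[of i] by eventually_elim (intro mult_right_mono ZK, simp)
      qed (use ZCm CEi in auto)
      moreover have "expectation (\<lambda>x. K * - CE i (D i) x) = K * expectation (\<lambda>x. - CE i (D i) x)" by simp
      ultimately show ?thesis by linarith
    qed
    then have "(\<Sum>i<n. expectation (\<lambda>x. (D i x)\<^sup>2)) \<le> (\<Sum>i<n. (expectation (\<lambda>x. (Z (Suc i) x)\<^sup>2) - expectation (\<lambda>x. (Z i x)\<^sup>2))
        + 2 * K * expectation (\<lambda>x. - CE i (D i) x))" by (intro sum_mono)
    also have "\<dots> = (expectation (\<lambda>x. (Z n x)\<^sup>2) - expectation (\<lambda>x. (Z 0 x)\<^sup>2)) + 2 * K * (\<Sum>i<n. expectation (\<lambda>x. - CE i (D i) x))"
      unfolding sum.distrib sum_distrib_left[symmetric]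
      using sum_lessThan_telescope[of "\<lambda>i. expectation (\<lambda>x. (Z i x)\<^sup>2)" n] by simp
    also have "expectation (\<lambda>x. (Z n x)\<^sup>2) \<le> expectation (\<lambda>x. K * Z n x)"
      by (intro integral_mono ZZ integrable_mult_right Zi)
        (simp add: power2_eq_square mult_right_mono Z0 ZK)
    also have "expectation (\<lambda>x. K * Z n x) \<le> K * m"
      using Zm[of n] Nm[of n] K by (simp add: mult_left_mono)
    finally have "(\<Sum>i<n. expectation (\<lambda>x. (D i x)\<^sup>2))
      \<le> K * m - expectation (\<lambda>x. (Z 0 x)\<^sup>2) + 2 * K * (\<Sum>i<n. expectation (\<lambda>x. - CE i (D i) x))" by simp
    moreover have "expectation (\<lambda>x. (Z 0 x)\<^sup>2) \<ge> 0" by simp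
    moreover have "2 * K * (\<Sum>i<n. expectation (\<lambda>x. - CE i (D i) x)) \<le> 2 * K * m"
      using tele K by (intro mult_left_mono) auto
    ultimately show ?thesis by linarith
  qed
  define S where "S x = (\<Sum>i<n. H i x * (D i x - CE i (D i) x))" for x
  define A where "A x = (\<Sum>i<n. \<bar>CE i (D i) x\<bar>)" for x
  have Sm[measurable]: "S \<in> borel_measurable M" unfolding S_def[abs_def] by measurable
  have Am[measurable]: "A \<in> borel_measurable M" unfolding A_def[abs_def] by measurable
  have S2: "integrable M (\<lambda>x. (S x)\<^sup>2)" "expectation (\<lambda>x. (S x)\<^sup>2) \<le> 3 * K * m"
    using martingale_transform_square(2,3)[OF D1 D2 H, of n] sq unfolding S_def by auto
  have Ai: "integrable M A" unfolding A_def[abs_def] using CEi by auto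
  have "expectation A = (\<Sum>i<n. expectation (\<lambda>x. \<bar>CE i (D i) x\<bar>))"
    unfolding A_def[abs_def] using CEi by (intro Bochner_Integration.integral_sum) auto
  also have "\<dots> = (\<Sum>i<n. expectation (\<lambda>x. - CE i (D i) x))"
  proof (intro sum.cong refl integral_cong_AE)
    show "AE x in M. \<bar>CE i (D i) x\<bar> = - CE i (D i) x" for i using CED[of i] by eventually_elim auto
  qed auto
  finally have A1: "expectation A \<le> m" using tele by simp
  have "{x\<in>space M. \<bar>\<Sum>i<n. H i x * (N (Suc i) x - N i x)\<bar> > 2 * K} \<subseteq>
    {x\<in>space M. \<exists>i\<le>n. N i x > K} \<union> ({x\<in>space M. (S x)\<^sup>2 \<ge> K\<^sup>2} \<union> {x\<in>space M. A x \<ge> K})"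
  proof (intro subsetI, rule ccontr)
    fix x assume x: "x \<in> {x\<in>space M. \<bar>\<Sum>i<n. H i x * (N (Suc i) x - N i x)\<bar> > 2 * K}"
      and nx: "x \<notin> {x\<in>space M. \<exists>i\<le>n. N i x > K} \<union> ({x\<in>space M. (S x)\<^sup>2 \<ge> K\<^sup>2} \<union> {x\<in>space M. A x \<ge> K})"
    \<comment> \<open>Where N does not exceed K up to index n, the truncation is invisible and N and
      Z have the same transform.\<close>
    have NZ: "Z i x = N i x" if "i \<le> n" for i using x nx that unfolding Z_def by (auto simp: not_less)
    have "(S x)\<^sup>2 < K\<^sup>2" "A x < K" using x nx by (auto simp: not_le)
    then have SK: "\<bar>S x\<bar> < K" using K power2_less_imp_less[of "\<bar>S x\<bar>" K] by simp
    have "(\<Sum>i<n. H i x * (N (Suc i) x - N i x)) = (\<Sum>i<n. H i x * (D i x - CE i (D i) x) + H i x * CE i (D i) x)"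
      by (intro sum.cong) (auto simp: D_def NZ algebra_simps)
    also have "\<dots> = S x + (\<Sum>i<n. H i x * CE i (D i) x)" by (simp add: S_def sum.distrib)
    finally have "\<bar>\<Sum>i<n. H i x * (N (Suc i) x - N i x)\<bar> \<le> \<bar>S x\<bar> + \<bar>\<Sum>i<n. H i x * CE i (D i) x\<bar>" by simp
    also have "\<bar>\<Sum>i<n. H i x * CE i (D i) x\<bar> \<le> A x"
      unfolding A_def
      by (intro order_trans[OF sum_abs] sum_mono) (use H(2) in \<open>simp add: abs_mult mult_left_le_one_le\<close>)
    finally show False using SK \<open>A x < K\<close> x by simp
  qed
  then have "prob {x\<in>space M. \<bar>\<Sum>i<n. H i x * (N (Suc i) x - N i x)\<bar> > 2 * K} \<le>
    prob ({x\<in>space M. \<exists>i\<le>n. N i x > K} \<union> ({x\<in>space M. (S x)\<^sup>2 \<ge> K\<^sup>2} \<union> {x\<in>space M. A x \<ge> K}))"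
    by (intro finite_measure_mono) auto
  also have "\<dots> \<le> prob {x\<in>space M. \<exists>i\<le>n. N i x > K} + prob ({x\<in>space M. (S x)\<^sup>2 \<ge> K\<^sup>2} \<union> {x\<in>space M. A x \<ge> K})"
    by (intro measure_Un_le) auto
  also have "prob ({x\<in>space M. (S x)\<^sup>2 \<ge> K\<^sup>2} \<union> {x\<in>space M. A x \<ge> K}) \<le> prob {x\<in>space M. (S x)\<^sup>2 \<ge> K\<^sup>2} + prob {x\<in>space M. A x \<ge> K}"
    by (intro measure_Un_le) auto
  also have "prob {x\<in>space M. \<exists>i\<le>n. N i x > K} \<le> m / K"
    unfolding m_def by (rule doob_maximal[OF N mart K])
  also have "prob {x\<in>space M. (S x)\<^sup>2 \<ge> K\<^sup>2} \<le> expectation (\<lambda>x. (S x)\<^sup>2) / K\<^sup>2"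
    by (rule integral_Markov_inequality_measure[where A = "{}", OF S2(1)]) (use K in auto)
  also have "\<dots> \<le> 3 * K * m / K\<^sup>2" using S2(2) by (simp add: divide_right_mono)
  also have "prob {x\<in>space M. A x \<ge> K} \<le> expectation A / K"
    by (rule integral_Markov_inequality_measure[where A = "{}", OF Ai]) (use K in \<open>auto simp: A_def sum_nonneg\<close>)
  also have "\<dots> \<le> m / K" using A1 K by (simp add: divide_right_mono)
  finally show ?thesis using K by (simp add: m_def power2_eq_square field_simps)
qed

text \<open>The Krickeberg decomposition: the positive and negative parts of Y n, conditioned on
  each G i, give two nonnegative martingales whose difference is Y. Each is allowed the level 2 K,
  and their means add up to E|Y n|.\<close>

lemma weak_type_martingale:
  assumes Y: "\<And>i. Y i \<in> borel_measurable (G i)" "\<And>i. integrable M (Y i)"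
    and mart: "\<And>i. i \<le> n \<Longrightarrow> AE x in M. CE i (Y n) x = Y i x"
    and H: "\<And>i. H i \<in> borel_measurable (G i)" "\<And>i x. \<bar>H i x\<bar> \<le> 1"
    and K: "K > 0"
  shows "prob {x\<in>space M. \<bar>\<Sum>i<n. H i x * (Y (Suc i) x - Y i x)\<bar> > 4 * K}
    \<le> 5 * expectation (\<lambda>x. \<bar>Y n x\<bar>) / K"
proof -
  have YM[measurable]: "Y j \<in> borel_measurable M" for j using Y(1) by (rule G_meas)
  have HM[measurable]: "H j \<in> borel_measurable M" for j using H(1) by (rule G_meas)
  \<comment> \<open>For U \<ge> 0 the maximum with 0 changes the conditional expectation on a null
    set only, and it supplies nonnegativity at every point.\<close>
  define P where "P i U x = max 0 (CE i U x)" for i U x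
  define T where "T U x = (\<Sum>i<n. H i x * (P (Suc i) U x - P i U x))" for U x
  have PG[measurable]: "P i U \<in> borel_measurable (G i)" for i U
    unfolding P_def[abs_def] by measurable
  have PM[measurable]: "P i U \<in> borel_measurable M" for i U using PG by (rule G_meas)
  have TM[measurable]: "T U \<in> borel_measurable M" for U unfolding T_def[abs_def] by measurable
  have PC: "AE x in M. P i U x = CE i U x" if "integrable M U" "\<And>x. 0 \<le> U x" for U i
  proof -
    have "AE x in M. 0 \<le> CE i U x" using that by (intro CE_pos) auto
    then show ?thesis by eventually_elim (simp add: P_def)
  qed
  have weak: "prob {x\<in>space M. \<bar>T U x\<bar> > 2 * K} \<le> 5 * expectation U / K"
    if U: "integrable M U" "\<And>x. 0 \<le> U x" for U
  proof -
    have Pi: "integrable M (P i U)" for i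
      unfolding P_def[abs_def] using CE_int(1)[OF U(1)] by auto
    have "prob {x\<in>space M. \<bar>T U x\<bar> > 2 * K} \<le> 5 * expectation (P 0 U) / K"
      unfolding T_def
    proof (rule weak_type_nonneg[OF PG Pi _ _ H K])
      show "0 \<le> P i U x" for i x by (simp add: P_def)
      fix i
      have "AE x in M. CE i (P (Suc i) U) x = CE i (CE (Suc i) U) x"
        by (rule CE_cong[OF PC[OF U]]) auto
      moreover have "AE x in M. CE i (CE (Suc i) U) x = CE i U x"
        by (rule CE_nested[OF subalg subalg_mono U(1)]) simp
      ultimately show "AE x in M. CE i (P (Suc i) U) x = P i U x"
        using PC[OF U, of i] by eventually_elim simp
    qed
    also have "expectation (P 0 U) = expectation (CE 0 U)"
      using PC[OF U, of 0] by (intro integral_cong_AE) auto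
    also have "\<dots> = expectation U" by (rule CE_int(2)[OF U(1)])
    finally show ?thesis .
  qed
  define Up where "Up x = max 0 (Y n x)" for x
  define Um where "Um x = max 0 (- Y n x)" for x
  have Ui: "integrable M Up" "integrable M Um"
    unfolding Up_def[abs_def] Um_def[abs_def] using Y(2)[of n] by auto
  have U0: "0 \<le> Up x" "0 \<le> Um x" for x by (auto simp: Up_def Um_def)
  have Um: "Up \<in> borel_measurable M" "Um \<in> borel_measurable M" using Ui by auto
  have Yd: "AE x in M. Y i x = P i Up x - P i Um x" if "i \<le> n" for i
  proof -
    have "Y n = (\<lambda>x. Up x - Um x)" by (auto simp: Up_def Um_def)
    then have "AE x in M. CE i (Y n) x = CE i Up x - CE i Um x"
      using CE_diff[OF Ui] by simp
    with PC[OF Ui(1) U0(1), of i] PC[OF Ui(2) U0(2), of i] mart[OF that] show ?thesis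
      by eventually_elim simp
  qed
  have "AE x in M. \<forall>i\<in>{..n}. Y i x = P i Up x - P i Um x"
    using Yd by (subst AE_finite_all) auto
  then have eq: "AE x in M. (\<Sum>i<n. H i x * (Y (Suc i) x - Y i x)) = T Up x - T Um x"
  proof eventually_elim
    case (elim x)
    have "(\<Sum>i<n. H i x * (Y (Suc i) x - Y i x)) = (\<Sum>i<n. H i x * (P (Suc i) Up x - P i Up x) - H i x * (P (Suc i) Um x - P i Um x))"
    proof (intro sum.cong refl)
      fix i assume "i \<in> {..<n}"
      then have "Y i x = P i Up x - P i Um x" "Y (Suc i) x = P (Suc i) Up x - P (Suc i) Um x" using elim by auto
      then show "H i x * (Y (Suc i) x - Y i x) = H i x * (P (Suc i) Up x - P i Up x) - H i x * (P (Suc i) Um x - P i Um x)"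
        by (simp only:) (simp add: algebra_simps)
    qed
    then show ?case by (simp add: T_def sum_subtractf)
  qed
  have "prob {x\<in>space M. \<bar>\<Sum>i<n. H i x * (Y (Suc i) x - Y i x)\<bar> > 4 * K}
    \<le> prob ({x\<in>space M. \<bar>T Up x\<bar> > 2 * K} \<union> {x\<in>space M. \<bar>T Um x\<bar> > 2 * K})"
  proof (rule finite_measure_mono_AE)
    show "AE x in M. x \<in> {x\<in>space M. \<bar>\<Sum>i<n. H i x * (Y (Suc i) x - Y i x)\<bar> > 4 * K} \<longrightarrow>
      x \<in> {x\<in>space M. \<bar>T Up x\<bar> > 2 * K} \<union> {x\<in>space M. \<bar>T Um x\<bar> > 2 * K}"
      using eq by eventually_elim auto
  qed auto
  also have "\<dots> \<le> prob {x\<in>space M. \<bar>T Up x\<bar> > 2 * K} + prob {x\<in>space M. \<bar>T Um x\<bar> > 2 * K}"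
    by (intro measure_Un_le) auto
  also have "\<dots> \<le> 5 * expectation Up / K + 5 * expectation Um / K"
    using weak[OF Ui(1) U0(1)] weak[OF Ui(2) U0(2)] by linarith
  also have "\<dots> = 5 * expectation (\<lambda>x. Up x + Um x) / K"
    using Ui by (simp add: add_divide_distrib distrib_left)
  also have "(\<lambda>x. Up x + Um x) = (\<lambda>x. \<bar>Y n x\<bar>)" by (auto simp: Up_def Um_def)
  finally show ?thesis .
qed

end

section \<open>From martingales on a grid to semimartingales\<close>

lemma (in prob_space) AE_bounded_tail:
  fixes S :: "nat \<Rightarrow> 'a \<Rightarrow> real"
  assumes S[measurable]: "\<And>n. S n \<in> borel_measurable M"
    and bd: "AE x in M. \<exists>C. \<forall>n. S n x \<le> C" and e: "e > 0"
  shows "\<exists>k::nat. prob {x\<in>space M. \<exists>n. S n x > real k} < e"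
proof -
  define B where "B k = {x\<in>space M. \<exists>n. S n x > real k}" for k :: nat
  have Bm[measurable]: "B k \<in> sets M" for k
  proof -
    have "B k = (\<Union>n. {x\<in>space M. S n x > real k})" unfolding B_def by blast
    also have "\<dots> \<in> sets M"
    proof (rule sets.countable_UN'')
      show "{x\<in>space M. S n x > real k} \<in> sets M" for n using S[of n] by measurable
    qed (rule countableI_type)
    finally show ?thesis .
  qed
  have "(\<lambda>k. prob (B k)) \<longlonglongrightarrow> prob (\<Inter>k. B k)"
  proof (rule finite_Lim_measure_decseq)
    show "decseq B" unfolding decseq_def
    proof (intro allI impI subsetI)
      fix i j x assume "i \<le> j" and "x \<in> B j"
      then obtain n where "x \<in> space M" "S n x > real j" by (auto simp: B_def)
      moreover have "real i \<le> real j" using \<open>i \<le> j\<close> by simp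
      ultimately have "x \<in> space M" "S n x > real i" by linarith+
      then show "x \<in> B i" by (auto simp: B_def)
    qed
  qed auto
  moreover have "prob (\<Inter>k. B k) = 0"
  proof -
    have "AE x in M. x \<notin> (\<Inter>k. B k)"
      using bd
    proof eventually_elim
      case (elim x)
      then obtain C where C: "\<And>n. S n x \<le> C" by blast
      obtain k :: nat where "C \<le> real k" using real_arch_simple by blast
      then have "x \<notin> B k" using C unfolding B_def by (auto simp: not_less intro: order_trans)
      then show ?case by blast
    qed
    then show ?thesis by (subst prob_eq_0) auto
  qed
  ultimately have "\<forall>\<^sub>F k in sequentially. prob (B k) < e"
    using e by (simp add: order_tendstoD(2))
  then show ?thesis unfolding B_def eventually_sequentially by blast
qed

text \<open>
  One half of the Bichteler-Dellacherie theorem: elementary stochastic integrals against a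
  semimartingale with integrands bounded by one are bounded in probability.
\<close>

lemma (in prob_space) semimartingale_good_integrator:
  fixes X :: "real \<Rightarrow> 'a \<Rightarrow> real"
  assumes sub: "\<And>t. subalgebra M (F t)"
    and mono: "\<And>s t. 0 \<le> s \<Longrightarrow> s \<le> t \<Longrightarrow> subalgebra (F t) (F s)"
    and X: "semimartingale M F X" "\<And>t. t \<ge> 0 \<Longrightarrow> X t \<in> borel_measurable M" and e: "e > 0"
  obtains K where "K > 0" "\<And>n H. \<lbrakk>n > 0; \<And>i. H i \<in> borel_measurable (F (1 + real i / real n)); \<And>i x. \<bar>H i x\<bar> \<le> 1\<rbrakk> \<Longrightarrow>
    prob {x\<in>space M. \<bar>\<Sum>i<n. H i x * (X (1 + real (Suc i) / real n) x - X (1 + real i / real n) x)\<bar> > K} \<le> e"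
proof -
  obtain L A where L: "local_martingale M F L" and A: "adapted_process F A"
    and cA: "AE x in M. cadlag (\<lambda>t. A t x) \<and> finite_variation (\<lambda>t. A t x)"
    and XLA: "\<And>t. t \<ge> 0 \<Longrightarrow> AE x in M. X t x = L t x + A t x"
    using X(1) unfolding semimartingale_def by blast
  obtain \<tau> :: "nat \<Rightarrow> 'a \<Rightarrow> real" where
    st: "\<And>n. stopping_time F (\<tau> n)" and
    lim: "AE x in M. incseq (\<lambda>n. \<tau> n x) \<and> filterlim (\<lambda>n. \<tau> n x) at_top sequentially" and
    mart: "\<And>n. martingale M F (\<lambda>t x. L (min t (\<tau> n x)) x - L 0 x)"
    using L unfolding local_martingale_def by blast
  have FM: "f \<in> borel_measurable M" if "f \<in> borel_measurable (F t)" for f :: "'a \<Rightarrow> real" and t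
    using measurable_from_subalg[OF sub that] .
  have AM: "A t \<in> borel_measurable M" if "t \<ge> 0" for t
    using A that unfolding adapted_process_def by (blast intro: FM)
  have LM: "L t \<in> borel_measurable M" if "t \<ge> 0" for t
    using L that unfolding local_martingale_def adapted_process_def by (blast intro: FM)
  define g where "g n i = 1 + real i / real n" for n i :: nat
  have g0: "g n i \<ge> 0" for n i unfolding g_def by simp
  have [measurable]: "A (g n i) \<in> borel_measurable M" "L (g n i) \<in> borel_measurable M" "X (g n i) \<in> borel_measurable M" for n i
    using AM LM X(2) g0 by auto
  define V where "V n x = (\<Sum>i<n. \<bar>A (g n (Suc i)) x - A (g n i) x\<bar>)" for n x
  have [measurable]: "V n \<in> borel_measurable M" for n unfolding V_def[abs_def] by measurable
  have "AE x in M. \<exists>C. \<forall>n. V n x \<le> C"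
    using cA
  proof eventually_elim
    case (elim x)
    then obtain C where C: "\<And>n p. mono p \<Longrightarrow> range p \<subseteq> {0..2} \<Longrightarrow> (\<Sum>i<n. \<bar>A (p (Suc i)) x - A (p i) x\<bar>) \<le> C"
      unfolding finite_variation_def by (meson zero_le_numeral)
    have "V n x \<le> C" for n
    proof -
      \<comment> \<open>The grid is stopped at index n, which gives a monotone sequence with values
        in {0..2} at all indices, as \<open>finite_variation\<close> expects.\<close>
      define p where "p i = 1 + real (min i n) / real n" for i
      have "mono p" unfolding p_def by (intro monoI) (auto intro!: divide_right_mono)
      moreover have "range p \<subseteq> {0..2}" unfolding p_def by (auto simp: divide_le_eq_1)
      moreover have "V n x = (\<Sum>i<n. \<bar>A (p (Suc i)) x - A (p i) x\<bar>)"
        unfolding V_def by (intro sum.cong) (auto simp: p_def g_def)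
      ultimately show ?thesis using C by metis
    qed
    then show ?case by blast
  qed
  then have "\<exists>k::nat. prob {x\<in>space M. \<exists>n. V n x > real k} < e / 3"
    by (rule AE_bounded_tail[rotated]) (use e in auto)
  then obtain k :: nat where k: "prob {x\<in>space M. \<exists>n. V n x > real k} < e / 3" ..
  have tm[measurable]: "{x\<in>space M. \<tau> n x \<le> 2} \<in> sets M" for n
  proof -
    have "{x\<in>space (F 2). \<tau> n x \<le> 2} \<in> sets (F 2)" using stopping_timeD[OF st[of n], of 2] by (rule predE)
    moreover have sp: "space (F 2) = space M" and "sets (F 2) \<subseteq> sets M" using sub[of 2] unfolding subalgebra_def by blast+
    ultimately show ?thesis using sp by (metis (no_types, lifting) Collect_cong subset_eq)
  qed
  have "(\<lambda>n. prob {x\<in>space M. \<tau> n x \<le> 2}) \<longlonglongrightarrow> 0"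
  proof -
    have "(\<lambda>n. \<integral>x. indicator {x\<in>space M. \<tau> n x \<le> 2} x \<partial>M) \<longlonglongrightarrow> (\<integral>x. (0::real) \<partial>M)"
    proof (rule integral_dominated_convergence[where w = "\<lambda>_. 1"])
      show "AE x in M. (\<lambda>n. indicator {x\<in>space M. \<tau> n x \<le> 2} x) \<longlonglongrightarrow> (0::real)"
        using lim
      proof eventually_elim
        case (elim x)
        then have "\<forall>\<^sub>F n in sequentially. 2 < \<tau> n x" by (simp add: filterlim_at_top_dense)
        then have "\<forall>\<^sub>F n in sequentially. indicator {x\<in>space M. \<tau> n x \<le> 2} x = (0::real)"
          by eventually_elim auto
        then show ?case by (rule tendsto_eventually)
      qed
    next
      show "AE x in M. norm (indicator {x\<in>space M. \<tau> n x \<le> 2} x :: real) \<le> 1" for n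
        by (auto simp: indicator_def)
    qed (use tm in auto)
    then show ?thesis using tm by simp
  qed
  then have "\<forall>\<^sub>F n in sequentially. prob {x\<in>space M. \<tau> n x \<le> 2} < e / 3"
    using e by (intro order_tendstoD(2)) auto
  then obtain m where m: "prob {x\<in>space M. \<tau> m x \<le> 2} < e / 3"
    unfolding eventually_sequentially by blast
  \<comment> \<open>For this m the localizing time is at most 2 with probability below e / 3;
    otherwise Y and L have the same increments on the whole grid.\<close>
  define Y where "Y t x = L (min t (\<tau> m x)) x - L 0 x" for t x
  have mY: "martingale M F Y" using mart[of m] unfolding Y_def[abs_def] .
  define c where "c = expectation (\<lambda>x. \<bar>Y 2 x\<bar>)"
  have c0: "c \<ge> 0" unfolding c_def by (intro Bochner_Integration.integral_nonneg) auto
  \<comment> \<open>Chosen to bring the weak-type bound 5 c / K' below e / 3; the summand 1 keeps K'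
    positive when c = 0.\<close>
  define K' where "K' = 15 * c / e + 1"
  have K': "K' > 0" "5 * c / K' \<le> e / 3"
    using c0 e by (auto simp: K'_def field_simps add_nonneg_pos)
  show ?thesis
  proof (rule that[of "real k + 4 * K'"])
    show "real k + 4 * K' > 0" using K' by simp
    fix n :: nat and H :: "nat \<Rightarrow> 'a \<Rightarrow> real"
    assume n: "n > 0" and H: "\<And>i. H i \<in> borel_measurable (F (1 + real i / real n))" "\<And>i x. \<bar>H i x\<bar> \<le> 1"
    interpret D: discrete_filtration M "\<lambda>i. F (g n i)"
    proof
      show "subalgebra (F (g n j)) (F (g n i))" if "i \<le> j" for i j
        using that by (intro mono g0) (auto simp: g_def divide_right_mono)
    qed (rule sub)
    have HM[measurable]: "H i \<in> borel_measurable M" for i using H(1) by (rule FM)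
    have YF: "Y t \<in> borel_measurable (F t)" "integrable M (Y t)" if "t \<ge> 0" for t
      using mY that unfolding martingale_def adapted_process_def by auto
    have [measurable]: "Y (g n i) \<in> borel_measurable M" for i using YF(2) g0 by auto
    have gn: "g n n = 2" using n by (simp add: g_def)
    have "prob {x\<in>space M. \<bar>\<Sum>i<n. H i x * (Y (g n (Suc i)) x - Y (g n i) x)\<bar> > 4 * K'} \<le> 5 * expectation (\<lambda>x. \<bar>Y (g n n) x\<bar>) / K'"
    proof (rule D.weak_type_martingale)
      show "AE x in M. real_cond_exp M (F (g n i)) (Y (g n n)) x = Y (g n i) x" if "i \<le> n" for i
        using mY that g0 unfolding martingale_def by (auto simp: g_def divide_right_mono)
    qed (use YF g0 H K' in \<open>auto simp: g_def\<close>)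
    also have "\<dots> \<le> e / 3" using K'(2) by (simp only: gn c_def)
    finally have 1: "prob {x\<in>space M. \<bar>\<Sum>i<n. H i x * (Y (g n (Suc i)) x - Y (g n i) x)\<bar> > 4 * K'} \<le> e / 3" .
    have "AE x in M. \<forall>i\<in>{..n}. X (g n i) x = L (g n i) x + A (g n i) x"
      using XLA g0 by (subst AE_finite_all) auto
    \<comment> \<open>Outside the three exceptional events the integral splits into a martingale
      transform of size at most 4 K' and a sum bounded by the grid variation of A, which is at most
      k.\<close>
    then have "AE x in M. x \<in> {x\<in>space M. \<bar>\<Sum>i<n. H i x * (X (g n (Suc i)) x - X (g n i) x)\<bar> > real k + 4 * K'} \<longrightarrow>
      x \<in> {x\<in>space M. \<bar>\<Sum>i<n. H i x * (Y (g n (Suc i)) x - Y (g n i) x)\<bar> > 4 * K'} \<union>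
        ({x\<in>space M. \<tau> m x \<le> 2} \<union> {x\<in>space M. \<exists>n. V n x > real k})"
    proof eventually_elim
      case (elim x)
      show ?case
      proof (intro impI, rule ccontr)
        assume x: "x \<in> {x\<in>space M. \<bar>\<Sum>i<n. H i x * (X (g n (Suc i)) x - X (g n i) x)\<bar> > real k + 4 * K'}"
          and nx: "x \<notin> {x\<in>space M. \<bar>\<Sum>i<n. H i x * (Y (g n (Suc i)) x - Y (g n i) x)\<bar> > 4 * K'} \<union>
        ({x\<in>space M. \<tau> m x \<le> 2} \<union> {x\<in>space M. \<exists>n. V n x > real k})"
        have t2: "\<tau> m x > 2" and Vk: "V n x \<le> real k"
          and Y4: "\<bar>\<Sum>i<n. H i x * (Y (g n (Suc i)) x - Y (g n i) x)\<bar> \<le> 4 * K'"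
          using x nx by (auto simp: not_less)
        have g2: "g n i \<le> 2" if "i \<le> n" for i using that n by (simp add: g_def)
        have YL: "Y (g n i) x = L (g n i) x - L 0 x" if "i \<le> n" for i
        proof -
          have "min (g n i) (\<tau> m x) = g n i" using g2[OF that] t2 by linarith
          then show ?thesis by (simp add: Y_def)
        qed
        have "(\<Sum>i<n. H i x * (X (g n (Suc i)) x - X (g n i) x)) =
          (\<Sum>i<n. H i x * (Y (g n (Suc i)) x - Y (g n i) x) + H i x * (A (g n (Suc i)) x - A (g n i) x))"
        proof (intro sum.cong refl)
          fix i assume "i \<in> {..<n}"
          then have "X (g n i) x = L (g n i) x + A (g n i) x" "X (g n (Suc i)) x = L (g n (Suc i)) x + A (g n (Suc i)) x"
            "Y (g n i) x = L (g n i) x - L 0 x" "Y (g n (Suc i)) x = L (g n (Suc i)) x - L 0 x"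
            using elim YL by auto
          then show "H i x * (X (g n (Suc i)) x - X (g n i) x) =
            H i x * (Y (g n (Suc i)) x - Y (g n i) x) + H i x * (A (g n (Suc i)) x - A (g n i) x)"
            by (simp only:) (simp add: algebra_simps)
        qed
        also have "\<dots> = (\<Sum>i<n. H i x * (Y (g n (Suc i)) x - Y (g n i) x)) + (\<Sum>i<n. H i x * (A (g n (Suc i)) x - A (g n i) x))"
          by (rule sum.distrib)
        finally have eq: "(\<Sum>i<n. H i x * (X (g n (Suc i)) x - X (g n i) x)) = (\<Sum>i<n. H i x * (Y (g n (Suc i)) x - Y (g n i) x)) + (\<Sum>i<n. H i x * (A (g n (Suc i)) x - A (g n i) x))" .
        have "\<bar>\<Sum>i<n. H i x * (X (g n (Suc i)) x - X (g n i) x)\<bar> \<le> \<bar>\<Sum>i<n. H i x * (Y (g n (Suc i)) x - Y (g n i) x)\<bar> + \<bar>\<Sum>i<n. H i x * (A (g n (Suc i)) x - A (g n i) x)\<bar>"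
          unfolding eq by (rule abs_triangle_ineq)
        also have "\<bar>\<Sum>i<n. H i x * (A (g n (Suc i)) x - A (g n i) x)\<bar> \<le> V n x"
        proof -
          have "\<bar>H i x * (A (g n (Suc i)) x - A (g n i) x)\<bar> \<le> \<bar>A (g n (Suc i)) x - A (g n i) x\<bar>" for i
            unfolding abs_mult by (rule mult_left_le_one_le) (use H(2)[of i x] in auto)
          then show ?thesis unfolding V_def by (intro order_trans[OF sum_abs] sum_mono)
        qed
        finally show False using Y4 Vk x by simp
      qed
    qed
    then have "prob {x\<in>space M. \<bar>\<Sum>i<n. H i x * (X (g n (Suc i)) x - X (g n i) x)\<bar> > real k + 4 * K'} \<le>
      prob ({x\<in>space M. \<bar>\<Sum>i<n. H i x * (Y (g n (Suc i)) x - Y (g n i) x)\<bar> > 4 * K'} \<union>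
        ({x\<in>space M. \<tau> m x \<le> 2} \<union> {x\<in>space M. \<exists>n. V n x > real k}))"
      by (rule finite_measure_mono_AE) auto
    also have "\<dots> \<le> prob {x\<in>space M. \<bar>\<Sum>i<n. H i x * (Y (g n (Suc i)) x - Y (g n i) x)\<bar> > 4 * K'} +
        prob ({x\<in>space M. \<tau> m x \<le> 2} \<union> {x\<in>space M. \<exists>n. V n x > real k})"
      by (intro measure_Un_le) auto
    also have "prob ({x\<in>space M. \<tau> m x \<le> 2} \<union> {x\<in>space M. \<exists>n. V n x > real k}) \<le>
      prob {x\<in>space M. \<tau> m x \<le> 2} + prob {x\<in>space M. \<exists>n. V n x > real k}"
      by (intro measure_Un_le) auto
    finally show "prob {x\<in>space M. \<bar>\<Sum>i<n. H i x * (X (1 + real (Suc i) / real n) x - X (1 + real i / real n) x)\<bar> > real k + 4 * K'} \<le> e"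
      using 1 m k unfolding g_def by linarith
  qed
qed

section \<open>Moments and paths\<close>

lemma (in gaussian_space) square_diff:
  assumes "U \<in> V" "W \<in> V"
  shows "expectation (\<lambda>\<omega>. (U \<omega> - W \<omega>)\<^sup>2) =
    expectation (\<lambda>\<omega>. (U \<omega>)\<^sup>2) - 2 * expectation (\<lambda>\<omega>. U \<omega> * W \<omega>) + expectation (\<lambda>\<omega>. (W \<omega>)\<^sup>2)"
  using square_sum[OF assms(1) scale[OF assms(2), of "-1"]] by simp

lemma (in gaussian_space) square_lincomb:
  assumes "\<And>i. i \<in> J \<Longrightarrow> X i \<in> V"
  shows "expectation (\<lambda>\<omega>. (\<Sum>i\<in>J. c i * X i \<omega>)\<^sup>2) = (\<Sum>i\<in>J. \<Sum>j\<in>J. c i * c j * expectation (\<lambda>\<omega>. X i \<omega> * X j \<omega>))"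
proof -
  have "(\<Sum>i\<in>J. c i * X i \<omega>)\<^sup>2 = (\<Sum>i\<in>J. \<Sum>j\<in>J. c i * c j * (X i \<omega> * X j \<omega>))" for \<omega>
    unfolding power2_eq_square sum_product by (intro sum.cong refl) (simp add: ac_simps)
  then show ?thesis using assms integrable_product by (simp add: Bochner_Integration.integral_sum)
qed

lemma gaussian_space_distr_eq:
  assumes M: "gaussian_space M V" and N: "gaussian_space N W" and J: "finite J"
    and X: "\<And>i. i \<in> J \<Longrightarrow> X i \<in> V" and Y: "\<And>i. i \<in> J \<Longrightarrow> Y i \<in> W"
    and cov: "\<And>i j. i \<in> J \<Longrightarrow> j \<in> J \<Longrightarrow> (\<integral>\<omega>. X i \<omega> * X j \<omega> \<partial>M) = (\<integral>\<omega>. Y i \<omega> * Y j \<omega> \<partial>N)"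
  shows "distr M (Pi\<^sub>M J (\<lambda>_. borel)) (\<lambda>\<omega>. \<lambda>i\<in>J. X i \<omega>) = distr N (Pi\<^sub>M J (\<lambda>_. borel)) (\<lambda>\<omega>. \<lambda>i\<in>J. Y i \<omega>)"
proof -
  interpret M: gaussian_space M V by (rule M)
  interpret N: gaussian_space N W by (rule N)
  show ?thesis
  proof (rule distr_eq_of_cos[OF M.prob_space_axioms N.prob_space_axioms J])
    fix c d
    have X': "(\<lambda>\<omega>. \<Sum>i\<in>J. c i * X i \<omega>) \<in> V" using X by (intro M.sum M.scale)
    have Y': "(\<lambda>\<omega>. \<Sum>i\<in>J. c i * Y i \<omega>) \<in> W" using Y by (intro N.sum N.scale)
    show "(\<integral>\<omega>. cos ((\<Sum>i\<in>J. c i * X i \<omega>) + d) \<partial>M) = (\<integral>\<omega>. cos ((\<Sum>i\<in>J. c i * Y i \<omega>) + d) \<partial>N)"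
    proof -
      have "(\<integral>\<omega>. (\<Sum>i\<in>J. c i * X i \<omega>)\<^sup>2 \<partial>M) = (\<Sum>i\<in>J. \<Sum>j\<in>J. c i * c j * (\<integral>\<omega>. X i \<omega> * X j \<omega> \<partial>M))"
        by (rule M.square_lincomb) (rule X)
      also have "\<dots> = (\<Sum>i\<in>J. \<Sum>j\<in>J. c i * c j * (\<integral>\<omega>. Y i \<omega> * Y j \<omega> \<partial>N))"
        by (intro sum.cong refl) (simp add: cov)
      also have "\<dots> = (\<integral>\<omega>. (\<Sum>i\<in>J. c i * Y i \<omega>)\<^sup>2 \<partial>N)"
        by (rule N.square_lincomb[symmetric]) (rule Y)
      finally show ?thesis
        unfolding M.expectation_cos_shift[OF X'] N.expectation_cos_shift[OF Y'] by simp
    qed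
  qed (use X Y in \<open>auto intro: M.meas N.meas M.integrable_power N.integrable_power\<close>)
qed

text \<open>Convergence of covariances does two things: on the diagonal it eventually bounds the
  second moments, and through the quadratic form of a linear combination it yields the limits of the
  expected cosines.\<close>

lemma gaussian_space_weak_convergence:
  assumes M: "gaussian_space M V" and N: "gaussian_space N W" and J: "finite J"
    and X: "\<forall>\<^sub>F T in F. \<forall>i\<in>J. X T i \<in> V" and Y: "\<And>i. i \<in> J \<Longrightarrow> Y i \<in> W"
    and cov: "\<And>i j. i \<in> J \<Longrightarrow> j \<in> J \<Longrightarrow> ((\<lambda>T. \<integral>\<omega>. X T i \<omega> * X T j \<omega> \<partial>M) \<longlongrightarrow> (\<integral>\<omega>. Y i \<omega> * Y j \<omega> \<partial>N)) F"
    and f: "continuous_map (product_topology (\<lambda>_. euclideanreal) J) euclideanreal f"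
    and fB: "\<And>x. x \<in> (\<Pi>\<^sub>E i\<in>J. UNIV) \<Longrightarrow> \<bar>f x\<bar> \<le> B"
  shows "((\<lambda>T. \<integral>\<omega>. f (\<lambda>i\<in>J. X T i \<omega>) \<partial>M) \<longlongrightarrow> (\<integral>\<omega>. f (\<lambda>i\<in>J. Y i \<omega>) \<partial>N)) F"
proof -
  interpret M: gaussian_space M V by (rule M)
  interpret N: gaussian_space N W by (rule N)
  \<comment> \<open>The summand 1 places every limit variance strictly below C, so that the bound
    holds eventually along F.\<close>
  define C where "C = (\<Sum>i\<in>J. (\<integral>\<omega>. (Y i \<omega>)\<^sup>2 \<partial>N)) + 1"
  have C: "(\<integral>\<omega>. (Y i \<omega>)\<^sup>2 \<partial>N) < C" if "i \<in> J" for i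
  proof -
    have "(\<integral>\<omega>. (Y i \<omega>)\<^sup>2 \<partial>N) \<le> (\<Sum>i\<in>J. (\<integral>\<omega>. (Y i \<omega>)\<^sup>2 \<partial>N))" using that J by (intro member_le_sum) auto
    then show ?thesis by (simp add: C_def)
  qed
  have sq: "((\<lambda>T. \<integral>\<omega>. (X T i \<omega>)\<^sup>2 \<partial>M) \<longlongrightarrow> (\<integral>\<omega>. (Y i \<omega>)\<^sup>2 \<partial>N)) F" if "i \<in> J" for i
    using cov[OF that that] by (simp add: power2_eq_square)
  have "\<forall>\<^sub>F T in F. \<forall>i\<in>J. (\<integral>\<omega>. (X T i \<omega>)\<^sup>2 \<partial>M) < C"
    using order_tendstoD(2)[OF sq C] J by (simp add: eventually_ball_finite)
  with X have X': "\<forall>\<^sub>F T in F. \<forall>i\<in>J. X T i \<in> borel_measurable M \<and> integrable M (\<lambda>\<omega>. (X T i \<omega>)\<^sup>2) \<and> (\<integral>\<omega>. (X T i \<omega>)\<^sup>2 \<partial>M) \<le> C"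
    by eventually_elim (auto intro: M.meas M.integrable_power less_imp_le)
  show ?thesis
  proof (rule weak_convergence_criterion[OF M.prob_space_axioms N.prob_space_axioms J X' _ _ _ _ f fB])
    fix c d
    have Y': "(\<lambda>\<omega>. \<Sum>i\<in>J. c i * Y i \<omega>) \<in> W" using Y by (intro N.sum N.scale)
    have "((\<lambda>T. cos d * exp (- (\<Sum>i\<in>J. \<Sum>j\<in>J. c i * c j * (\<integral>\<omega>. X T i \<omega> * X T j \<omega> \<partial>M)) / 2)) \<longlongrightarrow>
      cos d * exp (- (\<Sum>i\<in>J. \<Sum>j\<in>J. c i * c j * (\<integral>\<omega>. Y i \<omega> * Y j \<omega> \<partial>N)) / 2)) F"
      by (intro tendsto_intros cov) auto
    moreover have "\<forall>\<^sub>F T in F. cos d * exp (- (\<Sum>i\<in>J. \<Sum>j\<in>J. c i * c j * (\<integral>\<omega>. X T i \<omega> * X T j \<omega> \<partial>M)) / 2) =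
      (\<integral>\<omega>. cos ((\<Sum>i\<in>J. c i * X T i \<omega>) + d) \<partial>M)"
      using X
    proof eventually_elim
      case (elim T)
      then have XT: "\<And>i. i \<in> J \<Longrightarrow> X T i \<in> V" by blast
      then have "(\<lambda>\<omega>. \<Sum>i\<in>J. c i * X T i \<omega>) \<in> V" by (intro M.sum M.scale)
      from M.expectation_cos_shift[OF this, of d] M.square_lincomb[where J = J and X = "X T" and c = c, OF XT] show ?case by simp
    qed
    moreover have "(\<integral>\<omega>. cos ((\<Sum>i\<in>J. c i * Y i \<omega>) + d) \<partial>N) =
      cos d * exp (- (\<Sum>i\<in>J. \<Sum>j\<in>J. c i * c j * (\<integral>\<omega>. Y i \<omega> * Y j \<omega> \<partial>N)) / 2)"
      using N.expectation_cos_shift[OF Y', of d] N.square_lincomb[where J = J and X = Y and c = c, OF Y] by simp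
    ultimately show "((\<lambda>T. \<integral>\<omega>. cos ((\<Sum>i\<in>J. c i * X T i \<omega>) + d) \<partial>M) \<longlongrightarrow> (\<integral>\<omega>. cos ((\<Sum>i\<in>J. c i * Y i \<omega>) + d) \<partial>N)) F"
      by (simp only:) (rule Lim_transform_eventually)
  qed (use Y C in \<open>auto intro: N.meas N.integrable_power less_imp_le\<close>)
qed

section \<open>Increments and paths of the weighted process\<close>

locale weighted_fbm_space = gaussian_space M V for M :: "'a measure" and V +
  fixes a b :: real and X :: "real \<Rightarrow> 'a \<Rightarrow> real"
  assumes a: "a > -1" and b: "b > -1" and b1: "b < 1" and ab: "\<bar>b\<bar> \<le> 1 + a"
    and XV: "t \<ge> 0 \<Longrightarrow> X t \<in> V"
    and cov: "0 \<le> s \<Longrightarrow> s \<le> t \<Longrightarrow> expectation (\<lambda>\<omega>. X s \<omega> * X t \<omega>) = wint a b 0 s t + wint a b 0 s s"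
begin

abbreviation B :: real where "B \<equiv> wB a b"

lemma B_pos: "B > 0" by (rule wB_pos[OF a b])

lemma cov_comm: "expectation (\<lambda>\<omega>. X s \<omega> * X t \<omega>) = expectation (\<lambda>\<omega>. X t \<omega> * X s \<omega>)"
  by (simp add: mult.commute)

lemma var: "t \<ge> 0 \<Longrightarrow> expectation (\<lambda>\<omega>. (X t \<omega>)\<^sup>2) = 2 * wint a b 0 t t"
  using cov[of t t] by (simp add: power2_eq_square)

lemma increment_in_V: "s \<ge> 0 \<Longrightarrow> t \<ge> 0 \<Longrightarrow> (\<lambda>\<omega>. X t \<omega> - X s \<omega>) \<in> V"
  by (intro diff XV)

lemma increment_sq_eq: "0 \<le> s \<Longrightarrow> s \<le> t \<Longrightarrow> increment_sq M X s t = 2 * wint a b s t t"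
  using square_diff[OF XV XV, of t s] var[of s] var[of t] cov[of s t] wint_split[OF a b, of 0 s t t]
  by (simp add: increment_sq_def cov_comm[of t s])

lemma increment_sq_commute: "increment_sq M X s t = increment_sq M X t s"
  by (simp add: increment_sq_def power2_commute)

lemma increment_sq_wlog:
  assumes "\<And>s t. s \<in> A \<Longrightarrow> t \<in> A \<Longrightarrow> s \<le> t \<Longrightarrow> Q (increment_sq M X s t) (t - s)" "s \<in> A" "t \<in> A"
  shows "Q (increment_sq M X s t) \<bar>t - s\<bar>"
  using assms(1)[of s t] assms(1)[of t s] assms(2,3) increment_sq_commute[of s t] by (cases "s \<le> t") auto

lemma increment_cov_eq:
  assumes "0 \<le> r" "r \<le> v" "v \<le> s" "s \<le> t"
  shows "increment_cov M X r v s t = wint a b r v t - wint a b r v s"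
proof -
  have i: "integrable M (\<lambda>\<omega>. X p \<omega> * X q \<omega>)" if "p \<ge> 0" "q \<ge> 0" for p q using that by (intro integrable_product XV)
  have "increment_cov M X r v s t = expectation (\<lambda>\<omega>. X v \<omega> * X t \<omega> - X r \<omega> * X t \<omega> - (X v \<omega> * X s \<omega> - X r \<omega> * X s \<omega>))"
    unfolding increment_cov_def by (simp add: algebra_simps)
  also have "\<dots> = expectation (\<lambda>\<omega>. X v \<omega> * X t \<omega>) - expectation (\<lambda>\<omega>. X r \<omega> * X t \<omega>) - (expectation (\<lambda>\<omega>. X v \<omega> * X s \<omega>) - expectation (\<lambda>\<omega>. X r \<omega> * X s \<omega>))"
    using assms i by simp
  also have "\<dots> = wint a b r v t - wint a b r v s"
    using assms cov[of v t] cov[of r t] cov[of v s] cov[of r s]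
      wint_split[OF a b, of 0 r v t] wint_split[OF a b, of 0 r v s] by simp
  finally show ?thesis .
qed

lemma increment_sq_bounds:
  assumes "0 \<le> s" "s \<le> t" "\<And>u. s < u \<Longrightarrow> u < t \<Longrightarrow> m \<le> u powr a \<and> u powr a \<le> m'"
  shows "2 * m / (b + 1) * (t - s) powr (b + 1) \<le> increment_sq M X s t"
    "increment_sq M X s t \<le> 2 * m' / (b + 1) * (t - s) powr (b + 1)"
  using wint_bounds_right[OF a b assms(1,2), of m m'] assms(3) increment_sq_eq[OF assms(1,2)] by simp_all

lemma self_similar: "c > 0 \<Longrightarrow> fdd_equal M (\<lambda>t. X (c * t)) M (\<lambda>t \<omega>. c powr ((1 + a + b) / 2) * X t \<omega>)"
  unfolding fdd_equal_def fdd_def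
proof (intro allI impI)
  fix J :: "real set" assume c: "c > 0" and J: "finite J \<and> J \<subseteq> {0..}"
  have c2: "c powr ((1 + a + b) / 2) * c powr ((1 + a + b) / 2) = c powr (1 + a + b)"
    by (simp flip: powr_add)
  have *: "expectation (\<lambda>\<omega>. X (c * s) \<omega> * X (c * t) \<omega>) = c powr (1 + a + b) * expectation (\<lambda>\<omega>. X s \<omega> * X t \<omega>)"
    if "0 \<le> s" "s \<le> t" for s t
  proof -
    have "c * s \<le> c * t" "0 \<le> c * s" using that c by auto
    then have "expectation (\<lambda>\<omega>. X (c * s) \<omega> * X (c * t) \<omega>) = wint a b (c * 0) (c * s) (c * t) + wint a b (c * 0) (c * s) (c * s)"
      using cov[of "c * s" "c * t"] by simp
    also have "\<dots> = c powr (1 + a + b) * (wint a b 0 s t + wint a b 0 s s)"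
      unfolding distrib_left using that c by (simp only: wint_scale[OF a b] order_refl)
    finally show ?thesis using cov[OF that] by simp
  qed
  have c': "expectation (\<lambda>\<omega>. X (c * s) \<omega> * X (c * t) \<omega>) = c powr (1 + a + b) * expectation (\<lambda>\<omega>. X s \<omega> * X t \<omega>)"
    if "0 \<le> s" "0 \<le> t" for s t
    using *[of s t] *[of t s] that cov_comm[of s t] cov_comm[of "c * s" "c * t"] by (cases "s \<le> t") auto
  show "distr M (Pi\<^sub>M J (\<lambda>_. borel)) (\<lambda>\<omega>. \<lambda>t\<in>J. X (c * t) \<omega>) =
    distr M (Pi\<^sub>M J (\<lambda>_. borel)) (\<lambda>\<omega>. \<lambda>t\<in>J. c powr ((1 + a + b) / 2) * X t \<omega>)"
  proof (rule gaussian_space_distr_eq[OF gaussian_space_axioms gaussian_space_axioms])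
    fix s t assume st: "s \<in> J" "t \<in> J"
    have "expectation (\<lambda>\<omega>. c powr ((1 + a + b) / 2) * X s \<omega> * (c powr ((1 + a + b) / 2) * X t \<omega>))
      = expectation (\<lambda>\<omega>. c powr (1 + a + b) * (X s \<omega> * X t \<omega>))"
      unfolding c2[symmetric] by (simp add: ac_simps)
    then show "expectation (\<lambda>\<omega>. X (c * s) \<omega> * X (c * t) \<omega>) =
      expectation (\<lambda>\<omega>. c powr ((1 + a + b) / 2) * X s \<omega> * (c powr ((1 + a + b) / 2) * X t \<omega>))"
      using c'[of s t] st J by auto
  qed (use J c in \<open>auto intro!: XV scale\<close>)
qed

lemma upper_nonneg_exponent:
  assumes "a \<ge> 0" "s \<in> {0..T}" "t \<in> {0..T}"
  shows "increment_sq M X s t \<le> 2 * T powr a / (b + 1) * \<bar>t - s\<bar> powr (b + 1)"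
proof (rule increment_sq_wlog[where A = "{0..T}" and Q = "\<lambda>x d. x \<le> 2 * T powr a / (b + 1) * d powr (b + 1)"])
  fix s t assume st: "s \<in> {0..T}" "t \<in> {0..T}" "s \<le> t"
  show "increment_sq M X s t \<le> 2 * T powr a / (b + 1) * (t - s) powr (b + 1)"
    by (rule increment_sq_bounds(2)[where m = 0]) (use st assms(1) in \<open>auto intro!: powr_mono2\<close>)
qed (use assms in auto)

lemma upper_neg_exponent:
  assumes "a < 0" "e > 0" "s \<ge> e" "t \<ge> e"
  shows "increment_sq M X s t \<le> 2 * e powr a / (b + 1) * \<bar>t - s\<bar> powr (b + 1)"
proof (rule increment_sq_wlog[where A = "{e..}" and Q = "\<lambda>x d. x \<le> 2 * e powr a / (b + 1) * d powr (b + 1)"])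
  fix s t assume st: "s \<in> {e..}" "t \<in> {e..}" "s \<le> t"
  show "increment_sq M X s t \<le> 2 * e powr a / (b + 1) * (t - s) powr (b + 1)"
    by (rule increment_sq_bounds(2)[where m = 0]) (use st assms(1,2) in \<open>auto intro!: powr_mono2'\<close>)
qed (use assms in auto)

lemma upper_self_similar:
  assumes "a \<le> 0" "s \<ge> 0" "t \<ge> 0"
  shows "increment_sq M X s t \<le> 2 * B * \<bar>t - s\<bar> powr (1 + a + b)"
proof (rule increment_sq_wlog[where A = "{0..}" and Q = "\<lambda>x d. x \<le> 2 * B * d powr (1 + a + b)"])
  fix s t :: real assume st: "s \<in> {0..}" "t \<in> {0..}" "s \<le> t"
  then show "increment_sq M X s t \<le> 2 * B * (t - s) powr (1 + a + b)"
    using wint_le_self_similar[OF a b assms(1), of s t] increment_sq_eq[of s t] by (simp add: mult.commute)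
qed (use assms in auto)

lemma lower_pos_exponent:
  assumes "a > 0" "e > 0" "s \<ge> e" "t \<ge> e"
  shows "increment_sq M X s t \<ge> 2 * e powr a / (b + 1) * \<bar>t - s\<bar> powr (b + 1)"
proof (rule increment_sq_wlog[where A = "{e..}" and Q = "\<lambda>x d. x \<ge> 2 * e powr a / (b + 1) * d powr (b + 1)"])
  fix s t assume st: "s \<in> {e..}" "t \<in> {e..}" "s \<le> t"
  show "2 * e powr a / (b + 1) * (t - s) powr (b + 1) \<le> increment_sq M X s t"
    by (rule increment_sq_bounds(1)[where m' = "t powr a"]) (use st assms(1,2) in \<open>auto intro!: powr_mono2\<close>)
qed (use assms in auto)

lemma lower_nonpos_exponent:
  assumes "a \<le> 0" "s \<in> {0..T}" "t \<in> {0..T}"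
  shows "increment_sq M X s t \<ge> 2 * T powr a / (b + 1) * \<bar>t - s\<bar> powr (b + 1)"
proof (rule increment_sq_wlog[where A = "{0..T}" and Q = "\<lambda>x d. x \<ge> 2 * T powr a / (b + 1) * d powr (b + 1)"])
  fix s t assume st: "s \<in> {0..T}" "t \<in> {0..T}" "s \<le> t"
  have "T powr a * ((t - s) powr (b + 1) / (b + 1)) \<le> wint a b s t t"
  proof -
    have i: "set_integrable lborel {s..t} (\<lambda>u. (t - u) powr b)"
      and v: "(LINT u:{s..t}|lborel. (t - u) powr b) = (t - s) powr (b + 1) / (b + 1)"
      using powr_integral_reflected[of b s t] b st by auto
    have "(LINT u:{s..t}|lborel. T powr a * (t - u) powr b) \<le> wint a b s t t"
      unfolding wint_def
      by (rule set_integral_mono_interior)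
        (use i wint_integrable[OF a b] st assms(1) in \<open>auto intro!: mult_right_mono powr_mono2'\<close>)
    then show ?thesis using v by simp
  qed
  then show "2 * T powr a / (b + 1) * (t - s) powr (b + 1) \<le> increment_sq M X s t"
    using increment_sq_eq[of s t] st by simp
qed (use assms in auto)

lemma continuous_paths:
  assumes "\<not> (a < 0 \<and> b < 0 \<and> a + b = -1)"
  shows "continuous_process M X"
proof -
  have "\<exists>\<gamma>>0. \<forall>m::nat. \<exists>C\<ge>0. \<forall>s\<in>{0..real m}. \<forall>t\<in>{0..real m}. increment_sq M X s t \<le> C * \<bar>t - s\<bar> powr \<gamma>"
  proof (cases "a \<ge> 0")
    case True
    have "\<forall>m::nat. \<exists>C\<ge>0. \<forall>s\<in>{0..real m}. \<forall>t\<in>{0..real m}. increment_sq M X s t \<le> C * \<bar>t - s\<bar> powr (b + 1)"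
    proof
      fix m :: nat
      show "\<exists>C\<ge>0. \<forall>s\<in>{0..real m}. \<forall>t\<in>{0..real m}. increment_sq M X s t \<le> C * \<bar>t - s\<bar> powr (b + 1)"
        by (intro exI[of _ "2 * real m powr a / (b + 1)"] conjI ballI upper_nonneg_exponent[OF True]) (use b in auto)
    qed
    then show ?thesis using b by (intro exI[of _ "b + 1"]) auto
  next
    case False
    \<comment> \<open>For b < 0 the condition |b| \<le> 1 + a gives 1 + a + b \<ge> 0, and equality
      is the excluded case.\<close>
    have "1 + a + b > 0" using assms ab a b False by (cases "b < 0") auto
    then show ?thesis using upper_self_similar False B_pos
      by (intro exI[of _ "1 + a + b"] conjI allI exI[of _ "2 * B"]) auto
  qed
  then obtain \<gamma> where "\<gamma> > 0 \<and> (\<forall>m::nat. \<exists>C\<ge>0. \<forall>s\<in>{0..real m}. \<forall>t\<in>{0..real m}. increment_sq M X s t \<le> C * \<bar>t - s\<bar> powr \<gamma>)" ..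
  then have g: "\<gamma> > 0"
    "\<And>m::nat. \<exists>C\<ge>0. \<forall>s\<in>{0..real m}. \<forall>t\<in>{0..real m}. increment_sq M X s t \<le> C * \<bar>t - s\<bar> powr \<gamma>" by auto
  \<comment> \<open>The Gaussian moment of order 2 k is of order |t - s|^(k \<gamma>), so any
    \<gamma> > 0, however small, can be lifted above the threshold 1 of the Kolmogorov
    criterion.\<close>
  obtain k :: nat where k: "1 / \<gamma> < real k" using reals_Archimedean2 ..
  have k1: "real k * \<gamma> > 1" using k g(1) by (simp add: field_simps)
  show ?thesis
  proof (rule kolmogorov_continuity[where p = "2 * k" and \<beta> = "real k * \<gamma> - 1"])
    show "X t \<in> borel_measurable M" if "t \<ge> 0" for t using that by (intro meas XV)
    show "integrable M (\<lambda>x. (X t x - X s x) ^ (2 * k))" if "s \<ge> 0" "t \<ge> 0" for s t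
      using that by (intro integrable_power increment_in_V)
    fix m :: nat
    from g(2)[of m] obtain C where "C \<ge> 0 \<and> (\<forall>s\<in>{0..real m}. \<forall>t\<in>{0..real m}. increment_sq M X s t \<le> C * \<bar>t - s\<bar> powr \<gamma>)" ..
    then have C: "C \<ge> 0" "\<forall>s\<in>{0..real m}. \<forall>t\<in>{0..real m}. increment_sq M X s t \<le> C * \<bar>t - s\<bar> powr \<gamma>" by auto
    show "\<exists>C. \<forall>s\<in>{0..real m}. \<forall>t\<in>{0..real m}.
      expectation (\<lambda>x. (X t x - X s x) ^ (2 * k)) \<le> C * \<bar>t - s\<bar> powr (1 + (real k * \<gamma> - 1))"
    proof (intro exI[of _ "fact (2 * k) / (2 ^ k * fact k) * C ^ k"] ballI)
      fix s t assume st: "s \<in> {0..real m}" "t \<in> {0..real m}"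
      have "expectation (\<lambda>x. (X t x - X s x) ^ (2 * k)) = fact (2 * k) / (2 ^ k * fact k) * increment_sq M X s t ^ k"
        unfolding increment_sq_def using st by (intro even_moment increment_in_V) auto
      also have "\<dots> \<le> fact (2 * k) / (2 ^ k * fact k) * (C * \<bar>t - s\<bar> powr \<gamma>) ^ k"
      proof (intro mult_left_mono power_mono)
        show "0 \<le> increment_sq M X s t" unfolding increment_sq_def by simp
      qed (use C st in auto)
      also have "\<dots> = fact (2 * k) / (2 ^ k * fact k) * C ^ k * \<bar>t - s\<bar> powr (1 + (real k * \<gamma> - 1))"
      proof (cases "s = t")
        case True
        have "k > 0" using k1 by (cases k) auto
        with True show ?thesis by simp
      next
        case False
        then show ?thesis by (simp add: power_mult_distrib powr_power mult.commute)
      qed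
      finally show "expectation (\<lambda>x. (X t x - X s x) ^ (2 * k)) \<le> fact (2 * k) / (2 ^ k * fact k) * C ^ k * \<bar>t - s\<bar> powr (1 + (real k * \<gamma> - 1))" .
    qed
  qed (use k1 in auto)
qed

lemma discontinuous:
  assumes "a + b = -1"
  shows "discontinuous_at_0 M X"
  unfolding discontinuous_at_0_def
proof
  assume "\<exists>Y. modification M X Y \<and> (AE \<omega> in M. continuous (at 0 within {0..}) (\<lambda>t. Y t \<omega>))"
  then obtain Y where Y: "\<And>t. t \<ge> 0 \<Longrightarrow> Y t \<in> borel_measurable M" "\<And>t. t \<ge> 0 \<Longrightarrow> AE \<omega> in M. Y t \<omega> = X t \<omega>"
    and cont: "AE \<omega> in M. continuous (at 0 within {0..}) (\<lambda>t. Y t \<omega>)"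
    unfolding modification_def by blast
  define h where "h n = 1 / real (Suc n)" for n
  have h: "h n > 0" for n by (simp add: h_def)
  note [measurable] = meas[OF XV]
  have "AE \<omega> in M. X 0 \<omega> = 0"
  proof -
    have "expectation (\<lambda>\<omega>. (X 0 \<omega>)\<^sup>2) = 0" using var[of 0] wint_empty[OF a b] by simp
    then have "AE \<omega> in M. (X 0 \<omega>)\<^sup>2 = 0"
      using integrable_power[OF XV, of 0 2] by (subst (asm) integral_nonneg_eq_0_iff_AE) auto
    then show ?thesis by simp
  qed
  moreover have "AE \<omega> in M. \<forall>n. Y (h n) \<omega> = X (h n) \<omega>"
    using Y(2) h less_imp_le by (subst AE_all_countable) blast
  ultimately have lim: "AE \<omega> in M. (\<lambda>n. cos (X (h n) \<omega>)) \<longlonglongrightarrow> 1"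
    using Y(2)[of 0, OF order_refl] cont
  proof eventually_elim
    case (elim \<omega>)
    have "((\<lambda>t. Y t \<omega>) \<longlongrightarrow> Y 0 \<omega>) (at 0 within {0..})" using elim(4) by (simp add: continuous_within)
    moreover have "filterlim h (at 0 within {0..}) sequentially"
      unfolding filterlim_at
    proof
      show "h \<longlonglongrightarrow> 0" unfolding h_def by real_asymp
      show "\<forall>\<^sub>F n in sequentially. h n \<in> {0..} \<and> h n \<noteq> 0" using h by (auto simp: less_imp_le less_imp_neq[symmetric])
    qed
    ultimately have "(\<lambda>n. Y (h n) \<omega>) \<longlonglongrightarrow> Y 0 \<omega>" by (rule filterlim_compose)
    then have "(\<lambda>n. X (h n) \<omega>) \<longlonglongrightarrow> 0" using elim by simp
    then show ?case using tendsto_cos by fastforce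
  qed
  \<comment> \<open>The bounded test function cos detects the jump: continuity at 0 sends its
    expectation to 1, whereas the variance 2 B at every time h n fixes it at exp(- B) < 1.\<close>
  have "(\<lambda>n. expectation (\<lambda>\<omega>. cos (X (h n) \<omega>))) \<longlonglongrightarrow> expectation (\<lambda>_. 1)"
    using lim by (intro integral_dominated_convergence[where w = "\<lambda>_. 1"])
      (use h in \<open>auto simp: less_imp_le\<close>)
  moreover have "expectation (\<lambda>\<omega>. cos (X (h n) \<omega>)) = exp (- B)" for n
  proof -
    have "expectation (\<lambda>\<omega>. (X (h n) \<omega>)\<^sup>2) = 2 * (h n powr (1 + a + b) * B)"
      using var[of "h n"] wint_full[OF a b, of "h n"] h[of n] by simp
    also have "1 + a + b = 0" using assms by simp
    finally show ?thesis using expectation_cos_sin(1)[OF XV, of "h n"] h[of n] by simp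
  qed
  ultimately have "exp (- B) = 1" by (simp add: LIMSEQ_const_iff prob_space)
  then show False using B_pos by simp
qed

section \<open>Asymptotics of increments\<close>

lemma long_range:
  assumes "0 \<le> r" "r < v" "v \<le> s" "s < t"
  shows "((\<lambda>T. T powr (1 - b) * increment_cov M X r v (s + T) (t + T)) \<longlongrightarrow>
    b / (a + 1) * (t - s) * (v powr (a + 1) - r powr (a + 1))) at_top"
proof (rule Lim_transform_eventually[OF wint_long_range[OF a b b1 assms]])
  show "\<forall>\<^sub>F T in at_top. T powr (1 - b) * (wint a b r v (t + T) - wint a b r v (s + T)) =
    T powr (1 - b) * increment_cov M X r v (s + T) (t + T)"
    using eventually_ge_at_top[of 0] by eventually_elim (use assms in \<open>simp add: increment_cov_eq\<close>)
qed

text \<open>The weight is monotone in u, so its extremes over the interval sit at the end points;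
  which end carries the minimum depends on the sign of a, hence \<open>min\<close> and
  \<open>max\<close>.\<close>

lemma increment_sq_sandwich:
  assumes "0 < s" "s \<le> t"
  shows "min (s powr a) (t powr a) * (2 / (b + 1) * (t - s) powr (b + 1)) \<le> increment_sq M X s t"
    "increment_sq M X s t \<le> max (s powr a) (t powr a) * (2 / (b + 1) * (t - s) powr (b + 1))"
proof -
  have "min (s powr a) (t powr a) \<le> u powr a \<and> u powr a \<le> max (s powr a) (t powr a)" if "s < u" "u < t" for u
    using powr_mono2[of a s u] powr_mono2[of a u t] powr_mono2'[of a s u] powr_mono2'[of a u t] assms that
    by (cases "a \<ge> 0") auto
  from increment_sq_bounds[OF _ assms(2) this] assms(1)
  show "min (s powr a) (t powr a) * (2 / (b + 1) * (t - s) powr (b + 1)) \<le> increment_sq M X s t"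
    "increment_sq M X s t \<le> max (s powr a) (t powr a) * (2 / (b + 1) * (t - s) powr (b + 1))"
    by (simp_all add: mult.commute mult.left_commute)
qed

text \<open>Far from the origin the weight is nearly constant, as (s + T)^a and (t + T)^a are both
  asymptotic to T^a. What remains is, up to the factor 2 / (b + 1), the increment variance of
  fractional Brownian motion with Hurst parameter (1 + b) / 2.\<close>

lemma shifted_increment_limit:
  assumes "0 \<le> s" "s \<le> t"
  shows "((\<lambda>T. T powr (- a) * increment_sq M X (s + T) (t + T)) \<longlongrightarrow> 2 / (b + 1) * (t - s) powr (b + 1)) at_top"
proof -
  define c where "c = 2 / (b + 1) * (t - s) powr (b + 1)"
  have 1: "((\<lambda>T. T powr (- a) * (s + T) powr a) \<longlongrightarrow> 1) at_top" "((\<lambda>T. T powr (- a) * (t + T) powr a) \<longlongrightarrow> 1) at_top"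
    by real_asymp+
  show ?thesis unfolding c_def[symmetric]
  proof (rule tendsto_sandwich)
    show "((\<lambda>T. min (T powr (- a) * (s + T) powr a) (T powr (- a) * (t + T) powr a) * c) \<longlongrightarrow> c) at_top"
      using tendsto_mult_right[OF tendsto_min[OF 1], of c] by simp
    show "((\<lambda>T. max (T powr (- a) * (s + T) powr a) (T powr (- a) * (t + T) powr a) * c) \<longlongrightarrow> c) at_top"
      using tendsto_mult_right[OF tendsto_max[OF 1], of c] by simp
    show "\<forall>\<^sub>F T in at_top. min (T powr (- a) * (s + T) powr a) (T powr (- a) * (t + T) powr a) * c \<le> T powr (- a) * increment_sq M X (s + T) (t + T)"
      using eventually_gt_at_top[of 0]
    proof eventually_elim
      case (elim T)
      have "T powr (- a) * (min ((s + T) powr a) ((t + T) powr a) * c) \<le> T powr (- a) * increment_sq M X (s + T) (t + T)"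
        using increment_sq_sandwich(1)[of "s + T" "t + T"] assms elim by (intro mult_left_mono) (auto simp: c_def)
      moreover have "min (T powr (- a) * (s + T) powr a) (T powr (- a) * (t + T) powr a) = T powr (- a) * min ((s + T) powr a) ((t + T) powr a)"
        by (simp add: min_mult_distrib_left)
      ultimately show ?case by (simp add: mult.assoc)
    qed
    show "\<forall>\<^sub>F T in at_top. T powr (- a) * increment_sq M X (s + T) (t + T) \<le> max (T powr (- a) * (s + T) powr a) (T powr (- a) * (t + T) powr a) * c"
      using eventually_gt_at_top[of 0]
    proof eventually_elim
      case (elim T)
      have "T powr (- a) * increment_sq M X (s + T) (t + T) \<le> T powr (- a) * (max ((s + T) powr a) ((t + T) powr a) * c)"
        using increment_sq_sandwich(2)[of "s + T" "t + T"] assms elim by (intro mult_left_mono) (auto simp: c_def)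
      moreover have "max (T powr (- a) * (s + T) powr a) (T powr (- a) * (t + T) powr a) = T powr (- a) * max ((s + T) powr a) ((t + T) powr a)"
        by (simp add: max_mult_distrib_left)
      ultimately show ?case by (simp add: mult.assoc)
    qed
  qed
qed

text \<open>For a = 0 the squared increment is an exact power; for t > 0 the two end point weights
  squeeze the limit; for t = 0 and a > 0 scaling gives 2 B \<epsilon>^a, which tends to 0. The
  conditional in the limit implements 0^0 = 1, since \<open>0 powr 0 = 0\<close>.\<close>

lemma short_time:
  assumes "0 \<le> t" "a < 0 \<Longrightarrow> 0 < t"
  shows "((\<lambda>\<epsilon>. \<epsilon> powr (- b - 1) * increment_sq M X t (t + \<epsilon>)) \<longlongrightarrow>
    2 / (b + 1) * (if a = 0 then 1 else t powr a)) (at_right 0)"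
proof (cases "a = 0")
  case True
  have "\<epsilon> powr (- b - 1) * increment_sq M X t (t + \<epsilon>) = 2 / (b + 1)" if "\<epsilon> > 0" for \<epsilon>
  proof -
    have "increment_sq M X t (t + \<epsilon>) = 2 / (b + 1) * \<epsilon> powr (b + 1)"
      using increment_sq_bounds[of t "t + \<epsilon>" 1 1] assms(1) True that by simp
    moreover have "\<epsilon> powr (- b - 1) * \<epsilon> powr (b + 1) = 1" using that by (simp flip: powr_add)
    ultimately show ?thesis by simp
  qed
  then have "\<forall>\<^sub>F \<epsilon> in at_right 0. \<epsilon> powr (- b - 1) * increment_sq M X t (t + \<epsilon>) = 2 / (b + 1)"
    by (auto simp: eventually_at_filter)
  then show ?thesis using True by (simp add: tendsto_eventually)
next
  case a0: False
  show ?thesis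
  proof (cases "t = 0")
    case True
    have "\<forall>\<^sub>F \<epsilon> in at_right 0. 2 * B * \<epsilon> powr a = \<epsilon> powr (- b - 1) * increment_sq M X t (t + \<epsilon>)"
      unfolding eventually_at_filter
    proof (intro always_eventually allI impI)
      fix \<epsilon> :: real assume "\<epsilon> \<noteq> 0" "\<epsilon> \<in> {0<..}"
      then have e: "\<epsilon> > 0" by simp
      have "\<epsilon> powr (- b - 1) * increment_sq M X t (t + \<epsilon>) = 2 * B * (\<epsilon> powr (- b - 1) * \<epsilon> powr (1 + a + b))"
        using e True increment_sq_eq[of 0 \<epsilon>] wint_full[OF a b, of \<epsilon>] by simp
      also have "\<epsilon> powr (- b - 1) * \<epsilon> powr (1 + a + b) = \<epsilon> powr a" using e by (simp flip: powr_add)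
      finally show "2 * B * \<epsilon> powr a = \<epsilon> powr (- b - 1) * increment_sq M X t (t + \<epsilon>)" by simp
    qed
    moreover have "((\<lambda>\<epsilon>. 2 * B * \<epsilon> powr a) \<longlongrightarrow> 2 * B * 0) (at_right 0)"
    proof (intro tendsto_mult tendsto_const)
      have "a > 0" using assms a0 True by linarith
      then show "((\<lambda>\<epsilon>. \<epsilon> powr a) \<longlongrightarrow> 0) (at_right 0)" by real_asymp
    qed
    ultimately have "((\<lambda>\<epsilon>. \<epsilon> powr (- b - 1) * increment_sq M X t (t + \<epsilon>)) \<longlongrightarrow> 0) (at_right 0)"
      by (simp add: Lim_transform_eventually)
    then show ?thesis using True a0 by simp
  next
    case False
    then have t: "t > 0" using assms by simp
    define c where "c = 2 / (b + 1)"
    have e1: "\<epsilon> powr (- b - 1) * \<epsilon> powr (b + 1) = 1" if "\<epsilon> > 0" for \<epsilon> :: real using that by (simp flip: powr_add)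
    have 1: "((\<lambda>\<epsilon>. t powr a) \<longlongrightarrow> t powr a) (at_right 0)" "((\<lambda>\<epsilon>. (t + \<epsilon>) powr a) \<longlongrightarrow> t powr a) (at_right 0)"
      using t by (auto intro!: tendsto_eq_intros)
    have ev: "\<forall>\<^sub>F \<epsilon> in at_right 0. \<epsilon> > (0::real)" by (simp add: eventually_at_right_less)
    have "((\<lambda>\<epsilon>. \<epsilon> powr (- b - 1) * increment_sq M X t (t + \<epsilon>)) \<longlongrightarrow> t powr a * c) (at_right 0)"
    proof (rule tendsto_sandwich)
      show "((\<lambda>\<epsilon>. min (t powr a) ((t + \<epsilon>) powr a) * c) \<longlongrightarrow> t powr a * c) (at_right 0)"
        using tendsto_mult_right[OF tendsto_min[OF 1], of c] by simp
      show "((\<lambda>\<epsilon>. max (t powr a) ((t + \<epsilon>) powr a) * c) \<longlongrightarrow> t powr a * c) (at_right 0)"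
        using tendsto_mult_right[OF tendsto_max[OF 1], of c] by simp
      show "\<forall>\<^sub>F \<epsilon> in at_right 0. min (t powr a) ((t + \<epsilon>) powr a) * c \<le> \<epsilon> powr (- b - 1) * increment_sq M X t (t + \<epsilon>)"
        using ev
      proof eventually_elim
        case (elim \<epsilon>)
        have "\<epsilon> powr (- b - 1) * (min (t powr a) ((t + \<epsilon>) powr a) * (c * \<epsilon> powr (b + 1))) \<le> \<epsilon> powr (- b - 1) * increment_sq M X t (t + \<epsilon>)"
          using increment_sq_sandwich(1)[of t "t + \<epsilon>"] t elim by (intro mult_left_mono) (auto simp: c_def)
        moreover have "\<epsilon> powr (- b - 1) * (min (t powr a) ((t + \<epsilon>) powr a) * (c * \<epsilon> powr (b + 1))) = min (t powr a) ((t + \<epsilon>) powr a) * c * (\<epsilon> powr (- b - 1) * \<epsilon> powr (b + 1))"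
          by (simp only: ac_simps)
        ultimately show ?case using e1[OF elim] by simp
      qed
      show "\<forall>\<^sub>F \<epsilon> in at_right 0. \<epsilon> powr (- b - 1) * increment_sq M X t (t + \<epsilon>) \<le> max (t powr a) ((t + \<epsilon>) powr a) * c"
        using ev
      proof eventually_elim
        case (elim \<epsilon>)
        have "\<epsilon> powr (- b - 1) * increment_sq M X t (t + \<epsilon>) \<le> \<epsilon> powr (- b - 1) * (max (t powr a) ((t + \<epsilon>) powr a) * (c * \<epsilon> powr (b + 1)))"
          using increment_sq_sandwich(2)[of t "t + \<epsilon>"] t elim by (intro mult_left_mono) (auto simp: c_def)
        moreover have "\<epsilon> powr (- b - 1) * (max (t powr a) ((t + \<epsilon>) powr a) * (c * \<epsilon> powr (b + 1))) = max (t powr a) ((t + \<epsilon>) powr a) * c * (\<epsilon> powr (- b - 1) * \<epsilon> powr (b + 1))"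
          by (simp only: ac_simps)
        ultimately show ?case using e1[OF elim] by simp
      qed
    qed
    then show ?thesis using a0 by (simp add: c_def mult.commute)
  qed
qed

lemma long_time:
  assumes "t \<ge> 0"
  shows "((\<lambda>T. T powr (- (1 + a + b)) * increment_sq M X t (t + T)) \<longlongrightarrow> 2 * B) at_top"
proof (rule Lim_transform_eventually[OF tendsto_mult_left[OF wint_long[OF a b assms], of 2]])
  show "\<forall>\<^sub>F T in at_top. 2 * (T powr (- (1 + a + b)) * wint a b t (t + T) (t + T)) =
    T powr (- (1 + a + b)) * increment_sq M X t (t + T)"
    using eventually_ge_at_top[of 0] by eventually_elim (use assms in \<open>simp add: increment_sq_eq\<close>)
qed

lemma asymp_equiv_of_powr_limit:
  fixes f :: "real \<Rightarrow> real"
  assumes "((\<lambda>x. x powr (- p) * f x) \<longlongrightarrow> c) F" "c \<noteq> 0"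
  shows "f \<sim>[F] (\<lambda>x. c * x powr p)"
  by (rule asymp_equivI'_const) (use assms in \<open>simp_all add: powr_minus divide_inverse mult.commute\<close>)

lemma asymptotically_stationary_long: "asymptotically_stationary_increments M X {0..} at_top"
  unfolding asymptotically_stationary_increments_def
proof (intro ballI)
  fix s t :: real assume "s \<in> {0..}" "t \<in> {0..}"
  then have "(\<lambda>\<tau>. increment_sq M X s (s + \<tau>)) \<sim>[at_top] (\<lambda>x. 2 * B * x powr (1 + a + b))"
    "(\<lambda>\<tau>. increment_sq M X t (t + \<tau>)) \<sim>[at_top] (\<lambda>x. 2 * B * x powr (1 + a + b))"
    using long_time B_pos by (auto intro!: asymp_equiv_of_powr_limit)
  then show "(\<lambda>\<tau>. increment_sq M X s (s + \<tau>)) \<sim>[at_top] (\<lambda>\<tau>. increment_sq M X t (t + \<tau>))"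
    using asymp_equiv_trans asymp_equiv_symI by blast
qed

text \<open>The short-time limits at the starting times 1 and 2 differ by the factor 2^a, so equal
  asymptotics force a = 0. Positive starting times are the range in which the limit is available for
  every a.\<close>

lemma asymptotically_stationary_short: "asymptotically_stationary_increments M X {0<..} (at_right 0) \<longleftrightarrow> a = 0"
proof
  assume "a = 0"
  show "asymptotically_stationary_increments M X {0<..} (at_right 0)"
    unfolding asymptotically_stationary_increments_def
  proof (intro ballI)
    have *: "(\<lambda>\<tau>. increment_sq M X t (t + \<tau>)) \<sim>[at_right 0] (\<lambda>x. 2 / (b + 1) * x powr (b + 1))" if "t > 0" for t
      using short_time[of t] that \<open>a = 0\<close> b by (intro asymp_equiv_of_powr_limit) auto
    fix s t :: real assume "s \<in> {0<..}" "t \<in> {0<..}"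
    then show "(\<lambda>\<tau>. increment_sq M X s (s + \<tau>)) \<sim>[at_right 0] (\<lambda>\<tau>. increment_sq M X t (t + \<tau>))"
      using * asymp_equiv_trans asymp_equiv_symI by blast
  qed
next
  assume "asymptotically_stationary_increments M X {0<..} (at_right 0)"
  then have "(\<lambda>\<tau>. increment_sq M X 2 (2 + \<tau>)) \<sim>[at_right 0] (\<lambda>\<tau>. increment_sq M X 1 (1 + \<tau>))"
    unfolding asymptotically_stationary_increments_def by simp
  then have "(\<lambda>\<tau>. \<tau> powr (- b - 1) * increment_sq M X 2 (2 + \<tau>)) \<sim>[at_right 0] (\<lambda>\<tau>. \<tau> powr (- b - 1) * increment_sq M X 1 (1 + \<tau>))"
    by (intro asymp_equiv_intros)
  moreover have "((\<lambda>\<tau>. \<tau> powr (- b - 1) * increment_sq M X 1 (1 + \<tau>)) \<longlongrightarrow> 2 / (b + 1)) (at_right 0)"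
    using short_time[of 1] by (cases "a = 0") simp_all
  ultimately have "((\<lambda>\<tau>. \<tau> powr (- b - 1) * increment_sq M X 2 (2 + \<tau>)) \<longlongrightarrow> 2 / (b + 1)) (at_right 0)"
    by (simp add: tendsto_asymp_equiv_cong)
  moreover have "((\<lambda>\<tau>. \<tau> powr (- b - 1) * increment_sq M X 2 (2 + \<tau>)) \<longlongrightarrow> 2 / (b + 1) * (if a = 0 then 1 else 2 powr a)) (at_right 0)"
    using short_time[of 2] by simp
  ultimately have "2 / (b + 1) = 2 / (b + 1) * (if a = 0 then 1 else 2 powr a)"
    by (rule tendsto_unique[rotated]) simp
  then have "a = 0 \<or> 2 powr a = 2 powr (0::real)" using b by (cases "a = 0") simp_all
  then show "a = 0" by (auto simp: powr_inj)
qed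

text \<open>Polarization writes the covariance of two increments from the common time T through
  three squared increments, each with a known limit. The factor (2 / (1 + b))^(1/2) on the limit
  process absorbs the constant of the increment variance.\<close>

lemma fbm_limit:
  fixes N :: "'c measure"
  assumes "fbm N ((1 + b) / 2) Z"
  shows "fdd_converges M (\<lambda>T t \<omega>. T powr (- a / 2) * (X (t + T) \<omega> - X T \<omega>)) at_top
    N (\<lambda>t \<omega>. (2 / (1 + b)) powr (1 / 2) * Z t \<omega>)"
  unfolding fdd_converges_def
proof (intro allI impI, elim conjE)
  fix J :: "real set" and f :: "(real \<Rightarrow> real) \<Rightarrow> real"
  assume J: "finite J" "J \<subseteq> {0..}"
    and f: "continuous_map (product_topology (\<lambda>_. euclideanreal) J) euclideanreal f"
    and bf: "bounded (f ` (\<Pi>\<^sub>E t\<in>J. UNIV))"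
  obtain C where C: "\<And>x. x \<in> (\<Pi>\<^sub>E i\<in>J. UNIV) \<Longrightarrow> \<bar>f x\<bar> \<le> C"
    using bf unfolding bounded_iff by auto
  have cZ: "centered_gaussian_process N (\<lambda>s t. (s powr (1 + b) + t powr (1 + b) - \<bar>s - t\<bar> powr (1 + b)) / 2) Z"
  proof -
    have "2 * ((1 + b) / 2) = 1 + b" by simp
    then show ?thesis using assms unfolding fbm_def by (simp only:)
  qed
  \<comment> \<open>The limit process lives on a probability space of its own and therefore gets a
    Gaussian space of its own.\<close>
  define W where "W = {\<lambda>\<omega>. \<Sum>t\<in>J. c t * Z t \<omega> | J c. finite J \<and> J \<subseteq> {0..}}"
  have W: "gaussian_space N W" and ZW: "\<And>t. t \<ge> 0 \<Longrightarrow> Z t \<in> W"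
    using gaussian_space_span[OF cZ] unfolding W_def by auto
  interpret N: gaussian_space N W by (rule W)
  let ?X = "\<lambda>T t \<omega>. T powr (- a / 2) * (X (t + T) \<omega> - X T \<omega>)"
  let ?Y = "\<lambda>t \<omega>. (2 / (1 + b)) powr (1 / 2) * Z t \<omega>"
  have XT: "?X T t \<in> V" if "t \<in> J" "T \<ge> 0" for T t
    using that J by (intro scale increment_in_V) auto
  have YW: "?Y t \<in> W" if "t \<in> J" for t using that J by (intro N.scale ZW) auto
  have covZ: "(\<integral>\<omega>. ?Y s \<omega> * ?Y t \<omega> \<partial>N) = 1 / (1 + b) * (s powr (1 + b) + t powr (1 + b) - \<bar>s - t\<bar> powr (1 + b))"
    if "s \<in> J" "t \<in> J" for s t
  proof -
    have k: "(2 / (1 + b)) powr (1 / 2) * (2 / (1 + b)) powr (1 / 2) = 2 / (1 + b)"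
      using b by (simp flip: powr_add)
    have "(\<integral>\<omega>. ?Y s \<omega> * ?Y t \<omega> \<partial>N) =
      (\<integral>\<omega>. ((2 / (1 + b)) powr (1 / 2) * (2 / (1 + b)) powr (1 / 2)) * (Z s \<omega> * Z t \<omega>) \<partial>N)"
      by (simp only: ac_simps)
    also have "\<dots> = (\<integral>\<omega>. 2 / (1 + b) * (Z s \<omega> * Z t \<omega>) \<partial>N)" unfolding k ..
    also have "\<dots> = 2 / (1 + b) * ((s powr (1 + b) + t powr (1 + b) - \<bar>s - t\<bar> powr (1 + b)) / 2)"
    proof -
      have "s \<ge> 0" "t \<ge> 0" using that J by auto
      then have "(\<integral>\<omega>. Z s \<omega> * Z t \<omega> \<partial>N) = (s powr (1 + b) + t powr (1 + b) - \<bar>s - t\<bar> powr (1 + b)) / 2"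
        using cZ unfolding centered_gaussian_process_def by blast
      then show ?thesis by (simp only: integral_mult_right_zero)
    qed
    also have "2 / c * (x / 2) = 1 / c * x" for c x :: real by simp
    finally show ?thesis .
  qed
  have lim: "((\<lambda>T. expectation (\<lambda>\<omega>. ?X T s \<omega> * ?X T t \<omega>)) \<longlongrightarrow>
    1 / (1 + b) * (s powr (1 + b) + t powr (1 + b) - \<bar>s - t\<bar> powr (1 + b))) at_top" if st: "0 \<le> s" "s \<le> t" for s t
  proof -
    have e: "((T powr (- a) * increment_sq M X (0 + T) (s + T) + T powr (- a) * increment_sq M X (0 + T) (t + T)) - T powr (- a) * increment_sq M X (s + T) (t + T)) / 2
      = expectation (\<lambda>\<omega>. ?X T s \<omega> * ?X T t \<omega>)" if T: "T > 0" for T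
    proof -
      let ?U = "\<lambda>\<omega>. X (s + T) \<omega> - X T \<omega>" and ?W = "\<lambda>\<omega>. X (t + T) \<omega> - X T \<omega>"
      have UV: "?U \<in> V" "?W \<in> V" using T st by (auto intro!: increment_in_V)
      have inc3: "increment_sq M X (s + T) (t + T) = increment_sq M X (0 + T) (t + T) - 2 * expectation (\<lambda>\<omega>. ?W \<omega> * ?U \<omega>) + increment_sq M X (0 + T) (s + T)"
        using square_diff[OF UV(2,1)] by (simp add: increment_sq_def)
      have alg: "p * E = ((p * i1 + p * i2) - p * i3) / 2" if "i3 = i2 - 2 * E + i1" for p E i1 i2 i3 :: real
        unfolding that by (simp add: algebra_simps)
      have "T powr (- a) * expectation (\<lambda>\<omega>. ?W \<omega> * ?U \<omega>) = ((T powr (- a) * increment_sq M X (0 + T) (s + T) + T powr (- a) * increment_sq M X (0 + T) (t + T)) - T powr (- a) * increment_sq M X (s + T) (t + T)) / 2"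
        by (rule alg[OF inc3])
      moreover have "expectation (\<lambda>\<omega>. ?X T s \<omega> * ?X T t \<omega>) = T powr (- a) * expectation (\<lambda>\<omega>. ?W \<omega> * ?U \<omega>)"
      proof -
        have k: "T powr (- a / 2) * T powr (- a / 2) = T powr (- a)" by (simp flip: powr_add)
        have "expectation (\<lambda>\<omega>. ?X T s \<omega> * ?X T t \<omega>) = expectation (\<lambda>\<omega>. (T powr (- a / 2) * T powr (- a / 2)) * (?W \<omega> * ?U \<omega>))"
          by (simp only: ac_simps)
        then show ?thesis unfolding k by simp
      qed
      ultimately show ?thesis by simp
    qed
    have L1: "((\<lambda>T. ((T powr (- a) * increment_sq M X (0 + T) (s + T) + T powr (- a) * increment_sq M X (0 + T) (t + T)) - T powr (- a) * increment_sq M X (s + T) (t + T)) / 2) \<longlongrightarrow>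
      (2 / (b + 1) * (s - 0) powr (b + 1) + 2 / (b + 1) * (t - 0) powr (b + 1) - 2 / (b + 1) * (t - s) powr (b + 1)) / 2) at_top"
      using st by (intro tendsto_divide[OF tendsto_diff[OF tendsto_add] tendsto_const] shifted_increment_limit) auto
    have L2: "(2 / (b + 1) * (s - 0) powr (b + 1) + 2 / (b + 1) * (t - 0) powr (b + 1) - 2 / (b + 1) * (t - s) powr (b + 1)) / 2
      = 1 / (1 + b) * (s powr (1 + b) + t powr (1 + b) - \<bar>s - t\<bar> powr (1 + b))"
    proof -
      have "(2 / c * x + 2 / c * y - 2 / c * z) / 2 = 1 / c * (x + y - z)" for c x y z :: real
        by (simp add: add_divide_distrib diff_divide_distrib)
      moreover have "\<bar>s - t\<bar> = t - s" using st by simp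
      ultimately show ?thesis by (simp only: add.commute[of b 1] diff_zero)
    qed
    have L3: "\<forall>\<^sub>F T in at_top. ((T powr (- a) * increment_sq M X (0 + T) (s + T) + T powr (- a) * increment_sq M X (0 + T) (t + T)) - T powr (- a) * increment_sq M X (s + T) (t + T)) / 2
      = expectation (\<lambda>\<omega>. ?X T s \<omega> * ?X T t \<omega>)"
      using eventually_gt_at_top[of 0] by eventually_elim (rule e)
    show ?thesis using Lim_transform_eventually[OF L1 L3] unfolding L2 .
  qed
  have cov_lim: "((\<lambda>T. expectation (\<lambda>\<omega>. ?X T s \<omega> * ?X T t \<omega>)) \<longlongrightarrow> (\<integral>\<omega>. ?Y s \<omega> * ?Y t \<omega> \<partial>N)) at_top"
    if "s \<in> J" "t \<in> J" for s t
  proof (cases "s \<le> t")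
    case True
    then show ?thesis using lim[of s t] covZ[OF that] that J by auto
  next
    case False
    have c: "(\<lambda>T. expectation (\<lambda>\<omega>. ?X T t \<omega> * ?X T s \<omega>)) = (\<lambda>T. expectation (\<lambda>\<omega>. ?X T s \<omega> * ?X T t \<omega>))"
      by (intro ext Bochner_Integration.integral_cong refl mult.commute)
    have r: "1 / (1 + b) * (t powr (1 + b) + s powr (1 + b) - \<bar>t - s\<bar> powr (1 + b)) = (\<integral>\<omega>. ?Y s \<omega> * ?Y t \<omega> \<partial>N)"
      unfolding covZ[OF that] by (simp only: add.commute[of "t powr _"] abs_minus_commute[of t s])
    have "0 \<le> t" "t \<le> s" using False that J by auto
    from lim[OF this] show ?thesis unfolding c r .
  qed
  have fm: "f \<in> borel_measurable (Pi\<^sub>M J (\<lambda>_. borel))" by (rule continuous_map_measurable_PiM[OF J(1) f C])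
  have "((\<lambda>T. \<integral>\<omega>. f (\<lambda>i\<in>J. ?X T i \<omega>) \<partial>M) \<longlongrightarrow> (\<integral>\<omega>. f (\<lambda>i\<in>J. ?Y i \<omega>) \<partial>N)) at_top"
  proof (rule gaussian_space_weak_convergence[OF gaussian_space_axioms W J(1) _ YW cov_lim f C])
    show "\<forall>\<^sub>F T in at_top. \<forall>i\<in>J. ?X T i \<in> V"
      using eventually_ge_at_top[of 0] by eventually_elim (use XT in blast)
  qed
  moreover have "(\<integral>\<omega>. f (\<lambda>i\<in>J. ?Y i \<omega>) \<partial>N) = (\<integral>x. f x \<partial>fdd N ?Y J)"
    unfolding fdd_def
    by (rule integral_distr[symmetric, OF measurable_restrict fm]) (use YW N.meas in auto)
  moreover have "\<forall>\<^sub>F T in at_top. (\<integral>\<omega>. f (\<lambda>i\<in>J. ?X T i \<omega>) \<partial>M) = (\<integral>x. f x \<partial>fdd M (?X T) J)"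
    using eventually_ge_at_top[of 0]
  proof eventually_elim
    case (elim T)
    show ?case unfolding fdd_def
      by (rule integral_distr[symmetric, OF measurable_restrict fm]) (use XT[OF _ elim] meas in blast)
  qed
  ultimately show "((\<lambda>T. \<integral>x. f x \<partial>fdd M (?X T) J) \<longlongrightarrow> (\<integral>x. f x \<partial>fdd N ?Y J)) at_top"
    by (simp add: Lim_transform_eventually)
qed

end

section \<open>The semimartingale and Markov properties\<close>

text \<open>A pointwise inequality does the work of Cauchy-Schwarz: Z is at most m / 2 off the event
  and at most (l Z^2 + 1 / l) / 2 on it, the latter by the arithmetic-geometric mean.\<close>

lemma (in prob_space) paley_zygmund:
  fixes Z :: "'a \<Rightarrow> real"
  assumes Z: "Z \<in> borel_measurable M" "\<And>x. 0 \<le> Z x" "integrable M (\<lambda>x. (Z x)\<^sup>2)"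
    and m: "0 < m" "m \<le> expectation Z" and C: "C > 0" "expectation (\<lambda>x. (Z x)\<^sup>2) \<le> C * m\<^sup>2"
  shows "1 / (4 * C) \<le> prob {x\<in>space M. Z x > m / 2}"
proof -
  note [measurable] = Z(1)
  let ?A = "{x\<in>space M. Z x > m / 2}"
  have Zi: "integrable M Z" using Z(1,3) by (rule integrable_of_square)
  \<comment> \<open>Chosen so that l C m^2 = m / 2; integration then leaves m / 2 \<le>
    \<open>prob ?A / l\<close>.\<close>
  define l where "l = 1 / (2 * C * m)"
  have l: "l > 0" using m C by (simp add: l_def)
  have ind: "integrable M (\<lambda>x. indicator ?A x :: real)" by (intro integrable_real_indicator) (auto simp: less_top[symmetric])
  have "Z x \<le> m / 2 + (l * (Z x)\<^sup>2 + indicator ?A x / l) / 2" if "x \<in> space M" for x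
  proof (cases "x \<in> ?A")
    case True
    have "(l * Z x - 1)\<^sup>2 \<ge> 0" by simp
    then have "2 * (l * Z x) \<le> (l * Z x)\<^sup>2 + 1" by (simp add: power2_eq_square algebra_simps)
    then have "2 * Z x \<le> l * (Z x)\<^sup>2 + 1 / l" using l by (simp add: field_simps power2_eq_square)
    moreover have "z \<le> m / 2 + w / 2" if "2 * z \<le> w" for z w :: real using that m(1) by linarith
    ultimately have "Z x \<le> m / 2 + (l * (Z x)\<^sup>2 + 1 / l) / 2" by blast
    then show ?thesis using True by simp
  next
    case False
    then have "Z x \<le> m / 2" using that by auto
    moreover have "0 \<le> l * (Z x)\<^sup>2" using l by simp
    ultimately show ?thesis using False by simp
  qed
  then have "expectation Z \<le> expectation (\<lambda>x. m / 2 + (l * (Z x)\<^sup>2 + indicator ?A x / l) / 2)"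
    using Zi Z(3) ind by (intro integral_mono) auto
  also have "\<dots> = m / 2 + (l * expectation (\<lambda>x. (Z x)\<^sup>2) + prob ?A / l) / 2"
    using Z(3) ind by (simp add: prob_space)
  also have "l * expectation (\<lambda>x. (Z x)\<^sup>2) \<le> l * (C * m\<^sup>2)" using C(2) l by (intro mult_left_mono) auto
  also have "l * (C * m\<^sup>2) = m / 2" using m C by (simp add: l_def power2_eq_square)
  finally have "m \<le> m / 2 + (m / 2 + prob ?A / l) / 2" using m(2) by simp
  moreover have "m / 2 \<le> q" if "m \<le> m / 2 + (m / 2 + q) / 2" for q using that by (simp add: field_simps)
  ultimately have "m / 2 \<le> prob ?A / l" by blast
  then have "m / 2 \<le> prob ?A * (2 * C * m)" by (simp add: l_def)
  then show ?thesis using m C by (simp add: field_simps)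
qed

section \<open>Grid increments and the failure of the semimartingale property\<close>

context weighted_fbm_space
begin

lemma X_measurable: "t \<ge> 0 \<Longrightarrow> X t \<in> borel_measurable M"
  by (intro meas XV)

definition inc :: "nat \<Rightarrow> nat \<Rightarrow> 'a \<Rightarrow> real" where
  "inc n i \<omega> = X (1 + real (Suc i) / real n) \<omega> - X (1 + real i / real n) \<omega>"

lemma inc_in_V: "inc n i \<in> V"
  unfolding inc_def[abs_def] by (intro increment_in_V) (auto intro: add_nonneg_nonneg)

lemma inc_measurable: "inc n i \<in> borel_measurable M"
  by (intro meas inc_in_V)

text \<open>The grid lies in [1, 2], where u^a runs monotonically between 1 and 2^a. The resulting
  bounds hold for either sign of a and stay clear of the behaviour of the weight at 0.\<close>

definition weight_low :: real where "weight_low = min 1 (2 powr a)"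
definition weight_high :: real where "weight_high = max 1 (2 powr a)"

lemma weight_low_pos: "weight_low > 0" and weight_high_pos: "weight_high > 0"
  by (auto simp: weight_low_def weight_high_def)

lemma weight_bounds:
  assumes "1 \<le> u" "u \<le> 2"
  shows "weight_low \<le> u powr a" "u powr a \<le> weight_high"
  using assms powr_mono2[of a 1 u] powr_mono2[of a u 2] powr_mono2'[of a 1 u] powr_mono2'[of a u 2]
  unfolding weight_low_def weight_high_def by (cases "a \<ge> 0"; auto)+

lemma grid:
  assumes "i < n"
  shows "1 \<le> 1 + real i / real n" "1 + real i / real n \<le> 1 + real (Suc i) / real n" "1 + real (Suc i) / real n \<le> 2"
    "(1 + real (Suc i) / real n) - (1 + real i / real n) = 1 / real n"
  using assms by (auto simp: divide_simps)

lemma grid_powr: "c \<ge> 0 \<Longrightarrow> (c / real n) powr (b + 1) = c powr (b + 1) * real n powr (- (1 + b))"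
proof -
  assume c: "c \<ge> 0"
  have "real n powr (- (1 + b)) = 1 / real n powr (b + 1)" by (simp only: powr_minus_divide add.commute[of 1 b])
  moreover have "(c / real n) powr (b + 1) = c powr (b + 1) / real n powr (b + 1)" by (rule powr_divide)
  ultimately show ?thesis by (simp only: times_divide_eq_right mult_1_right)
qed

lemma inc_sq_bounds:
  assumes "i < n"
  shows "2 * weight_low / (b + 1) * real n powr (- (1 + b)) \<le> expectation (\<lambda>\<omega>. (inc n i \<omega>)\<^sup>2)"
    "expectation (\<lambda>\<omega>. (inc n i \<omega>)\<^sup>2) \<le> 2 * weight_high / (b + 1) * real n powr (- (1 + b))"
proof -
  let ?s = "1 + real i / real n" and ?t = "1 + real (Suc i) / real n"
  have p: "(1 / real n) powr (b + 1) = real n powr (- (1 + b))"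
    using grid_powr[of 1 n] by simp
  have "weight_low \<le> u powr a \<and> u powr a \<le> weight_high" if "?s < u" "u < ?t" for u
    using weight_bounds[of u] grid[OF assms] that by auto
  from increment_sq_bounds[OF _ grid(2)[OF assms] this]
  show "2 * weight_low / (b + 1) * real n powr (- (1 + b)) \<le> expectation (\<lambda>\<omega>. (inc n i \<omega>)\<^sup>2)"
    "expectation (\<lambda>\<omega>. (inc n i \<omega>)\<^sup>2) \<le> 2 * weight_high / (b + 1) * real n powr (- (1 + b))"
    unfolding grid(4)[OF assms] p by (auto simp: increment_sq_def inc_def)
qed

text \<open>For b > 0 the kernel difference is nonnegative, so the weight may be replaced by its
  minimum. The remaining integral is exact: a power of 2/n minus twice the same power of 1/n, whence
  the factor 2^(b + 1) - 2.\<close>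

lemma inc_cov_lower:
  assumes "b > 0" "Suc i < n"
  shows "weight_low * (2 powr (b + 1) - 2) / (b + 1) * real n powr (- (1 + b)) \<le> expectation (\<lambda>\<omega>. inc n i \<omega> * inc n (Suc i) \<omega>)"
proof -
  let ?r = "1 + real i / real n" and ?s = "1 + real (Suc i) / real n" and ?t = "1 + real (Suc (Suc i)) / real n"
  have i: "i < n" using assms by simp
  have p: "(1 / real n) powr (b + 1) = real n powr (- (1 + b))"
    using grid_powr[of 1 n] by simp
  have p2: "(2 / real n) powr (b + 1) = 2 powr (b + 1) * real n powr (- (1 + b))"
    using grid_powr[of 2 n] by simp
  have ord: "0 \<le> ?r" "?r < ?s" "?s < ?t" "?s \<le> 2" "1 \<le> ?r" and d: "?t - ?r = 2 / real n" "?t - ?s = 1 / real n" "?s - ?r = 1 / real n"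
    using assms by (auto simp: divide_simps)
  have 1: "set_integrable lborel {?r..?t} (\<lambda>u. (?t - u) powr b)" "(LINT u:{?r..?t}|lborel. (?t - u) powr b) = (2 / real n) powr (b + 1) / (b + 1)"
    "(LINT u:{?s..?t}|lborel. (?t - u) powr b) = (1 / real n) powr (b + 1) / (b + 1)"
    using powr_integral_reflected[of b ?r ?t] powr_integral_reflected[of b ?s ?t] ord b unfolding d by auto
  have 2: "set_integrable lborel {?r..?s} (\<lambda>u. (?s - u) powr b)" "(LINT u:{?r..?s}|lborel. (?s - u) powr b) = (1 / real n) powr (b + 1) / (b + 1)"
    using powr_integral_reflected[of b ?r ?s] ord b unfolding d by auto
  have 3: "set_integrable lborel {?r..?s} (\<lambda>u. (?t - u) powr b)"
    by (rule set_integrable_subset[OF 1(1)]) (use ord in auto)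
  have 4: "(LINT u:{?r..?s}|lborel. (?t - u) powr b) = ((2 / real n) powr (b + 1) - (1 / real n) powr (b + 1)) / (b + 1)"
    using set_integral_split[OF 1(1), of ?s] ord 1(2,3) by (simp add: diff_divide_distrib)
  have 5: "set_integrable lborel {?r..?s} (\<lambda>u. (?t - u) powr b - (?s - u) powr b)"
    by (rule set_integral_diff(1)[OF 3 2(1)])
  have 6: "set_integrable lborel {?r..?s} (\<lambda>u. u powr a * ((?t - u) powr b - (?s - u) powr b))"
    unfolding right_diff_distrib by (intro set_integral_diff(1) wint_integrable[OF a b]) (use ord in auto)
  have "weight_low * (((2 / real n) powr (b + 1) - (1 / real n) powr (b + 1)) / (b + 1) - (1 / real n) powr (b + 1) / (b + 1))
    = (LINT u:{?r..?s}|lborel. weight_low * ((?t - u) powr b - (?s - u) powr b))"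
    using set_integral_diff(2)[OF 3 2(1)] 4 2(2) by simp
  also have "\<dots> \<le> (LINT u:{?r..?s}|lborel. u powr a * ((?t - u) powr b - (?s - u) powr b))"
  proof (rule set_integral_mono_interior[OF _ 6])
    fix u assume u: "?r < u" "u < ?s"
    have "0 \<le> (?t - u) powr b - (?s - u) powr b" using u ord assms(1) by (simp add: powr_mono2)
    moreover have "weight_low \<le> u powr a" by (rule weight_bounds(1); use u ord in linarith)
    ultimately show "weight_low * ((?t - u) powr b - (?s - u) powr b) \<le> u powr a * ((?t - u) powr b - (?s - u) powr b)"
      by (intro mult_right_mono)
  qed (use 5 in simp)
  also have "\<dots> = increment_cov M X ?r ?s ?s ?t"
    using increment_cov_eq[of ?r ?s ?s ?t] wint_diff(1)[OF a b, of ?r ?s ?s ?t] ord by simp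
  also have "\<dots> = expectation (\<lambda>\<omega>. inc n i \<omega> * inc n (Suc i) \<omega>)"
    unfolding increment_cov_def inc_def by (simp add: mult.commute)
  finally show ?thesis unfolding p p2 by (simp add: algebra_simps diff_divide_distrib)
qed

text \<open>Choosing the sign of each new term by the sign of its covariance with the partial sum.\<close>

lemma signs_exist:
  fixes n :: nat
  assumes "\<And>i. D i \<in> V"
  shows "\<exists>h. (\<forall>i. \<bar>h i\<bar> \<le> 1) \<and> (\<Sum>i<n. expectation (\<lambda>\<omega>. (D i \<omega>)\<^sup>2)) \<le> expectation (\<lambda>\<omega>. (\<Sum>i<n. h i * D i \<omega>)\<^sup>2)"
proof (induction n)
  case 0
  show ?case by (intro exI[of _ "\<lambda>_. 0"]) simp
next
  case (Suc n)
  then obtain h where h: "\<forall>i. \<bar>h i\<bar> \<le> 1" "(\<Sum>i<n. expectation (\<lambda>\<omega>. (D i \<omega>)\<^sup>2)) \<le> expectation (\<lambda>\<omega>. (\<Sum>i<n. h i * D i \<omega>)\<^sup>2)"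
    by blast
  let ?S = "\<lambda>\<omega>. \<Sum>i<n. h i * D i \<omega>"
  have SV: "?S \<in> V" using assms by (intro sum scale)
  define e :: real where "e = (if expectation (\<lambda>\<omega>. ?S \<omega> * D n \<omega>) \<ge> 0 then 1 else -1)"
  have "expectation (\<lambda>\<omega>. (?S \<omega> + e * D n \<omega>)\<^sup>2) = expectation (\<lambda>\<omega>. (?S \<omega>)\<^sup>2) + 2 * expectation (\<lambda>\<omega>. ?S \<omega> * (e * D n \<omega>)) + expectation (\<lambda>\<omega>. (e * D n \<omega>)\<^sup>2)"
    by (rule square_sum[OF SV scale[OF assms]])
  also have "expectation (\<lambda>\<omega>. (e * D n \<omega>)\<^sup>2) = expectation (\<lambda>\<omega>. (D n \<omega>)\<^sup>2)" by (simp add: e_def power_mult_distrib)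
  also have "expectation (\<lambda>\<omega>. ?S \<omega> * (e * D n \<omega>)) = e * expectation (\<lambda>\<omega>. ?S \<omega> * D n \<omega>)"
    by (simp add: mult.left_commute[of _ e])
  finally have eq: "expectation (\<lambda>\<omega>. (?S \<omega> + e * D n \<omega>)\<^sup>2) = expectation (\<lambda>\<omega>. (?S \<omega>)\<^sup>2) + 2 * (e * expectation (\<lambda>\<omega>. ?S \<omega> * D n \<omega>)) + expectation (\<lambda>\<omega>. (D n \<omega>)\<^sup>2)" .
  have "0 \<le> e * expectation (\<lambda>\<omega>. ?S \<omega> * D n \<omega>)" by (simp add: e_def)
  then have "expectation (\<lambda>\<omega>. (?S \<omega>)\<^sup>2) + expectation (\<lambda>\<omega>. (D n \<omega>)\<^sup>2) \<le> expectation (\<lambda>\<omega>. (?S \<omega> + e * D n \<omega>)\<^sup>2)"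
    unfolding eq by simp
  moreover have "(\<Sum>i<Suc n. (h(n := e)) i * D i \<omega>) = ?S \<omega> + e * D n \<omega>" for \<omega> by simp
  ultimately show ?case using h by (intro exI[of _ "h(n := e)"]) (auto simp: e_def)
qed

text \<open>The signed sum is Gaussian with fourth moment 3 v^2, so the second moment argument
  applies to its square with C = 3 and gives the probability 1/12, whatever n. It remains to take n
  so large that v \<ge> 2 K^2.\<close>

lemma not_good_integrator_neg:
  assumes "b < 0" and K: "K > 0"
  shows "\<exists>n>0. \<exists>h. (\<forall>i. \<bar>h i\<bar> \<le> 1) \<and> prob {\<omega>\<in>space M. \<bar>\<Sum>i<n. h i * inc n i \<omega>\<bar> > K} \<ge> 1 / 12"
proof -
  define c where "c = 2 * weight_low / (b + 1)"
  have c: "c > 0" using weight_low_pos b by (simp add: c_def)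
  have "filterlim (\<lambda>n. c * real n powr (- b)) at_top sequentially"
    using c assms(1) by real_asymp
  then have "\<forall>\<^sub>F n in sequentially. c * real n powr (- b) \<ge> 2 * K\<^sup>2 \<and> n > 0"
    using eventually_gt_at_top[of "0::nat"] by (auto simp: filterlim_at_top eventually_conj_iff)
  from eventually_happens'[OF sequentially_bot this] obtain n where "c * real n powr (- b) \<ge> 2 * K\<^sup>2 \<and> n > 0" ..
  then have n: "c * real n powr (- b) \<ge> 2 * K\<^sup>2" "n > 0" by auto
  obtain h where h: "\<forall>i. \<bar>h i\<bar> \<le> 1" "(\<Sum>i<n. expectation (\<lambda>\<omega>. (inc n i \<omega>)\<^sup>2)) \<le> expectation (\<lambda>\<omega>. (\<Sum>i<n. h i * inc n i \<omega>)\<^sup>2)"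
    using signs_exist[of "inc n" n] inc_in_V by blast
  define S where "S \<omega> = (\<Sum>i<n. h i * inc n i \<omega>)" for \<omega>
  have SV: "S \<in> V" unfolding S_def[abs_def] by (intro sum scale inc_in_V)
  define v where "v = expectation (\<lambda>\<omega>. (S \<omega>)\<^sup>2)"
  have "c * real n powr (- b) = (\<Sum>i<n. c * real n powr (- (1 + b)))"
  proof -
    have "real n * real n powr (- (1 + b)) = real n powr (1 + - (1 + b))" using n by (subst powr_add) simp
    then show ?thesis by (simp add: mult.left_commute)
  qed
  also have "\<dots> \<le> (\<Sum>i<n. expectation (\<lambda>\<omega>. (inc n i \<omega>)\<^sup>2))"
    unfolding c_def by (intro sum_mono inc_sq_bounds(1)) auto
  also have "\<dots> \<le> v" using h(2) by (simp add: v_def S_def)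
  finally have v: "v \<ge> 2 * K\<^sup>2" using n by simp
  have v0: "v > 0" using v K by (smt (verit) zero_less_power)
  have "1 / (4 * 3) \<le> prob {\<omega>\<in>space M. (S \<omega>)\<^sup>2 > v / 2}"
  proof (rule paley_zygmund[OF _ _ _ v0])
    show "(\<lambda>\<omega>. (S \<omega>)\<^sup>2) \<in> borel_measurable M" using meas[OF SV] by simp
    show "integrable M (\<lambda>\<omega>. ((S \<omega>)\<^sup>2)\<^sup>2)" using integrable_power[OF SV, of 4] by (simp flip: power_mult)
    have "expectation (\<lambda>\<omega>. S \<omega> ^ (2 * 2)) = 3 * v\<^sup>2"
      using even_moment[OF SV, of 2] by (simp add: v_def fact_numeral)
    then show "expectation (\<lambda>\<omega>. ((S \<omega>)\<^sup>2)\<^sup>2) \<le> 3 * v\<^sup>2" by (simp flip: power_mult)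
  qed (auto simp: v_def)
  also have "\<dots> \<le> prob {\<omega>\<in>space M. \<bar>S \<omega>\<bar> > K}"
  proof (rule finite_measure_mono)
    show "{\<omega>\<in>space M. (S \<omega>)\<^sup>2 > v / 2} \<subseteq> {\<omega>\<in>space M. \<bar>S \<omega>\<bar> > K}"
    proof safe
      fix \<omega> assume "(S \<omega>)\<^sup>2 > v / 2"
      then have "K\<^sup>2 < \<bar>S \<omega>\<bar>\<^sup>2" using v by simp
      then show "\<bar>S \<omega>\<bar> > K" by (rule power2_less_imp_less) simp
    qed
    show "{\<omega>\<in>space M. \<bar>S \<omega>\<bar> > K} \<in> sets M" using meas[OF SV] by measurable
  qed
  finally show ?thesis using n(2) h(1) unfolding S_def by (intro exI[of _ n] conjI exI[of _ h]) auto
qed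

text \<open>Testing against \<open>sin (inc n i / \<delta>)\<close>, a bounded function of the previous increment.\<close>

lemma pos_predictable_part:
  assumes "b > 0" "n \<ge> 2" and G: "discrete_filtration M G"
    and ad: "\<And>i. inc n i \<in> borel_measurable (G (Suc i))" and that: "Suc i < n"
  shows "expectation (\<lambda>\<omega>. \<bar>real_cond_exp M (G (Suc i)) (inc n (Suc i)) \<omega>\<bar>) \<ge>
      weight_low * (2 powr (b + 1) - 2) / (b + 1) * exp (- (weight_high / (b + 1))) * real n powr (- (1 + b) / 2)"
proof -
  interpret G: discrete_filtration M G by (rule G)
  \<comment> \<open>The order of the standard deviation of an increment: after division by \<delta>
    the variance stays below a constant, so the Gaussian factor exp(- E(U^2) / 2) is bounded below
    uniformly in n.\<close>
  define \<delta> where "\<delta> = real n powr (- (1 + b) / 2)"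
  have d: "\<delta> > 0" using assms(2) by (simp add: \<delta>_def)
  have d2: "\<delta>\<^sup>2 = real n powr (- (1 + b))" using assms(2) by (simp add: \<delta>_def power2_eq_square flip: powr_add)
  let ?U = "\<lambda>\<omega>. (1 / \<delta>) * inc n i \<omega>" and ?W = "inc n (Suc i)"
  have UV: "?U \<in> V" by (intro scale inc_in_V)
  note [measurable] = inc_measurable
  have [measurable]: "inc n i \<in> borel_measurable (G (Suc i))" by (rule ad)
  have "exp (- (weight_high / (b + 1))) \<le> exp (- expectation (\<lambda>\<omega>. (?U \<omega>)\<^sup>2) / 2)"
  proof -
    have "expectation (\<lambda>\<omega>. (?U \<omega>)\<^sup>2) = expectation (\<lambda>\<omega>. (inc n i \<omega>)\<^sup>2) / \<delta>\<^sup>2"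
      by (simp add: power_divide)
    also have "\<dots> \<le> (2 * weight_high / (b + 1) * \<delta>\<^sup>2) / \<delta>\<^sup>2"
      unfolding d2 using inc_sq_bounds(2)[of i n] that by (intro divide_right_mono) auto
    also have "\<dots> = 2 * (weight_high / (b + 1))" using d by simp
    finally have "expectation (\<lambda>\<omega>. (?U \<omega>)\<^sup>2) \<le> 2 * (weight_high / (b + 1))" .
    then have "- (weight_high / (b + 1)) \<le> - expectation (\<lambda>\<omega>. (?U \<omega>)\<^sup>2) / 2" by linarith
    then show ?thesis by (rule exp_mono)
  qed
  moreover have "weight_low * (2 powr (b + 1) - 2) / (b + 1) * \<delta> \<le> expectation (\<lambda>\<omega>. ?U \<omega> * ?W \<omega>)"
  proof -
    have "expectation (\<lambda>\<omega>. ?U \<omega> * ?W \<omega>) = expectation (\<lambda>\<omega>. inc n i \<omega> * ?W \<omega>) / \<delta>"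
      by (simp add: mult.assoc)
    also have "\<dots> \<ge> weight_low * (2 powr (b + 1) - 2) / (b + 1) * \<delta>\<^sup>2 / \<delta>"
      unfolding d2 using inc_cov_lower[OF assms(1) that] d by (intro divide_right_mono) auto
    finally show ?thesis using d by (simp add: power2_eq_square)
  qed
  moreover have "0 \<le> weight_low * (2 powr (b + 1) - 2) / (b + 1) * \<delta>"
  proof -
    have "2 powr 1 \<le> 2 powr (b + 1)" using assms(1) by (intro powr_mono) auto
    then show ?thesis using weight_low_pos b d by simp
  qed
  ultimately have "weight_low * (2 powr (b + 1) - 2) / (b + 1) * \<delta> * exp (- (weight_high / (b + 1))) \<le> expectation (\<lambda>\<omega>. ?U \<omega> * ?W \<omega>) * exp (- expectation (\<lambda>\<omega>. (?U \<omega>)\<^sup>2) / 2)"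
    by (intro mult_mono) auto
  \<comment> \<open>Gaussian integration by parts turns the covariance into the expectation of the
    new increment against a bounded variable that is known at step \<open>Suc i\<close>; there the
    increment may be replaced by its conditional expectation.\<close>
  also have "\<dots> = expectation (\<lambda>\<omega>. ?W \<omega> * sin (?U \<omega>))" by (rule expectation_mult_sin[OF UV inc_in_V, symmetric])
  also have "\<dots> = expectation (\<lambda>\<omega>. sin (?U \<omega>) * ?W \<omega>)" by (simp add: mult.commute)
  also have "\<dots> = expectation (\<lambda>\<omega>. sin (?U \<omega>) * real_cond_exp M (G (Suc i)) ?W \<omega>)"
  proof (rule G.CE_intg(2)[symmetric])
    show "integrable M (\<lambda>\<omega>. sin (?U \<omega>) * ?W \<omega>)"
      by (rule Bochner_Integration.integrable_bound[OF integrable_single[OF inc_in_V, of n "Suc i"]])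
        (auto simp: abs_mult intro!: mult_left_le_one_le)
  qed auto
  also have "\<dots> \<le> expectation (\<lambda>\<omega>. \<bar>real_cond_exp M (G (Suc i)) ?W \<omega>\<bar>)"
  proof (rule integral_mono)
    have i: "integrable M (real_cond_exp M (G (Suc i)) ?W)" by (rule G.CE_int(1)[OF integrable_single[OF inc_in_V]])
    then show "integrable M (\<lambda>\<omega>. \<bar>real_cond_exp M (G (Suc i)) ?W \<omega>\<bar>)" by simp
    show "integrable M (\<lambda>\<omega>. sin (?U \<omega>) * real_cond_exp M (G (Suc i)) ?W \<omega>)"
      by (rule Bochner_Integration.integrable_bound[OF i])
        (auto simp: abs_mult intro!: mult_left_le_one_le)
    show "sin (?U \<omega>) * real_cond_exp M (G (Suc i)) ?W \<omega> \<le> \<bar>real_cond_exp M (G (Suc i)) ?W \<omega>\<bar>" for \<omega>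
    proof -
      have "sin (?U \<omega>) * real_cond_exp M (G (Suc i)) ?W \<omega> \<le> \<bar>sin (?U \<omega>)\<bar> * \<bar>real_cond_exp M (G (Suc i)) ?W \<omega>\<bar>"
        unfolding abs_mult[symmetric] by (rule abs_ge_self)
      also have "\<dots> \<le> \<bar>real_cond_exp M (G (Suc i)) ?W \<omega>\<bar>" by (intro mult_left_le_one_le) auto
      finally show ?thesis .
    qed
  qed
  finally show ?thesis by (simp add: \<delta>_def mult.assoc mult.commute[of "real n powr _"])
qed

text \<open>The integral equals Z + R, with Z the sum of the absolute conditional means and R the
  compensated transform. Z exceeds half of the bound m for its mean with probability at least 1 / (4
  C), while |R| reaches K0 with probability at most 1 / (16 C); neither C nor K0 depends on n, but m
  is unbounded.\<close>

lemma not_good_integrator_pos: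
  assumes "b > 0" and sub: "\<And>t. subalgebra M (F t)"
    and mono: "\<And>s t. 0 \<le> s \<Longrightarrow> s \<le> t \<Longrightarrow> subalgebra (F t) (F s)"
    and ad: "\<And>t. t \<ge> 0 \<Longrightarrow> X t \<in> borel_measurable (F t)"
  shows "\<exists>e>0. \<forall>K>0. \<exists>n>0. \<exists>H. (\<forall>i. H i \<in> borel_measurable (F (1 + real i / real n))) \<and> (\<forall>i x. \<bar>H i x\<bar> \<le> 1) \<and>
    prob {x\<in>space M. \<bar>\<Sum>i<n. H i x * inc n i x\<bar> > K} > e"
proof -
  define c0 where "c0 = weight_low * (2 powr (b + 1) - 2) / (b + 1) * exp (- (weight_high / (b + 1)))"
  define c2 where "c2 = 2 * weight_high / (b + 1)"
  have "2 powr 1 < 2 powr (b + 1)" using assms(1) by (intro powr_less_mono) auto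
  then have c0: "c0 > 0" using weight_low_pos b by (simp add: c0_def)
  have c2: "c2 > 0" using weight_high_pos b by (simp add: c2_def)
  \<comment> \<open>With \<delta> = n^(- (1 + b) / 2), this is the ratio of the bound c2 n^2
    \<delta>^2 for E(Z^2) to the square of m = (n - 1) c0 \<delta>; the factor 4 comes from n \<le>
    2 (n - 1).\<close>
  define C where "C = 4 * c2 / c0\<^sup>2"
  have C: "C > 0" using c0 c2 by (simp add: C_def)
  \<comment> \<open>Makes the Markov bound c2 / K0^2 equal to 1 / (16 C), a quarter of the
    probability obtained for Z; the difference still exceeds 1 / (8 C).\<close>
  define K0 where "K0 = sqrt (16 * C * c2)"
  have K0: "K0 > 0" "K0\<^sup>2 = 16 * C * c2" using C c2 by (auto simp: K0_def)
  show ?thesis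
  proof (intro exI[of _ "1 / (8 * C)"] conjI allI impI)
    show "1 / (8 * C) > 0" using C by simp
    fix K :: real assume K: "K > 0"
    have "filterlim (\<lambda>n. (real n - 1) * c0 * real n powr (- (1 + b) / 2)) at_top sequentially"
    proof -
      have "filterlim (\<lambda>n. (real n - 1) * c0 * real n powr (- p)) at_top sequentially" if "p < 1" for p
        using c0 that by real_asymp
      moreover have "(1 + b) / 2 < 1" using b1 by simp
      ultimately have "filterlim (\<lambda>n. (real n - 1) * c0 * real n powr (- ((1 + b) / 2))) at_top sequentially" .
      then show ?thesis unfolding minus_divide_left .
    qed
    then have "\<forall>\<^sub>F n in sequentially. (real n - 1) * c0 * real n powr (- (1 + b) / 2) \<ge> 2 * (K + K0) \<and> n \<ge> 2"
      using eventually_ge_at_top[of "2::nat"] by (auto simp: filterlim_at_top eventually_conj_iff)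
    from eventually_happens'[OF sequentially_bot this] obtain n where "(real n - 1) * c0 * real n powr (- (1 + b) / 2) \<ge> 2 * (K + K0) \<and> n \<ge> 2" ..
    then have n: "(real n - 1) * c0 * real n powr (- (1 + b) / 2) \<ge> 2 * (K + K0)" "n \<ge> 2" by auto
    define g where "g i = 1 + real i / real n" for i
    have g0: "g i \<ge> 0" for i by (simp add: g_def)
    have gm: "i \<le> j \<Longrightarrow> g i \<le> g j" for i j by (simp add: g_def divide_right_mono)
    interpret G: discrete_filtration M "\<lambda>i. F (g i)"
      by standard (auto intro: sub mono g0 gm)
    have incF: "inc n i \<in> borel_measurable (F (g (Suc i)))" for i
    proof -
      have "X (g i) \<in> borel_measurable (F (g (Suc i)))"
        using G.G_meas_mono[OF ad[OF g0], of i "Suc i"] by simp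
      moreover have "X (g (Suc i)) \<in> borel_measurable (F (g (Suc i)))" by (rule ad[OF g0])
      ultimately show ?thesis unfolding inc_def[abs_def] g_def[symmetric] by (rule borel_measurable_diff[rotated])
    qed
    define P where "P i = real_cond_exp M (F (g i)) (inc n i)" for i
    \<comment> \<open>The sign of the conditional mean is known at the left end of the grid
      interval, which makes H an admissible integrand and turns the predictable part of the sum into
      Z.\<close>
    define H where "H i x = sgn (P i x)" for i x
    have PF: "P i \<in> borel_measurable (F (g i))" for i unfolding P_def by simp
    have PM[measurable]: "P i \<in> borel_measurable M" for i unfolding P_def by simp
    have HF: "H i \<in> borel_measurable (F (g i))" for i using PF[of i] unfolding H_def[abs_def] by measurable
    have H1: "\<bar>H i x\<bar> \<le> 1" for i x by (simp add: H_def abs_sgn_eq)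
    have HM[measurable]: "H i \<in> borel_measurable M" for i using HF by (rule G.G_meas)
    note [measurable] = inc_measurable
    have i2: "integrable M (\<lambda>x. (inc n i x)\<^sup>2)" for i by (rule integrable_power[OF inc_in_V])
    have P2: "integrable M (\<lambda>x. (P i x)\<^sup>2)" "expectation (\<lambda>x. (P i x)\<^sup>2) \<le> expectation (\<lambda>x. (inc n i x)\<^sup>2)" for i
      unfolding P_def using G.CE_square[OF inc_measurable i2] by auto
    have P1: "integrable M (\<lambda>x. \<bar>P i x\<bar>)" for i
      using integrable_of_square[OF PM P2(1), of i] by simp
    define \<delta>2 where "\<delta>2 = real n powr (- (1 + b))"
    have d: "(real n powr (- (1 + b) / 2))\<^sup>2 = \<delta>2" using n(2) by (simp add: \<delta>2_def power2_eq_square flip: powr_add)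
    have Db: "expectation (\<lambda>x. (inc n i x)\<^sup>2) \<le> c2 * \<delta>2" if "i < n" for i
      using inc_sq_bounds(2)[OF that] by (simp add: c2_def \<delta>2_def)
    define m where "m = (real n - 1) * c0 * real n powr (- (1 + b) / 2)"
    have m: "m \<ge> 2 * (K + K0)" using n by (simp add: m_def)
    have "0 < 2 * (K + K0)" using K K0(1) by simp
    then have m0: "m > 0" using m by (rule less_le_trans)
    define Z where "Z x = (\<Sum>i<n. \<bar>P i x\<bar>)" for x
    have Zm[measurable]: "Z \<in> borel_measurable M" unfolding Z_def[abs_def] by measurable
    have Z2b: "(Z x)\<^sup>2 \<le> real n * (\<Sum>i<n. (P i x)\<^sup>2)" for x
    proof -
      have "(\<Sum>i<n. 1 * \<bar>P i x\<bar>)\<^sup>2 \<le> (\<Sum>i<n. 1\<^sup>2) * (\<Sum>i<n. \<bar>P i x\<bar>\<^sup>2)" by (rule Cauchy_Schwarz_ineq_sum)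
      then show ?thesis by (simp add: Z_def)
    qed
    have Z2i: "integrable M (\<lambda>x. (Z x)\<^sup>2)"
      by (rule Bochner_Integration.integrable_bound[of _ "\<lambda>x. real n * (\<Sum>i<n. (P i x)\<^sup>2)"])
        (use P2(1) Z2b in \<open>auto simp: sum_nonneg\<close>)
    have "expectation (\<lambda>x. (Z x)\<^sup>2) \<le> expectation (\<lambda>x. real n * (\<Sum>i<n. (P i x)\<^sup>2))"
      using P2(1) by (intro integral_mono Z2i Z2b) auto
    also have "\<dots> = real n * (\<Sum>i<n. expectation (\<lambda>x. (P i x)\<^sup>2))" using P2(1) by simp
    also have "\<dots> \<le> real n * (\<Sum>i<n. c2 * \<delta>2)"
      using P2(2) Db by (intro mult_left_mono sum_mono) (auto intro: order_trans)
    also have "\<dots> = c2 * \<delta>2 * (real n)\<^sup>2" by (simp add: power2_eq_square)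
    also have "\<dots> \<le> c2 * \<delta>2 * (2 * (real n - 1))\<^sup>2"
      using n(2) c2 by (intro mult_left_mono power_mono) (auto simp: \<delta>2_def)
    also have "\<dots> = C * m\<^sup>2"
      using c0 unfolding m_def power_mult_distrib d by (simp add: C_def field_simps)
    finally have EZ2: "expectation (\<lambda>x. (Z x)\<^sup>2) \<le> C * m\<^sup>2" .
    \<comment> \<open>The first increment has no predecessor on the grid to be tested against, so
      the lower bound collects n - 1 terms; the term for index 0 enters as a nonnegative
      one.\<close>
    have "m \<le> (\<Sum>i<n - 1. expectation (\<lambda>x. \<bar>P (Suc i) x\<bar>))"
    proof -
      have "(\<Sum>i<n - 1. c0 * real n powr (- (1 + b) / 2)) \<le> (\<Sum>i<n - 1. expectation (\<lambda>x. \<bar>P (Suc i) x\<bar>))"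
      proof (intro sum_mono)
        fix i assume "i \<in> {..<n - 1}"
        then show "c0 * real n powr (- (1 + b) / 2) \<le> expectation (\<lambda>x. \<bar>P (Suc i) x\<bar>)"
          using pos_predictable_part[OF assms(1) n(2) G.discrete_filtration_axioms incF, of i]
          by (simp add: P_def c0_def)
      qed
      then show ?thesis using n(2) by (simp add: m_def of_nat_diff mult.assoc)
    qed
    also have "\<dots> \<le> expectation (\<lambda>x. \<bar>P 0 x\<bar>) + (\<Sum>i<n - 1. expectation (\<lambda>x. \<bar>P (Suc i) x\<bar>))" by simp
    also have "\<dots> = (\<Sum>i<Suc (n - 1). expectation (\<lambda>x. \<bar>P i x\<bar>))" by (rule sum.lessThan_Suc_shift[symmetric])
    also have "Suc (n - 1) = n" using n(2) by simp
    also have "(\<Sum>i<n. expectation (\<lambda>x. \<bar>P i x\<bar>)) = expectation Z"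
      unfolding Z_def[abs_def] using P1 by (intro Bochner_Integration.integral_sum[symmetric])
    finally have EZ: "m \<le> expectation Z" .
    have pz: "1 / (4 * C) \<le> prob {x\<in>space M. Z x > m / 2}"
      by (rule paley_zygmund[OF Zm _ Z2i m0 EZ C EZ2]) (simp add: Z_def sum_nonneg)
    define R where "R x = (\<Sum>i<n. H i x * (inc n i x - P i x))" for x
    have Rm[measurable]: "R \<in> borel_measurable M" unfolding R_def[abs_def] by measurable
    have R2: "integrable M (\<lambda>x. (R x)\<^sup>2)" "expectation (\<lambda>x. (R x)\<^sup>2) \<le> (\<Sum>i<n. expectation (\<lambda>x. (inc n i x)\<^sup>2))"
      using G.martingale_transform_square(2,3)[OF incF i2 HF H1, of n] unfolding R_def P_def by auto
    have "(\<Sum>i<n. expectation (\<lambda>x. (inc n i x)\<^sup>2)) \<le> (\<Sum>i<n. c2 * \<delta>2)" by (intro sum_mono Db) auto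
    also have "\<dots> = c2 * (real n * \<delta>2)" by simp
    also have "real n * \<delta>2 = real n powr (- b)"
      using n(2) powr_add[of "real n" 1 "- (1 + b)"] by (simp add: \<delta>2_def)
    also have "c2 * real n powr (- b) \<le> c2 * 1"
    proof (intro mult_left_mono)
      have "real n powr (- b) \<le> real n powr 0" using n(2) assms(1) by (intro powr_mono) auto
      then show "real n powr (- b) \<le> 1" using n(2) by simp
    qed (use c2 in auto)
    finally have ER: "expectation (\<lambda>x. (R x)\<^sup>2) \<le> c2" using R2(2) by simp
    have "prob {x\<in>space M. (R x)\<^sup>2 \<ge> K0\<^sup>2} \<le> expectation (\<lambda>x. (R x)\<^sup>2) / K0\<^sup>2"
      by (rule integral_Markov_inequality_measure[where A = "{}", OF R2(1)]) (use zero_less_power[OF K0(1), of 2] in auto)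
    also have "\<dots> \<le> c2 / K0\<^sup>2" using ER by (intro divide_right_mono) auto
    also have "\<dots> = 1 / (16 * C)" unfolding K0(2) using C c2 by simp
    finally have PR: "prob {x\<in>space M. (R x)\<^sup>2 \<ge> K0\<^sup>2} \<le> 1 / (16 * C)" .
    have "{x\<in>space M. Z x > m / 2} \<subseteq> {x\<in>space M. \<bar>\<Sum>i<n. H i x * inc n i x\<bar> > K} \<union> {x\<in>space M. (R x)\<^sup>2 \<ge> K0\<^sup>2}"
    proof (intro subsetI, rule ccontr)
      fix x assume x: "x \<in> {x\<in>space M. Z x > m / 2}"
        and nx: "x \<notin> {x\<in>space M. \<bar>\<Sum>i<n. H i x * inc n i x\<bar> > K} \<union> {x\<in>space M. (R x)\<^sup>2 \<ge> K0\<^sup>2}"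
      then have "(R x)\<^sup>2 < K0\<^sup>2" and S: "\<bar>\<Sum>i<n. H i x * inc n i x\<bar> \<le> K" and Zx: "Z x > m / 2" by (auto simp: not_le not_less)
      then have Rx: "\<bar>R x\<bar> < K0" using power2_less_imp_less[of "\<bar>R x\<bar>" K0] K0 by simp
      have "(\<Sum>i<n. H i x * inc n i x) = (\<Sum>i<n. \<bar>P i x\<bar> + H i x * (inc n i x - P i x))"
      proof (intro sum.cong refl)
        fix i
        have "\<bar>P i x\<bar> = H i x * P i x" unfolding H_def by (simp add: abs_sgn mult.commute)
        then show "H i x * inc n i x = \<bar>P i x\<bar> + H i x * (inc n i x - P i x)" by (simp add: right_diff_distrib)
      qed
      also have "\<dots> = Z x + R x" by (simp add: sum.distrib Z_def R_def)
      finally have SZ: "(\<Sum>i<n. H i x * inc n i x) = Z x + R x" .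
      have False if "s = z + r" "\<bar>s\<bar> \<le> k" "\<bar>r\<bar> < k0" "m' / 2 < z" "2 * (k + k0) \<le> m'" for s z r k k0 m' :: real
        using that unfolding distrib_left by linarith
      from this[OF SZ S Rx Zx m] show False .
    qed
    then have "prob {x\<in>space M. Z x > m / 2} \<le> prob ({x\<in>space M. \<bar>\<Sum>i<n. H i x * inc n i x\<bar> > K} \<union> {x\<in>space M. (R x)\<^sup>2 \<ge> K0\<^sup>2})"
      by (intro finite_measure_mono) auto
    also have "\<dots> \<le> prob {x\<in>space M. \<bar>\<Sum>i<n. H i x * inc n i x\<bar> > K} + prob {x\<in>space M. (R x)\<^sup>2 \<ge> K0\<^sup>2}"
      by (intro measure_Un_le) auto
    finally have "1 / (4 * C) - 1 / (16 * C) \<le> prob {x\<in>space M. \<bar>\<Sum>i<n. H i x * inc n i x\<bar> > K}" using pz PR by linarith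
    moreover have "1 / (8 * C) < 1 / (4 * C) - 1 / (16 * C)" using C by (simp add: field_simps)
    ultimately have "1 / (8 * C) < prob {x\<in>space M. \<bar>\<Sum>i<n. H i x * inc n i x\<bar> > K}" by linarith
    then show "\<exists>n>0. \<exists>H. (\<forall>i. H i \<in> borel_measurable (F (1 + real i / real n))) \<and> (\<forall>i x. \<bar>H i x\<bar> \<le> 1) \<and>
      prob {x\<in>space M. \<bar>\<Sum>i<n. H i x * inc n i x\<bar> > K} > 1 / (8 * C)"
      using n(2) HF H1 unfolding g_def by (intro exI[of _ n] conjI exI[of _ H]) auto
  qed
qed

text \<open>The contradiction uses integrands adapted to F and nothing else about the filtration, so
  the natural filtration and its usual augmentation are covered by one argument.\<close>

lemma not_semimartingale:
  assumes "b \<noteq> 0" and sub: "\<And>t. subalgebra M (F t)"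
    and mono: "\<And>s t. 0 \<le> s \<Longrightarrow> s \<le> t \<Longrightarrow> subalgebra (F t) (F s)"
    and ad: "\<And>t. t \<ge> 0 \<Longrightarrow> X t \<in> borel_measurable (F t)"
  shows "\<not> semimartingale M F X"
proof
  assume sm: "semimartingale M F X"
  have "\<exists>e>0. \<forall>K>0. \<exists>n>0. \<exists>H. (\<forall>i. H i \<in> borel_measurable (F (1 + real i / real n))) \<and> (\<forall>i x. \<bar>H i x\<bar> \<le> 1) \<and>
    prob {x\<in>space M. \<bar>\<Sum>i<n. H i x * inc n i x\<bar> > K} > e"
  proof (cases "b > 0")
    case True
    show ?thesis by (rule not_good_integrator_pos[OF True sub mono ad])
  next
    case False
    then have "b < 0" using assms(1) by simp
    show ?thesis
    proof (intro exI[of _ "1 / 24"] conjI allI impI)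
      fix K :: real assume "K > 0"
      from not_good_integrator_neg[OF \<open>b < 0\<close> this] obtain n h where
        "n > 0" "\<forall>i. \<bar>h i\<bar> \<le> 1" "prob {\<omega>\<in>space M. \<bar>\<Sum>i<n. h i * inc n i \<omega>\<bar> > K} \<ge> 1 / 12"
        by (elim exE conjE) (rule that)
      then show "\<exists>n>0. \<exists>H. (\<forall>i. H i \<in> borel_measurable (F (1 + real i / real n))) \<and> (\<forall>i x. \<bar>H i x\<bar> \<le> 1) \<and>
        prob {x\<in>space M. \<bar>\<Sum>i<n. H i x * inc n i x\<bar> > K} > 1 / 24"
        by (intro exI[of _ n] conjI exI[of _ "\<lambda>i _. h i"]) auto
    qed simp
  qed
  then obtain e where e: "e > 0" and bad: "\<And>K. K > 0 \<Longrightarrow> \<exists>n>0. \<exists>H. (\<forall>i. H i \<in> borel_measurable (F (1 + real i / real n))) \<and> (\<forall>i x. \<bar>H i x\<bar> \<le> 1) \<and>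
    prob {x\<in>space M. \<bar>\<Sum>i<n. H i x * inc n i x\<bar> > K} > e" by meson
  show False
  proof (rule semimartingale_good_integrator[of F X e])
    show "subalgebra (F t) (F s)" if "0 \<le> s" "s \<le> t" for s t using that by (rule mono)
    show "X t \<in> borel_measurable M" if "t \<ge> 0" for t using that by (rule X_measurable)
  next
    fix K :: real assume K: "K > 0" and good: "\<And>n H. \<lbrakk>n > 0; \<And>i. H i \<in> borel_measurable (F (1 + real i / real n)); \<And>i x. \<bar>H i x\<bar> \<le> 1\<rbrakk> \<Longrightarrow>
      prob {x\<in>space M. \<bar>\<Sum>i<n. H i x * (X (1 + real (Suc i) / real n) x - X (1 + real i / real n) x)\<bar> > K} \<le> e"
    from bad[OF K] obtain n H where "n > 0" "\<forall>i. H i \<in> borel_measurable (F (1 + real i / real n))" "\<forall>i x. \<bar>H i x\<bar> \<le> 1"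
      and gt: "prob {x\<in>space M. \<bar>\<Sum>i<n. H i x * inc n i x\<bar> > K} > e"
      by (elim exE conjE) (rule that)
    then have "prob {x\<in>space M. \<bar>\<Sum>i<n. H i x * inc n i x\<bar> > K} \<le> e"
      unfolding inc_def by (intro good) auto
    with gt show False by simp
  qed (rule sub sm e)+
qed

section \<open>The natural filtration and its usual augmentation\<close>

lemma space_natural_filtration: "space (natural_filtration M X t) = space M"
  unfolding natural_filtration_def by (rule space_measure_of) auto

lemma sets_natural_filtration:
  "sets (natural_filtration M X t) = sigma_sets (space M) (\<Union>s\<in>{0..t}. {X s -` B \<inter> space M | B. B \<in> sets borel})"
  unfolding natural_filtration_def by (rule sets_measure_of) auto

lemma natural_filtration_subalgebra: "subalgebra M (natural_filtration M X t)"
proof -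
  have "(\<Union>s\<in>{0..t}. {X s -` B \<inter> space M | B. B \<in> sets borel}) \<subseteq> sets M"
    using X_measurable by (auto intro: measurable_sets)
  then show ?thesis unfolding subalgebra_def space_natural_filtration sets_natural_filtration
    by (auto intro: sets.sigma_sets_subset[THEN subsetD])
qed

lemma natural_filtration_mono: "s \<le> t \<Longrightarrow> sets (natural_filtration M X s) \<subseteq> sets (natural_filtration M X t)"
  unfolding sets_natural_filtration by (intro sigma_sets_mono' UN_mono) auto

lemma natural_filtration_adapted:
  assumes "0 \<le> s" "s \<le> t"
  shows "X s \<in> borel_measurable (natural_filtration M X t)"
proof (rule measurableI)
  fix B :: "real set" assume "B \<in> sets borel"
  then show "X s -` B \<inter> space (natural_filtration M X t) \<in> sets (natural_filtration M X t)"
    unfolding space_natural_filtration sets_natural_filtration using assms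
    by (intro sigma_sets.Basic UN_I[of s]) auto
qed simp

lemma usual_augmentation_props:
  defines "F \<equiv> usual_augmentation M (natural_filtration M X)"
  shows "subalgebra M (F t)" "s \<le> t \<Longrightarrow> subalgebra (F t) (F s)" "t \<ge> 0 \<Longrightarrow> X t \<in> borel_measurable (F t)"
proof -
  let ?I = "\<lambda>t. \<Inter>s\<in>{t<..}. sigma_sets (space M) (sets (natural_filtration M X s) \<union> null_sets M)"
  have nM: "sigma_sets (space M) (sets (natural_filtration M X s) \<union> null_sets M) \<subseteq> sets M" for s
    using natural_filtration_subalgebra[of s] by (intro sets.sigma_sets_subset) (auto simp: subalgebra_def)
  \<comment> \<open>The index t + 1 is one of those intersected over, so the intersection stays
    inside \<open>sets M\<close>.\<close>
  have IM: "?I t \<subseteq> sets M" for t using nM[of "t + 1"] by (auto dest!: bspec[of _ _ "t + 1"])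
  then have IP: "?I t \<subseteq> Pow (space M)" for t using sets.space_closed by blast
  have sp: "space (F t) = space M" and se: "sets (F t) = sigma_sets (space M) (?I t)" for t
    unfolding F_def usual_augmentation_def by (rule space_measure_of[OF IP], rule sets_measure_of[OF IP])
  show "subalgebra M (F t)"
    unfolding subalgebra_def sp se using IM by (auto intro: sets.sigma_sets_subset[THEN subsetD])
  show "subalgebra (F t) (F s)" if "s \<le> t"
    unfolding subalgebra_def sp se using that by (auto intro!: sigma_sets_mono' INT_anti_mono)
  show "X t \<in> borel_measurable (F t)" if t: "t \<ge> 0"
  proof (rule measurableI)
    fix B :: "real set" assume B: "B \<in> sets borel"
    have "X t -` B \<inter> space M \<in> sigma_sets (space M) (sets (natural_filtration M X s) \<union> null_sets M)" if "t < s" for s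
      using measurable_sets[OF natural_filtration_adapted[of t s] B] t that
      by (intro sigma_sets.Basic) (simp add: space_natural_filtration)
    then show "X t -` B \<inter> space (F t) \<in> sets (F t)" unfolding sp se by (intro sigma_sets.Basic) auto
  qed simp
qed

section \<open>Failure of the Markov property\<close>

lemma orthogonal_to_sigma:
  assumes UW: "U \<in> V" "W \<in> V" and orth: "expectation (\<lambda>\<omega>. U \<omega> * W \<omega>) = 0"
  shows "AE \<omega> in M. real_cond_exp M (vimage_algebra (space M) W borel) U \<omega> = 0"
proof -
  let ?G = "vimage_algebra (space M) W borel"
  note [measurable] = meas[OF UW(1)] meas[OF UW(2)]
  have sub: "subalgebra M ?G"
    unfolding subalgebra_def by (auto simp: sets_vimage_algebra2)
  have S: "sigma_finite_subalgebra M ?G"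
    by (intro finite_measure_subalgebra_is_sigma_finite finite_measure_subalgebra.intro
      finite_measure_subalgebra_axioms.intro sub) (rule finite_measure_axioms)
  show ?thesis
  proof (rule sigma_finite_subalgebra.real_cond_exp_charact[OF S])
    fix A assume "A \<in> sets ?G"
    then obtain B where B: "B \<in> sets borel" "A = W -` B \<inter> space M" by (auto simp: sets_vimage_algebra2)
    \<comment> \<open>The indicator of an event generated by W is a function of W, so the reflection
      of (U, W) into (- U, W) makes the integral vanish.\<close>
    have "(\<integral>\<omega>\<in>A. U \<omega> \<partial>M) = expectation (\<lambda>\<omega>. U \<omega> * indicator B (W \<omega>))"
      unfolding set_lebesgue_integral_def by (intro Bochner_Integration.integral_cong) (auto simp: B indicator_def)
    also have "\<dots> = 0" using B(1) by (intro reflection[OF UW orth]) simp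
    finally show "(\<integral>\<omega>\<in>A. U \<omega> \<partial>M) = (\<integral>\<omega>\<in>A. 0 \<partial>M)" by simp
  qed (use integrable_single[OF UW(1)] in auto)
qed

text \<open>
  The residual \<open>N\<close> of the regression of \<open>X r\<close> on \<open>X s\<close> is orthogonal to all bounded functions of \<open>X s\<close>,
  hence by the Markov property to \<open>sin (X t)\<close>; for Gaussian variables this forces \<open>E(N X\<^sub>t) = 0\<close>.
\<close>

lemma markov_covariance:
  assumes mk: "markov_process M X" and rst: "0 < r" "r < s" "s < t"
  shows "expectation (\<lambda>\<omega>. X r \<omega> * X t \<omega>) * expectation (\<lambda>\<omega>. X s \<omega> * X s \<omega>) =
    expectation (\<lambda>\<omega>. X r \<omega> * X s \<omega>) * expectation (\<lambda>\<omega>. X s \<omega> * X t \<omega>)"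
proof -
  \<comment> \<open>The regression coefficient that makes X r - \<beta> X s orthogonal to X
    s.\<close>
  define \<beta> where "\<beta> = expectation (\<lambda>\<omega>. X r \<omega> * X s \<omega>) / expectation (\<lambda>\<omega>. X s \<omega> * X s \<omega>)"
  have vs: "expectation (\<lambda>\<omega>. X s \<omega> * X s \<omega>) > 0"
    using cov[of s s] wint_pos[OF a b, of 0 s s] rst by simp
  have XV': "X r \<in> V" "X s \<in> V" "X t \<in> V" using rst by (auto intro: XV)
  define N where "N \<omega> = X r \<omega> - \<beta> * X s \<omega>" for \<omega>
  have NV: "N \<in> V" unfolding N_def[abs_def] by (intro diff scale XV')
  note [measurable] = meas[OF XV'(1)] meas[OF XV'(2)] meas[OF XV'(3)] meas[OF NV]
  have NW: "expectation (\<lambda>\<omega>. N \<omega> * W \<omega>) = expectation (\<lambda>\<omega>. X r \<omega> * W \<omega>) - \<beta> * expectation (\<lambda>\<omega>. X s \<omega> * W \<omega>)" if "W \<in> V" for W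
  proof -
    have "expectation (\<lambda>\<omega>. N \<omega> * W \<omega>) = expectation (\<lambda>\<omega>. X r \<omega> * W \<omega> - \<beta> * (X s \<omega> * W \<omega>))"
      by (simp add: N_def algebra_simps)
    then show ?thesis using integrable_product[OF XV'(1) that] integrable_product[OF XV'(2) that] by simp
  qed
  have "expectation (\<lambda>\<omega>. N \<omega> * X s \<omega>) = 0" using NW[OF XV'(2)] vs by (simp add: \<beta>_def)
  from orthogonal_to_sigma[OF NV XV'(2) this]
  have N0: "AE \<omega> in M. real_cond_exp M (vimage_algebra (space M) (X s) borel) N \<omega> = 0" .
  let ?Fs = "natural_filtration M X s" and ?Gs = "vimage_algebra (space M) (X s) borel"
  have subF: "subalgebra M ?Fs" by (rule natural_filtration_subalgebra)
  have subG: "subalgebra M (vimage_algebra (space M) W borel)" if "W \<in> V" for W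
    using meas[OF that] unfolding subalgebra_def by (auto simp: sets_vimage_algebra2 measurable_sets)
  have S: "sigma_finite_subalgebra M G" if "subalgebra M G" for G
    by (intro finite_measure_subalgebra_is_sigma_finite finite_measure_subalgebra.intro
      finite_measure_subalgebra_axioms.intro that) (rule finite_measure_axioms)
  have Ni: "integrable M N" by (rule integrable_single[OF NV])
  \<comment> \<open>N is known at time s, so the indicator may be conditioned on the past; by the
    Markov property this yields a function of X s, and N has conditional mean 0 given X s.\<close>
  have "expectation (\<lambda>\<omega>. N \<omega> * indicator B (X t \<omega>)) = 0" if B[measurable]: "B \<in> sets borel" for B
  proof -
    let ?f = "\<lambda>\<omega>. indicator B (X t \<omega>) :: real"
    define h where "h = real_cond_exp M ?Gs ?f"
    have fi: "integrable M ?f" by (rule integrable_const_bound[of _ 1]) (auto simp: indicator_def)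
    have "X r \<in> borel_measurable ?Fs" "X s \<in> borel_measurable ?Fs"
      using rst by (auto intro!: natural_filtration_adapted)
    then have NF: "N \<in> borel_measurable ?Fs" unfolding N_def[abs_def] by measurable
    have hG: "h \<in> borel_measurable ?Gs" unfolding h_def by simp
    have hM[measurable]: "h \<in> borel_measurable M" unfolding h_def by simp
    have h1: "AE \<omega> in M. \<bar>h \<omega>\<bar> \<le> 1"
    proof -
      have "AE \<omega> in M. 0 \<le> h \<omega>" unfolding h_def
        by (rule sigma_finite_subalgebra.real_cond_exp_pos[OF S[OF subG[OF XV'(2)]]]) (auto simp: indicator_def)
      moreover have "AE \<omega> in M. h \<omega> \<le> 1" unfolding h_def
        by (rule sigma_finite_subalgebra.real_cond_exp_le_c[OF S[OF subG[OF XV'(2)]] fi]) (auto simp: indicator_def)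
      ultimately show ?thesis by eventually_elim auto
    qed
    have mk': "AE \<omega> in M. real_cond_exp M ?Fs ?f \<omega> = h \<omega>"
      using mk rst B unfolding markov_process_def h_def by auto
    have "expectation (\<lambda>\<omega>. N \<omega> * ?f \<omega>) = expectation (\<lambda>\<omega>. N \<omega> * real_cond_exp M ?Fs ?f \<omega>)"
    proof (rule sigma_finite_subalgebra.real_cond_exp_intg(2)[OF S[OF subF], symmetric])
      show "integrable M (\<lambda>\<omega>. N \<omega> * ?f \<omega>)"
        by (rule Bochner_Integration.integrable_bound[OF Ni]) (auto simp: indicator_def)
    qed (use NF in auto)
    also have "\<dots> = expectation (\<lambda>\<omega>. h \<omega> * N \<omega>)"
      using mk' by (intro integral_cong_AE) auto
    also have "\<dots> = expectation (\<lambda>\<omega>. h \<omega> * real_cond_exp M ?Gs N \<omega>)"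
    proof (rule sigma_finite_subalgebra.real_cond_exp_intg(2)[OF S[OF subG[OF XV'(2)]], symmetric])
      show "integrable M (\<lambda>\<omega>. h \<omega> * N \<omega>)"
      proof (rule Bochner_Integration.integrable_bound[OF Ni])
        show "AE \<omega> in M. norm (h \<omega> * N \<omega>) \<le> norm (N \<omega>)"
          using h1 by eventually_elim (auto simp: abs_mult intro!: mult_left_le_one_le)
      qed simp
    qed (use hG in auto)
    also have "\<dots> = expectation (\<lambda>_. 0)" using N0 by (intro integral_cong_AE) auto
    finally show ?thesis by simp
  qed
  note ind0 = this
  have "AE \<omega> in M. real_cond_exp M (vimage_algebra (space M) (X t) borel) N \<omega> = 0"
  proof (rule sigma_finite_subalgebra.real_cond_exp_charact[OF S[OF subG[OF XV'(3)]]])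
    fix A assume "A \<in> sets (vimage_algebra (space M) (X t) borel)"
    then obtain B where B: "B \<in> sets borel" "A = X t -` B \<inter> space M" by (auto simp: sets_vimage_algebra2)
    have "(\<integral>\<omega>\<in>A. N \<omega> \<partial>M) = expectation (\<lambda>\<omega>. N \<omega> * indicator B (X t \<omega>))"
      unfolding set_lebesgue_integral_def by (intro Bochner_Integration.integral_cong) (auto simp: B indicator_def)
    then show "(\<integral>\<omega>\<in>A. N \<omega> \<partial>M) = (\<integral>\<omega>\<in>A. 0 \<partial>M)" using ind0[OF B(1)] by simp
  qed (use Ni in auto)
  note Nt = this
  \<comment> \<open>The sine is bounded, so it can be pulled through the conditional expectation,
    and its covariance with N is E(X t N) times a positive exponential.\<close>
  have "expectation (\<lambda>\<omega>. sin (X t \<omega>) * N \<omega>) = expectation (\<lambda>\<omega>. sin (X t \<omega>) * real_cond_exp M (vimage_algebra (space M) (X t) borel) N \<omega>)"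
  proof (rule sigma_finite_subalgebra.real_cond_exp_intg(2)[OF S[OF subG[OF XV'(3)]], symmetric])
    show "integrable M (\<lambda>\<omega>. sin (X t \<omega>) * N \<omega>)"
      by (rule Bochner_Integration.integrable_bound[OF Ni]) (auto simp: abs_mult intro!: mult_left_le_one_le)
    have "X t \<in> borel_measurable (vimage_algebra (space M) (X t) borel)"
      by (rule measurable_vimage_algebra1) auto
    then show "(\<lambda>\<omega>. sin (X t \<omega>)) \<in> borel_measurable (vimage_algebra (space M) (X t) borel)" by measurable
  qed simp
  also have "\<dots> = expectation (\<lambda>_. 0)" using Nt by (intro integral_cong_AE) auto
  finally have "expectation (\<lambda>\<omega>. N \<omega> * sin (X t \<omega>)) = 0" by (simp add: mult.commute)
  then have "expectation (\<lambda>\<omega>. X t \<omega> * N \<omega>) = 0" unfolding expectation_mult_sin[OF XV'(3) NV] by simp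
  then have "expectation (\<lambda>\<omega>. X r \<omega> * X t \<omega>) = \<beta> * expectation (\<lambda>\<omega>. X s \<omega> * X t \<omega>)"
    using NW[OF XV'(3)] by (simp add: mult.commute)
  then show ?thesis using vs by (simp add: \<beta>_def)
qed

text \<open>As r tends to 0, K r t has two competing terms, r^(a + 1) t^b / (a + 1) and B r^(1 + a +
  b), and the sign of b decides which survives in the Markov identity. For b > 0 this forces K 1 t =
  2 B t^b for all t > 1, incompatible with the growth of K 1 t - B; for b < 0 it forces W(0, 1, 2) =
  W(0, 1, 1), against strict monotonicity in t.\<close>

lemma not_markov:
  assumes "b \<noteq> 0"
  shows "\<not> markov_process M X"
proof
  assume mk: "markov_process M X"
  define K where "K r t = wint a b 0 r t + r powr (1 + a + b) * B" for r t
  have Kc: "expectation (\<lambda>\<omega>. X r \<omega> * X t \<omega>) = K r t" if "0 \<le> r" "r \<le> t" for r t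
    using cov[OF that] wint_full[OF a b, of r] that by (simp add: K_def)
  have id: "K r t * (2 * B) = K r 1 * K 1 t" if "0 < r" "r < 1" "1 < t" for r t
  proof -
    have "K 1 1 = 2 * B" using wint_full[OF a b, of 1] by (simp add: K_def)
    then show ?thesis using markov_covariance[OF mk that] Kc[of r t] Kc[of 1 1] Kc[of r 1] Kc[of 1 t] that by simp
  qed
  define lo hi where "lo r t = min (t powr b) ((t - r) powr b)" and "hi r t = max (t powr b) ((t - r) powr b)" for r t
  have sw: "lo r t * (r powr (a + 1) / (a + 1)) \<le> wint a b 0 r t" "wint a b 0 r t \<le> hi r t * (r powr (a + 1) / (a + 1))"
    if rt: "0 < r" "r < t" for r t
  proof -
    have "lo r t \<le> (t - u) powr b \<and> (t - u) powr b \<le> hi r t" if "0 < u" "u < r" for u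
      using powr_mono2[of b "t - r" "t - u"] powr_mono2[of b "t - u" t] powr_mono2'[of b "t - r" "t - u"] powr_mono2'[of b "t - u" t] rt that
      unfolding lo_def hi_def by (cases "b \<ge> 0") auto
    from wint_bounds_left[OF a b order_refl _ _ this] rt
    show "lo r t * (r powr (a + 1) / (a + 1)) \<le> wint a b 0 r t" "wint a b 0 r t \<le> hi r t * (r powr (a + 1) / (a + 1))"
      by auto
  qed
  have lim0: "((\<lambda>r. r powr (- (a + 1)) * wint a b 0 r t) \<longlongrightarrow> t powr b / (a + 1)) (at_right 0)" if "t > 0" for t
  proof (rule tendsto_sandwich)
    have l: "((\<lambda>r. (t - r) powr b) \<longlongrightarrow> t powr b) (at_right 0)" using that by (auto intro!: tendsto_eq_intros)
    show "((\<lambda>r. lo r t / (a + 1)) \<longlongrightarrow> t powr b / (a + 1)) (at_right 0)"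
      unfolding lo_def using tendsto_min[OF tendsto_const l, of "t powr b"] a by (intro tendsto_divide) auto
    show "((\<lambda>r. hi r t / (a + 1)) \<longlongrightarrow> t powr b / (a + 1)) (at_right 0)"
      unfolding hi_def using tendsto_max[OF tendsto_const l, of "t powr b"] a by (intro tendsto_divide) auto
    have ev: "\<forall>\<^sub>F r in at_right 0. 0 < r \<and> r < t"
      using that by (auto simp: eventually_at_right_field)
    have one: "r powr (- (a + 1)) * (x * (r powr (a + 1) / (a + 1))) = x / (a + 1)" if "r > 0" for r x
    proof -
      have "r powr (- (a + 1)) * r powr (a + 1) = 1" using that by (simp flip: powr_add)
      then have "x / (a + 1) * (r powr (- (a + 1)) * r powr (a + 1)) = x / (a + 1)" by simp
      then show ?thesis by (simp only: times_divide_eq_right times_divide_eq_left ac_simps)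
    qed
    show "\<forall>\<^sub>F r in at_right 0. lo r t / (a + 1) \<le> r powr (- (a + 1)) * wint a b 0 r t"
      using ev
    proof eventually_elim
      case (elim r)
      then have "r powr (- (a + 1)) * (lo r t * (r powr (a + 1) / (a + 1))) \<le> r powr (- (a + 1)) * wint a b 0 r t"
        by (intro mult_left_mono sw) auto
      then show ?case unfolding one[OF conjunct1[OF elim]] .
    qed
    show "\<forall>\<^sub>F r in at_right 0. r powr (- (a + 1)) * wint a b 0 r t \<le> hi r t / (a + 1)"
      using ev
    proof eventually_elim
      case (elim r)
      then have "r powr (- (a + 1)) * wint a b 0 r t \<le> r powr (- (a + 1)) * (hi r t * (r powr (a + 1) / (a + 1)))"
        by (intro mult_left_mono sw) auto
      then show ?case unfolding one[OF conjunct1[OF elim]] .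
    qed
  qed
  have ev1: "\<forall>\<^sub>F r in at_right 0. 0 < r \<and> r < (1::real)" by (auto simp: eventually_at_right_field intro: exI[of _ 1])
  have B0: "B > 0" by (rule B_pos)
  show False
  proof (cases "b > 0")
    case True
    have Klim: "((\<lambda>r. r powr (- (a + 1)) * K r t) \<longlongrightarrow> t powr b / (a + 1)) (at_right 0)" if "t > 0" for t
    proof -
      have "((\<lambda>r. r powr b * B) \<longlongrightarrow> 0 * B) (at_right 0)"
        using True by (intro tendsto_mult tendsto_const) real_asymp
      from tendsto_add[OF lim0[OF that] this]
      have 1: "((\<lambda>r. r powr (- (a + 1)) * wint a b 0 r t + r powr b * B) \<longlongrightarrow> t powr b / (a + 1)) (at_right 0)" by simp
      have "\<forall>\<^sub>F r in at_right 0. r powr (- (a + 1)) * wint a b 0 r t + r powr b * B = r powr (- (a + 1)) * K r t"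
        using ev1
      proof eventually_elim
        case (elim r)
        have "r powr (- (a + 1)) * r powr (1 + a + b) = r powr b" using elim by (simp flip: powr_add)
        then show ?case by (simp only: K_def distrib_left mult.assoc[symmetric])
      qed
      with 1 show ?thesis by (rule Lim_transform_eventually)
    qed
    have K1: "K 1 t = 2 * B * t powr b" if "t > 1" for t
    proof -
      have l1: "((\<lambda>r. r powr (- (a + 1)) * K r t * (2 * B)) \<longlongrightarrow> t powr b / (a + 1) * (2 * B)) (at_right 0)"
        using that by (intro tendsto_mult_right Klim) auto
      have l2: "((\<lambda>r. r powr (- (a + 1)) * K r 1 * K 1 t) \<longlongrightarrow> 1 powr b / (a + 1) * K 1 t) (at_right 0)"
        by (intro tendsto_mult_right Klim) auto
      have "\<forall>\<^sub>F r in at_right 0. r powr (- (a + 1)) * K r 1 * K 1 t = r powr (- (a + 1)) * K r t * (2 * B)"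
        using ev1 by eventually_elim (use id that in \<open>simp add: mult.assoc\<close>)
      from tendsto_unique[OF trivial_limit_at_right_real l1 Lim_transform_eventually[OF l2 this]]
      have "t powr b / (a + 1) * (2 * B) = 1 powr b / (a + 1) * K 1 t" .
      then show ?thesis using a by (simp add: field_simps)
    qed
    have w1: "(t - 1) powr b / (a + 1) \<le> K 1 t - B" "K 1 t - B \<le> t powr b / (a + 1)" if "t > 1" for t
    proof -
      have "lo 1 t = (t - 1) powr b" "hi 1 t = t powr b"
        using that True powr_mono2[of b "t - 1" t] by (auto simp: lo_def hi_def)
      then show "(t - 1) powr b / (a + 1) \<le> K 1 t - B" "K 1 t - B \<le> t powr b / (a + 1)"
        using sw[of 1 t] that by (auto simp: K_def)
    qed
    \<comment> \<open>The kernel over {0..1} is at most t^b; after division by t^b the constant B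
      disappears as t tends to infinity.\<close>
    have B2: "2 * B \<le> 1 / (a + 1)"
    proof (rule tendsto_lowerbound)
      show "((\<lambda>t::real. 1 / (a + 1) + B * t powr (- b)) \<longlongrightarrow> 1 / (a + 1)) at_top" using True by real_asymp
      show "\<forall>\<^sub>F t in at_top. 2 * B \<le> 1 / (a + 1) + B * t powr (- b)"
        using eventually_gt_at_top[of 1]
      proof eventually_elim
        case (elim t)
        have "2 * B * t powr b - B \<le> t powr b / (a + 1)" using w1(2)[OF elim] K1[OF elim] by simp
        then have 1: "t powr (- b) * (2 * B * t powr b - B) \<le> t powr (- b) * (t powr b / (a + 1))" by (intro mult_left_mono) auto
        have 2: "t powr (- b) * t powr b = 1" using elim by (simp flip: powr_add)
        have 3: "t powr (- b) * (2 * B * t powr b - B) = 2 * B * (t powr (- b) * t powr b) - B * t powr (- b)"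
          by (simp add: algebra_simps)
        have 4: "t powr (- b) * (t powr b / (a + 1)) = (t powr (- b) * t powr b) / (a + 1)" by simp
        from 1 have "2 * B - B * t powr (- b) \<le> 1 / (a + 1)" unfolding 3 4 2 mult_1_right .
        then show ?case by (simp only: diff_le_eq)
      qed
    qed simp
    \<comment> \<open>Combined with 2 B \<le> 1 / (a + 1), the lower bound for K 1 t leaves B below
      (t^b - (t - 1)^b) / (a + 1), which tends to 0 because b < 1.\<close>
    have "B \<le> 0"
    proof (rule tendsto_lowerbound)
      show "((\<lambda>t::real. (t powr b - (t - 1) powr b) / (a + 1)) \<longlongrightarrow> 0) at_top"
        using True b1 a by real_asymp
      show "\<forall>\<^sub>F t in at_top. B \<le> (t powr b - (t - 1) powr b) / (a + 1)"
        using eventually_gt_at_top[of 1]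
      proof eventually_elim
        case (elim t)
        have "(t - 1) powr b / (a + 1) \<le> 2 * B * t powr b - B" using w1(1)[OF elim] K1[OF elim] by simp
        moreover have "2 * B * t powr b \<le> 1 / (a + 1) * t powr b" by (intro mult_right_mono B2) simp
        then have "2 * B * t powr b \<le> t powr b / (a + 1)" by simp
        ultimately show ?case unfolding diff_divide_distrib by linarith
      qed
    qed simp
    then show False using B0 by simp
  next
    case False
    then have bn: "b < 0" using assms by simp
    have Klim: "((\<lambda>r. r powr (- (1 + a + b)) * K r t) \<longlongrightarrow> B) (at_right 0)" if "t > 0" for t
    proof -
      have "((\<lambda>r. r powr (- b)) \<longlongrightarrow> (0::real)) (at_right 0)" using bn by real_asymp
      from tendsto_add[OF tendsto_mult[OF this lim0[OF that]] tendsto_const[of B]]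
      have 1: "((\<lambda>r. r powr (- b) * (r powr (- (a + 1)) * wint a b 0 r t) + B) \<longlongrightarrow> B) (at_right 0)" by simp
      have "\<forall>\<^sub>F r in at_right 0. r powr (- b) * (r powr (- (a + 1)) * wint a b 0 r t) + B = r powr (- (1 + a + b)) * K r t"
        using ev1
      proof eventually_elim
        case (elim r)
        have "r powr (- b) * r powr (- (a + 1)) = r powr (- (1 + a + b))" by (simp flip: powr_add add: algebra_simps)
        moreover have "r powr (- (1 + a + b)) * r powr (1 + a + b) = 1" using elim by (simp flip: powr_add)
        ultimately show ?case by (simp only: K_def distrib_left mult.assoc[symmetric] mult_1_left)
      qed
      with 1 show ?thesis by (rule Lim_transform_eventually)
    qed
    have l1: "((\<lambda>r. r powr (- (1 + a + b)) * K r 2 * (2 * B)) \<longlongrightarrow> B * (2 * B)) (at_right 0)"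
      by (intro tendsto_mult_right Klim) auto
    have l2: "((\<lambda>r. r powr (- (1 + a + b)) * K r 1 * K 1 2) \<longlongrightarrow> B * K 1 2) (at_right 0)"
      by (intro tendsto_mult_right Klim) auto
    have "\<forall>\<^sub>F r in at_right 0. r powr (- (1 + a + b)) * K r 1 * K 1 2 = r powr (- (1 + a + b)) * K r 2 * (2 * B)"
      using ev1
    proof eventually_elim
      case (elim r)
      then show ?case using id[of r 2] by (simp add: mult.assoc)
    qed
    from tendsto_unique[OF trivial_limit_at_right_real l1 Lim_transform_eventually[OF l2 this]]
    have "B * (2 * B) = B * K 1 2" .
    then have "wint a b 0 1 2 = B" using B0 by (simp add: K_def)
    moreover have "wint a b 0 1 1 = B" using wint_full[OF a b, of 1] by simp
    moreover have "wint a b 0 1 2 - wint a b 0 1 1 < 0" using wint_diff(3)[OF a b, of 0 1 1 2] bn by simp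
    ultimately show False by simp
  qed
qed

end

lemma weighted_fbm_gaussian_space:
  assumes "a > -1" "-1 < b" "b < 1" "\<bar>b\<bar> \<le> 1 + a" and X: "weighted_fbm M a b X"
  shows "\<exists>V. weighted_fbm_space M V a b X"
proof -
  note cg = X[unfolded weighted_fbm_def]
  have "\<exists>V. gaussian_space M V \<and> (\<forall>t\<ge>0. X t \<in> V)"
    by (intro exI conjI allI impI) (rule gaussian_space_span[OF cg]; assumption?)+
  then obtain V where V: "gaussian_space M V" "\<And>t. t \<ge> 0 \<Longrightarrow> X t \<in> V"
    by (elim exE conjE) (rule that, assumption, simp)
  interpret gaussian_space M V by (rule V(1))
  have "weighted_fbm_space M V a b X"
  proof unfold_locales
    fix s t :: real assume st: "0 \<le> s" "s \<le> t"
    then have "expectation (\<lambda>\<omega>. X s \<omega> * X t \<omega>) = (LINT u:{0..s}|lborel. u powr a * ((t - u) powr b + (s - u) powr b))"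
      using cg unfolding centered_gaussian_process_def by (simp add: min_absorb1)
    also have "\<dots> = wint a b 0 s t + wint a b 0 s s"
      unfolding wint_def distrib_left using assms st by (intro set_integral_add(2) wint_integrable) auto
    finally show "expectation (\<lambda>\<omega>. X s \<omega> * X t \<omega>) = wint a b 0 s t + wint a b 0 s s" .
  qed (use assms V(2) in auto)
  then show ?thesis ..
qed

theorem theorem2p4:
  fixes M :: "'a measure" and a b :: real and \<xi> :: "real \<Rightarrow> 'a \<Rightarrow> real"
  assumes "a > -1" and "-1 < b" and "b < 1" and "\<bar>b\<bar> \<le> 1 + a"
    and "weighted_fbm M a b \<xi>"
  shows
    "(\<forall>c>0. fdd_equal M (\<lambda>t. \<xi> (c * t)) M (\<lambda>t \<omega>. c powr ((1 + a + b) / 2) * \<xi> t \<omega>)) \<and>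

     (\<forall>s t. 0 \<le> s \<and> s < t \<longrightarrow>
        increment_sq M \<xi> s t = 2 * (LINT u:{s..t}|lborel. u powr a * (t - u) powr b)) \<and>

     (a \<ge> 0 \<longrightarrow> (\<forall>T>0. \<exists>C. \<forall>s\<in>{0..T}. \<forall>t\<in>{0..T}.
        increment_sq M \<xi> s t \<le> C * \<bar>t - s\<bar> powr (b + 1))) \<and>
     (a < 0 \<longrightarrow> (\<forall>\<epsilon>>0. \<exists>C. \<forall>s\<ge>\<epsilon>. \<forall>t\<ge>\<epsilon>.
        increment_sq M \<xi> s t \<le> C * \<bar>t - s\<bar> powr (b + 1))) \<and>

     (a < 0 \<and> 1 + a + b > 0 \<longrightarrow> (\<exists>C. \<forall>s\<ge>0. \<forall>t\<ge>0.
        increment_sq M \<xi> s t \<le> C * \<bar>t - s\<bar> powr (1 + a + b))) \<and>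

     (a > 0 \<longrightarrow> (\<forall>\<epsilon>>0. \<exists>C>0. \<forall>s\<ge>\<epsilon>. \<forall>t\<ge>\<epsilon>.
        increment_sq M \<xi> s t \<ge> C * \<bar>t - s\<bar> powr (b + 1))) \<and>
     (a \<le> 0 \<longrightarrow> (\<forall>T>0. \<exists>C>0. \<forall>s\<in>{0..T}. \<forall>t\<in>{0..T}.
        increment_sq M \<xi> s t \<ge> C * \<bar>t - s\<bar> powr (b + 1))) \<and>

     (\<not> (a < 0 \<and> b < 0 \<and> a + b = -1) \<longrightarrow> continuous_process M \<xi>) \<and>
     (a < 0 \<and> b < 0 \<and> a + b = -1 \<longrightarrow> discontinuous_at_0 M \<xi>) \<and>

     (\<forall>r v s t. 0 \<le> r \<and> r < v \<and> v \<le> s \<and> s < t \<longrightarrow>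
        increment_cov M \<xi> r v s t =
          (LINT u:{r..v}|lborel. u powr a * ((t - u) powr b - (s - u) powr b)) \<and>
        (b > 0 \<longrightarrow> increment_cov M \<xi> r v s t > 0) \<and>
        (b = 0 \<longrightarrow> increment_cov M \<xi> r v s t = 0) \<and>
        (b < 0 \<longrightarrow> increment_cov M \<xi> r v s t < 0)) \<and>

     (\<forall>r v s t. 0 \<le> r \<and> r < v \<and> v \<le> s \<and> s < t \<longrightarrow>
        ((\<lambda>T. T powr (1 - b) * increment_cov M \<xi> r v (s + T) (t + T)) \<longlongrightarrow>
          b / (a + 1) * (t - s) * (v powr (a + 1) - r powr (a + 1))) at_top) \<and>

     (\<forall>(N :: 'b measure) B. fbm N ((1 + b) / 2) B \<longrightarrow>
        fdd_converges M (\<lambda>T t \<omega>. T powr (- a / 2) * (\<xi> (t + T) \<omega> - \<xi> T \<omega>)) at_top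
          N (\<lambda>t \<omega>. (2 / (1 + b)) powr (1 / 2) * B t \<omega>)) \<and>

     (\<forall>t. 0 \<le> t \<and> (a < 0 \<longrightarrow> 0 < t) \<longrightarrow>
        ((\<lambda>\<epsilon>. \<epsilon> powr (- b - 1) * increment_sq M \<xi> t (t + \<epsilon>)) \<longlongrightarrow>
          2 / (b + 1) * (if a = 0 then 1 else t powr a)) (at_right 0)) \<and>
     (\<forall>t\<ge>0.
        ((\<lambda>T. T powr (- (1 + a + b)) * increment_sq M \<xi> t (t + T)) \<longlongrightarrow>
          2 * (LINT u:{0..1}|lborel. u powr a * (1 - u) powr b)) at_top) \<and>
     asymptotically_stationary_increments M \<xi> {0..} at_top \<and>
     (asymptotically_stationary_increments M \<xi> {0<..} (at_right 0) \<longleftrightarrow> a = 0) \<and>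

     (b \<noteq> 0 \<longrightarrow>
        \<not> semimartingale M (natural_filtration M \<xi>) \<xi> \<and>
        \<not> semimartingale M (usual_augmentation M (natural_filtration M \<xi>)) \<xi>) \<and>

     (b \<noteq> 0 \<longrightarrow> \<not> markov_process M \<xi>)"
proof -
  obtain V where "weighted_fbm_space M V a b \<xi>"
    using weighted_fbm_gaussian_space[OF assms] ..
  then interpret weighted_fbm_space M V a b \<xi> .
  let ?F = "natural_filtration M \<xi>"
  show ?thesis
  proof (intro conjI, goal_cases)
    case 1
    show ?case using self_similar by blast
  next
    case 2
    show ?case using increment_sq_eq unfolding wint_def by auto
  next
    case 3
    show ?case using upper_nonneg_exponent by blast
  next
    case 4
    show ?case using upper_neg_exponent by blast
  next
    case 5
    show ?case using upper_self_similar by (meson less_imp_le)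
  next
    case 6
    show ?case
    proof (intro impI allI)
      fix e :: real assume "a > 0" "e > 0"
      then show "\<exists>C>0. \<forall>s\<ge>e. \<forall>t\<ge>e. increment_sq M \<xi> s t \<ge> C * \<bar>t - s\<bar> powr (b + 1)"
        using b lower_pos_exponent[of e] by (intro exI[of _ "2 * e powr a / (b + 1)"]) auto
    qed
  next
    case 7
    show ?case
    proof (intro impI allI)
      fix T :: real assume "a \<le> 0" "T > 0"
      then show "\<exists>C>0. \<forall>s\<in>{0..T}. \<forall>t\<in>{0..T}. increment_sq M \<xi> s t \<ge> C * \<bar>t - s\<bar> powr (b + 1)"
        using b lower_nonpos_exponent[of _ T] by (intro exI[of _ "2 * T powr a / (b + 1)"]) auto
    qed
  next
    case 8
    show ?case using continuous_paths by blast
  next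
    case 9
    show ?case using discontinuous by blast
  next
    case 10
    show ?case
    proof (intro allI impI, elim conjE)
      fix r v s t :: real assume o: "0 \<le> r" "r < v" "v \<le> s" "s < t"
      have eq: "increment_cov M \<xi> r v s t = wint a b r v t - wint a b r v s"
        using o by (intro increment_cov_eq) auto
      \<comment> \<open>For b = 0 the two kernels cancel except where a base vanishes:
        \<open>0 powr 0 = 0\<close> spoils this at u = s alone, a null set.\<close>
      have "increment_cov M \<xi> r v s t = 0" if "b = 0"
      proof -
        have "(LINT u:{r..v}|lborel. u powr a * ((t - u) powr 0 - (s - u) powr 0)) = (LINT u:{r..v}|lborel. 0)"
          unfolding set_lebesgue_integral_def
        proof (rule integral_cong_AE)
          show "AE u in lborel. indicator {r..v} u *\<^sub>R (u powr a * ((t - u) powr 0 - (s - u) powr 0)) = indicator {r..v} u *\<^sub>R (0::real)"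
            using AE_lborel_singleton[of s] by eventually_elim (use o in \<open>auto simp: indicator_def\<close>)
        qed auto
        then show ?thesis unfolding eq wint_diff(1)[OF a b o] unfolding that by simp
      qed
      then show "increment_cov M \<xi> r v s t = (LINT u:{r..v}|lborel. u powr a * ((t - u) powr b - (s - u) powr b)) \<and>
        (b > 0 \<longrightarrow> increment_cov M \<xi> r v s t > 0) \<and> (b = 0 \<longrightarrow> increment_cov M \<xi> r v s t = 0) \<and>
        (b < 0 \<longrightarrow> increment_cov M \<xi> r v s t < 0)"
        using wint_diff[OF a b o] unfolding eq by blast
    qed
  next
    case 11
    show ?case using long_range by blast
  next
    case 12
    show ?case using fbm_limit by blast
  next
    case 13
    show ?case using short_time by blast
  next
    case 14
    show ?case by (intro allI impI long_time[unfolded wB_def[OF a b] wint_def])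
  next
    case 15
    show ?case by (rule asymptotically_stationary_long)
  next
    case 16
    show ?case by (rule asymptotically_stationary_short)
  next
    case 17
    have "\<not> semimartingale M ?F \<xi>" if "b \<noteq> 0"
    proof (rule not_semimartingale[OF that natural_filtration_subalgebra])
      show "subalgebra (?F t) (?F s)" if "s \<le> t" for s t
        using natural_filtration_mono[OF that] by (simp add: subalgebra_def space_natural_filtration)
    qed (rule natural_filtration_adapted, auto)
    moreover have "\<not> semimartingale M (usual_augmentation M ?F) \<xi>" if "b \<noteq> 0"
      by (rule not_semimartingale[OF that]) (rule usual_augmentation_props; assumption)+
    ultimately show ?case by blast
  next
    case 18
    show ?case using not_markov by blast
  qed
qed

end
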